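(* Let $\theta\in\{-1,0,1\}$. When the interior penalty parameter $\gamma$ is large enough, there exists a constant $\mu_0>0$ independent of $h$ such that $$\mathrm{Re}\,A_h(\mathbf u_h,\mathbf u_h)\ \ge\ \mu_0\,\|\mathbf u_h\|_h^2\qquad\forall\,\mathbf u_h\in\mathbb X_h .$$
   Context: Let $d\in\{2,3\}$, let $\Omega\subset\mathbb R^d$ be a bounded polyhedral domain, $\mu>0$ a constant, and $\boldsymbol\beta\in W^{1,\infty}(\Omega)^d$ a given (real) divergence-free vector field (standard scaling: $\|\boldsymbol\beta\|_{\infty,\Omega}\sim1$ if $\mu\le\|\boldsymbol\beta\|_{\infty,\Omega}$, and $\mu\sim1$ otherwise). All functions are complex valued. Mesh. $\mathcal T_h=\{\tau\}$ belongs to a regular (shape-regular) family of simplicial partitions of $\Omega$, $h_\tau=\mathrm{diam}\,\tau$, $h=\max_\tau h_\tau$. $\mathcal E_h^i$, $\mathcal E_h^b$ are the sets of interior and boundary faces (edges if $d=2$), $\mathcal E_h=\mathcal E_h^i\cup\mathcal E_h^b$, and $h_F$ is the diameter of $F$. For $F\in\mathcal E_h^i$, $F=\tau^+\cap\tau^-$, $\mathbf n^+$ is the unit normal pointing from $\tau^+$ to $\tau^-$, $\mathbf n^-=-\mathbf n^+$, and $^\pm$ denotes traces from $\tau^\pm$. The mean is $\{\varphi\}=\frac12(\varphi^++\varphi^-)$. Jumps: for scalars $[\![\varphi]\!]=\varphi^+\mathbf n^++\varphi^-\mathbf n^-$; for vectors $[\![\boldsymbol\varphi]\!]=\boldsymbol\varphi^+\cdot\mathbf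 n^++\boldsymbol\varphi^-\cdot\mathbf n^-$; full jump $[\![\underline{\boldsymbol\varphi}]\!]=\boldsymbol\varphi^+\otimes\mathbf n^++\boldsymbol\varphi^-\otimes\mathbf n^-$ with $(\boldsymbol\varphi\otimes\mathbf n)_{ij}=\varphi_in_j$; for $d\times d$ tensors $[\![\boldsymbol\chi]\!]=\boldsymbol\chi^+\mathbf n^++\boldsymbol\chi^-\mathbf n^-$. On boundary faces jumps are defined by setting $^-$ values to zero and means by setting $^-$ values equal to $^+$ values. For $k\ge1$, $\mathbb X_h=\{\mathbf v_h\in L^2(\Omega)^d:\mathbf v_h|_\tau\in P_k(\tau)^d\ \forall\tau\in\mathcal T_h\}$. With penalty parameter $\gamma>0$ define $$\begin{aligned}A_h(\mathbf u,\mathbf v)=&\sum_{\tau}\int_\tau\mu\nabla\mathbf u:\overline{\nabla\mathbf v}\,dx+\sum_\tau\int_\tau(\boldsymbol\beta\cdot\nabla)\mathbf u\cdot\overline{\mathbf v}\,dx-\sum_{F\in\mathcal E_h}\int_F\mu\{\nabla\mathbf u\}:\overline{[\![\underline{\mathbf v}]\!]}ds+\theta\sum_{F\in\mathcal E_h}\int_F\mu\overline{\{\nabla\mathbf v\}}:[\![\underline{\mathbf u}]\!]ds\\&+\sum_{F\in\mathcal E_h}\int_F\frac{\gamma}{h_F}[\![\underline{\mathbf u}]\!]:\overline{[\![\underline{\mathbf v}]\!]}ds-\sum_{F\in\mathcal E_h^i}\int_F[\![\mathbf u\otimes\boldsymbol\beta]\!]\cdot\overline{\{\mathbf v\}}ds-\frac12\sum_{F\in\mathcal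 E_h^b}\int_F(\mathbf u\otimes\boldsymbol\beta)\mathbf n\cdot\overline{\mathbf v}ds,\end{aligned}$$ where $\theta=-1$ is the SIP, $\theta=1$ the NIP, $\theta=0$ the IIP method, and $$\|\mathbf v\|_h^2=\sum_\tau\|\nabla\mathbf v\|_{0,\tau}^2+\sum_{F\in\mathcal E_h}\int_F\frac{\gamma}{h_F}|[\![\underline{\mathbf v}]\!]|^2ds .$$ *)

theory Defs
  imports "HOL-Analysis.Analysis"
begin

section \<open>Complex vectors and tensors\<close>

definition cvec :: "real^'n \<Rightarrow> complex^'n" where
  "cvec x = (\<chi> i. complex_of_real (x $ i))"

definition outer :: "complex^'n \<Rightarrow> complex^'n \<Rightarrow> complex^'n^'n" (infixl \<open>\<otimes>\<^sub>t\<close> 75) where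
  "a \<otimes>\<^sub>t b = (\<chi> i j. a $ i * b $ j)"

text \<open>Both products below carry the complex conjugation on the second factor, i.e.
  they are \<open>a \<cdot> conj b\<close> and \<open>A : conj B\<close>.\<close>

definition cdot :: "complex^'n \<Rightarrow> complex^'n \<Rightarrow> complex" where
  "cdot a b = (\<Sum>i\<in>UNIV. a $ i * cnj (b $ i))"

definition cddot :: "complex^'n^'n \<Rightarrow> complex^'n^'n \<Rightarrow> complex" where
  "cddot A B = (\<Sum>i\<in>UNIV. \<Sum>j\<in>UNIV. A $ i $ j * cnj (B $ i $ j))"


section \<open>Derivatives and Sobolev regularity\<close>

definition partial_deriv :: "'n \<Rightarrow> (real^'n \<Rightarrow> 'b::real_normed_vector) \<Rightarrow> real^'n \<Rightarrow> 'b" where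
  "partial_deriv j f x = frechet_derivative f (at x) (axis j 1)"

definition grad :: "(real^'n \<Rightarrow> complex^'n) \<Rightarrow> real^'n \<Rightarrow> complex^'n^'n" where
  "grad u x = (\<chi> i j. partial_deriv j u x $ i)"

definition test_function :: "(real^'n) set \<Rightarrow> (real^'n \<Rightarrow> real) \<Rightarrow> bool" where
  "test_function \<Omega> \<phi> \<longleftrightarrow>
     (\<forall>x. \<phi> differentiable (at x)) \<and>
     (\<forall>j. continuous_on UNIV (partial_deriv j \<phi>)) \<and>
     compact (closure {x. \<phi> x \<noteq> 0}) \<and> closure {x. \<phi> x \<noteq> 0} \<subseteq> \<Omega>"

text \<open>Weak first-order derivatives, tested (as in Gilbarg and Trudinger) against
  compactly supported \<open>C\<^sup>1\<close> functions.\<close>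

definition has_weak_partial ::
    "(real^'n) set \<Rightarrow> 'n \<Rightarrow> (real^'n \<Rightarrow> real) \<Rightarrow> (real^'n \<Rightarrow> real) \<Rightarrow> bool" where
  "has_weak_partial \<Omega> j f g \<longleftrightarrow>
     (\<forall>K. compact K \<and> K \<subseteq> \<Omega> \<longrightarrow> f absolutely_integrable_on K \<and> g absolutely_integrable_on K) \<and>
     (\<forall>\<phi>. test_function \<Omega> \<phi> \<longrightarrow>
        (LINT x:\<Omega>|lebesgue. f x * partial_deriv j \<phi> x) = - (LINT x:\<Omega>|lebesgue. g x * \<phi> x))"

definition L_infty :: "(real^'n) set \<Rightarrow> (real^'n \<Rightarrow> real) set" where
  "L_infty \<Omega> = {f. f \<in> borel_measurable (lebesgue_on \<Omega>) \<and>
                   (\<exists>C. AE x in lebesgue_on \<Omega>. \<bar>f x\<bar> \<le> C)}"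

definition W1_infty :: "(real^'n) set \<Rightarrow> (real^'n \<Rightarrow> real) set" where
  "W1_infty \<Omega> = {f \<in> L_infty \<Omega>. \<forall>j. \<exists>g\<in>L_infty \<Omega>. has_weak_partial \<Omega> j f g}"

text \<open>Elements of \<open>W\<^sup>1\<^sup>,\<^sup>\<infinity>(\<Omega>)\<close> are identified with their continuous representative, so
  that the traces of the field on mesh faces are honest limits.\<close>

definition W1_infty_field :: "(real^'n) set \<Rightarrow> (real^'n \<Rightarrow> real^'n) \<Rightarrow> bool" where
  "W1_infty_field \<Omega> \<beta> \<longleftrightarrow> (\<forall>i. (\<lambda>x. \<beta> x $ i) \<in> W1_infty \<Omega>) \<and> continuous_on \<Omega> \<beta>"

definition divergence_free :: "(real^'n) set \<Rightarrow> (real^'n \<Rightarrow> real^'n) \<Rightarrow> bool" where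
  "divergence_free \<Omega> \<beta> \<longleftrightarrow>
     (\<exists>g. (\<forall>i. has_weak_partial \<Omega> i (\<lambda>x. \<beta> x $ i) (g i)) \<and>
          (AE x in lebesgue_on \<Omega>. (\<Sum>i\<in>UNIV. g i x) = 0))"


section \<open>Polyhedral domains and simplicial meshes\<close>

text \<open>The condition \<open>interior (closure \<Omega>) = \<Omega>\<close> says that the domain lies on one side of its
  boundary (no slits); convexity is not required.\<close>

definition polyhedral_domain :: "(real^'n) set \<Rightarrow> bool" where
  "polyhedral_domain \<Omega> \<longleftrightarrow>
     open \<Omega> \<and> connected \<Omega> \<and> \<Omega> \<noteq> {} \<and> interior (closure \<Omega>) = \<Omega> \<and>
     (\<exists>\<P>. finite \<P> \<and> (\<forall>P\<in>\<P>. polyhedron P) \<and> closure \<Omega> = \<Union>\<P>)"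

definition simplicial_mesh :: "(real^'n) set \<Rightarrow> (real^'n) set set \<Rightarrow> bool" where
  "simplicial_mesh \<Omega> \<T> \<longleftrightarrow>
     triangulation \<T> \<and> (\<forall>\<tau>\<in>\<T>. int CARD('n) simplex \<tau>) \<and> \<Union>\<T> = closure \<Omega>"

definition inball_diameter :: "(real^'n) set \<Rightarrow> real" where
  "inball_diameter \<tau> = Sup {2 * r | r c. 0 \<le> r \<and> cball c r \<subseteq> \<tau>}"

definition shape_regular :: "(real^'n) set set set \<Rightarrow> bool" where
  "shape_regular \<M> \<longleftrightarrow> (\<exists>\<sigma>>0. \<forall>\<T>\<in>\<M>. \<forall>\<tau>\<in>\<T>. diameter \<tau> \<le> \<sigma> * inball_diameter \<tau>)"

definition mesh_faces :: "(real^'n) set set \<Rightarrow> (real^'n) set set" where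
  "mesh_faces \<T> = {F. \<exists>\<tau>\<in>\<T>. F facet_of \<tau>}"

definition interior_faces :: "(real^'n) set set \<Rightarrow> (real^'n) set set" where
  "interior_faces \<T> = {F. \<exists>\<tau>\<in>\<T>. \<exists>\<tau>'\<in>\<T>. \<tau> \<noteq> \<tau>' \<and> F facet_of \<tau> \<and> F facet_of \<tau>'}"

definition boundary_faces :: "(real^'n) set set \<Rightarrow> (real^'n) set set" where
  "boundary_faces \<T> = mesh_faces \<T> - interior_faces \<T>"

definition outer_normal :: "(real^'n) set \<Rightarrow> (real^'n) set \<Rightarrow> real^'n" where
  "outer_normal \<tau> F = (THE n. norm n = 1 \<and> (\<forall>x\<in>F. \<forall>y\<in>\<tau>. (y - x) \<bullet> n \<le> 0))"

text \<open>The surface measure \<open>ds\<close>: Lebesgue measure on the hyperplane spanned by \<open>F\<close>, transported by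
  orthonormal coordinates (the construction by which the library obtains \<^const>\<open>lborel\<close> on
  the whole space). The result depends on neither the chosen origin nor the chosen basis.\<close>

definition face_measure :: "(real^'n) set \<Rightarrow> (real^'n) measure" where
  "face_measure F =
     (let a = (SOME a. a \<in> F);
          B = (SOME B. pairwise orthogonal B \<and> (\<forall>b\<in>B. norm b = 1) \<and>
                       span B = span {x - y | x y. x \<in> F \<and> y \<in> F})
      in distr (\<Pi>\<^sub>M b\<in>B. (lborel :: real measure)) borel (\<lambda>t. a + (\<Sum>b\<in>B. t b *\<^sub>R b)))"


section \<open>Traces, means and jumps\<close>

definition trace_from :: "(real^'n) set \<Rightarrow> (real^'n \<Rightarrow> 'b::t2_space) \<Rightarrow> real^'n \<Rightarrow> 'b" where
  "trace_from \<tau> f x = Lim (at x within interior \<tau>) f"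

text \<open>An interior face has two adjacent elements (\<open>\<tau>\<^sup>+\<close> and \<open>\<tau>\<^sup>-\<close>), a boundary face only one.
  Summing over the adjacent elements, each with its own outward normal, thus gives
  \<open>\<phi>\<^sup>+ n\<^sup>+ + \<phi>\<^sup>- n\<^sup>-\<close> on interior faces and \<open>\<phi>\<^sup>+ n\<^sup>+\<close> on boundary faces, and averaging over them gives
  \<open>(\<phi>\<^sup>+ + \<phi>\<^sup>-)/2\<close> and \<open>\<phi>\<^sup>+\<close> respectively; no labelling of the two sides has to be chosen.\<close>

definition adjacent :: "(real^'n) set set \<Rightarrow> (real^'n) set \<Rightarrow> (real^'n) set set" where
  "adjacent \<T> F = {\<tau>\<in>\<T>. F facet_of \<tau>}"

definition mean :: "(real^'n) set set \<Rightarrow> (real^'n) set \<Rightarrow> (real^'n \<Rightarrow> 'b::real_normed_vector)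
    \<Rightarrow> real^'n \<Rightarrow> 'b" where
  "mean \<T> F \<phi> x = (1 / real (card (adjacent \<T> F))) *\<^sub>R (\<Sum>\<tau>\<in>adjacent \<T> F. trace_from \<tau> \<phi> x)"

definition full_jump :: "(real^'n) set set \<Rightarrow> (real^'n) set \<Rightarrow> (real^'n \<Rightarrow> complex^'n)
    \<Rightarrow> real^'n \<Rightarrow> complex^'n^'n" where
  "full_jump \<T> F \<phi> x = (\<Sum>\<tau>\<in>adjacent \<T> F. trace_from \<tau> \<phi> x \<otimes>\<^sub>t cvec (outer_normal \<tau> F))"

definition tensor_jump :: "(real^'n) set set \<Rightarrow> (real^'n) set \<Rightarrow> (real^'n \<Rightarrow> complex^'n^'n)
    \<Rightarrow> real^'n \<Rightarrow> complex^'n" where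
  "tensor_jump \<T> F X x = (\<Sum>\<tau>\<in>adjacent \<T> F. trace_from \<tau> X x *v cvec (outer_normal \<tau> F))"


section \<open>The discrete space, the form and the norm\<close>

definition poly_space :: "nat \<Rightarrow> (real^'n \<Rightarrow> complex) set" where
  "poly_space k = {p. \<exists>c :: ('n \<Rightarrow> nat) \<Rightarrow> complex. \<forall>x.
     p x = (\<Sum>\<alpha> | (\<Sum>j\<in>UNIV. \<alpha> j) \<le> k. c \<alpha> * (\<Prod>j\<in>UNIV. complex_of_real (x $ j) ^ \<alpha> j))}"

text \<open>Each class in \<open>L\<^sup>2(\<Omega>)\<^sup>d\<close> is represented by functions that agree with the polynomial everywhere
  in the open simplex. Values on the mesh skeleton stay arbitrary; only traces are used there.\<close>

definition dg_space :: "(real^'n) set \<Rightarrow> (real^'n) set set \<Rightarrow> nat \<Rightarrow> (real^'n \<Rightarrow> complex^'n) set" where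
  "dg_space \<Omega> \<T> k =
     {v. v \<in> borel_measurable (lebesgue_on \<Omega>) \<and>
         integrable (lebesgue_on \<Omega>) (\<lambda>x. (norm (v x))\<^sup>2) \<and>
         (\<forall>\<tau>\<in>\<T>. \<forall>i. \<exists>p\<in>poly_space k. \<forall>x\<in>interior \<tau>. v x $ i = p x)}"

text \<open>In the last sum the jump and the mean reduce to the one-sided traces, so the integrand is
  \<open>(u \<otimes> \<beta>) n \<cdot> conj v\<close>.\<close>

definition dg_form ::
  "real \<Rightarrow> (real^'n \<Rightarrow> real^'n) \<Rightarrow> real \<Rightarrow> real \<Rightarrow> (real^'n) set set
     \<Rightarrow> (real^'n \<Rightarrow> complex^'n) \<Rightarrow> (real^'n \<Rightarrow> complex^'n) \<Rightarrow> complex" where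
  "dg_form \<mu> \<beta> \<theta> \<gamma> \<T> u v =
     (\<Sum>\<tau>\<in>\<T>. LINT x:\<tau>|lebesgue. complex_of_real \<mu> * cddot (grad u x) (grad v x))
   + (\<Sum>\<tau>\<in>\<T>. LINT x:\<tau>|lebesgue. cdot (grad u x *v cvec (\<beta> x)) (v x))
   - (\<Sum>F\<in>mesh_faces \<T>. LINT x:F|face_measure F.
        complex_of_real \<mu> * cddot (mean \<T> F (grad u) x) (full_jump \<T> F v x))
   + complex_of_real \<theta> * (\<Sum>F\<in>mesh_faces \<T>. LINT x:F|face_measure F.
        complex_of_real \<mu> * cddot (full_jump \<T> F u x) (mean \<T> F (grad v) x))
   + (\<Sum>F\<in>mesh_faces \<T>. LINT x:F|face_measure F.
        complex_of_real (\<gamma> / diameter F) * cddot (full_jump \<T> F u x) (full_jump \<T> F v x))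
   - (\<Sum>F\<in>interior_faces \<T>. LINT x:F|face_measure F.
        cdot (tensor_jump \<T> F (\<lambda>y. u y \<otimes>\<^sub>t cvec (\<beta> y)) x) (mean \<T> F v x))
   - 1 / 2 * (\<Sum>F\<in>boundary_faces \<T>. LINT x:F|face_measure F.
        cdot (tensor_jump \<T> F (\<lambda>y. u y \<otimes>\<^sub>t cvec (\<beta> y)) x) (mean \<T> F v x))"

definition dg_norm :: "real \<Rightarrow> (real^'n) set set \<Rightarrow> (real^'n \<Rightarrow> complex^'n) \<Rightarrow> real" where
  "dg_norm \<gamma> \<T> v = sqrt (
     (\<Sum>\<tau>\<in>\<T>. LINT x:\<tau>|lebesgue. (norm (grad v x))\<^sup>2)
   + (\<Sum>F\<in>mesh_faces \<T>. LINT x:F|face_measure F. \<gamma> / diameter F * (norm (full_jump \<T> F v x))\<^sup>2))"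

end

theory Submission
  imports Defs
begin

text \<open>
  Taking the real part of \<open>A\<^sub>h(u, u)\<close>, the convective terms vanish: on every simplex
  \<open>Re ((\<beta> \<cdot> \<nabla>) u \<cdot> conj u) = \<beta> \<cdot> \<nabla>\<bar>u\<bar>\<^sup>2 / 2\<close>, and since \<open>\<beta>\<close> is divergence free, the divergence theorem turns
  this into face integrals which the face terms of the convective part cancel. The term
  \<open>(\<theta> - 1) \<mu> Re \<integral> {\<nabla>u} : conj [u]\<close> is absorbed by Young's inequality and the inverse trace
  inequality \<open>h\<^sub>F \<integral>\<^sub>F \<bar>p\<bar>\<^sup>2 \<le> C \<integral>\<^sub>\<tau> \<bar>p\<bar>\<^sup>2\<close>, with \<open>C\<close> depending only on the degree, the dimension and the
  shape regularity.

  Both analytic ingredients rest on integration in polar form over the cone with apex \<open>v\<close> and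
  base \<open>F\<close>, \<open>\<integral>\<^sub>\<tau> f = \<integral>\<^sub>0\<^sup>1 H s\<^sup>d\<^sup>-\<^sup>1 \<integral>\<^sub>F f(v + s(y - v)) dS(y) ds\<close>. For the inverse trace inequality the value of
  a polynomial at \<open>y \<in> F\<close> is recovered from its values at \<open>k + 1\<close> equidistant points of the ray
  towards \<open>v\<close> by a vanishing finite difference, and the spacing is averaged. For the divergence
  theorem the weak formulation is tested with \<open>\<bar>u\<bar>\<^sup>2\<close> times a product of smooth steps in the
  barycentric coordinates; the gradient of this cutoff concentrates on the facets. A Lipschitz
  bound for \<open>W\<^sup>1\<^sup>,\<^sup>\<infinity>\<close> functions on convex sets makes the traces of \<open>\<beta>\<close> on the faces meaningful.
\<close>

section \<open>Integration over cones\<close>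

text \<open>Two gaps between the definitions and classical calculus shape the proof.
  \<open>face_measure\<close> is a pushforward along an orthonormal basis picked by
  \<open>SOME\<close>, so surface integrals are reached through Fubini in rotated coordinates; this
  calls for the rotation invariance of \<open>lborel\<close>, and makes one cone formula the source
  of every surface estimate. Moreover \<beta> is given on the open set \<Omega> with merely weak
  derivatives: on boundary faces its trace exists because it extends continuously from each simplex,
  and Gauss' theorem has to be regained from the weak identity.

  The inverse trace estimate uses no reference element: its constant is explicit in the difference
  coefficients, k and d, and the chain h_F \<le> diameter \<le> \<sigma> * inball \<le> \<sigma> *
  height brings in the mesh. With \<open>C\<close> equal to (d + 1) \<sigma> times this constant,
  plus 1, Young's inequality with weight h_F / (2 C) costs at most half of the gradient part and 2 C
  \<mu> of the penalty parameter, so \<gamma> \<ge> 4 C \<mu> leaves the factor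
  \<open>min (\<mu> / 2) (1 / 2)\<close>.\<close>

lemma nn_integral_lborel_translate:
  fixes f :: "'a::euclidean_space \<Rightarrow> ennreal"
  assumes [measurable]: "f \<in> borel_measurable borel"
  shows "(\<integral>\<^sup>+x. f (c + x) \<partial>lborel) = (\<integral>\<^sup>+x. f x \<partial>lborel)"
  by (subst (2) lborel_distr_plus[of c, symmetric]) (simp add: nn_integral_distr)

lemma nn_integral_lborel_uminus:
  fixes f :: "'a::euclidean_space \<Rightarrow> ennreal"
  assumes [measurable]: "f \<in> borel_measurable borel"
  shows "(\<integral>\<^sup>+x. f (- x) \<partial>lborel) = (\<integral>\<^sup>+x. f x \<partial>lborel)"
proof -
  have "lborel = density (distr lborel borel (\<lambda>x::'a. 0 + (-1) *\<^sub>R x)) (\<lambda>_. \<bar>-1::real\<bar> ^ DIM('a))"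
    by (rule lborel_affine) auto
  also have "\<dots> = distr lborel borel uminus"
    by (simp add: density_1)
  finally have *: "lborel = distr lborel borel (uminus :: 'a \<Rightarrow> 'a)" .
  show ?thesis
    by (subst (2) *) (simp add: nn_integral_distr)
qed

text \<open>Compares \<open>M(A) \<lambda>(B)\<close> with \<open>M(B) \<lambda>(A)\<close> by Fubini for \<open>1\<^sub>A(x) 1\<^sub>B(x + y)\<close>. It yields rotation
  invariance without a well-order on the index type, which \<open>measure_orthogonal_image\<close> requires.\<close>

lemma translation_invariant_eq_lborel:
  fixes M :: "'a::euclidean_space measure"
  assumes sets[measurable_cong]: "sets M = sets borel" and sf: "sigma_finite_measure M"
    and trans: "\<And>c f. f \<in> borel_measurable borel \<Longrightarrow> (\<integral>\<^sup>+x. f (c + x) \<partial>M) = (\<integral>\<^sup>+x. f x \<partial>M)"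
    and ball: "emeasure M (ball 0 1) = emeasure lborel (ball (0::'a) 1)"
  shows "M = lborel"
proof (rule measure_eqI)
  interpret M: sigma_finite_measure M by fact
  interpret MP: pair_sigma_finite M "lborel :: 'a measure" ..
  have key: "emeasure M A * emeasure lborel B = emeasure M B * emeasure lborel A"
    if [measurable]: "A \<in> sets borel" "B \<in> sets borel" for A B :: "'a set"
  proof -
    have "emeasure M A * emeasure lborel B
        = (\<integral>\<^sup>+x. indicator A x * (\<integral>\<^sup>+y. indicator B (x + y) \<partial>lborel) \<partial>M)"
      by (simp add: nn_integral_lborel_translate nn_integral_multc)
    also have "\<dots> = (\<integral>\<^sup>+x. (\<integral>\<^sup>+y. indicator A x * indicator B (x + y) \<partial>lborel) \<partial>M)"
      by (simp add: nn_integral_cmult)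
    also have "\<dots> = (\<integral>\<^sup>+y. (\<integral>\<^sup>+x. indicator A x * indicator B (x + y) \<partial>M) \<partial>lborel)"
      by (rule MP.Fubini'[symmetric]) simp
    also have "\<dots> = (\<integral>\<^sup>+y. (\<integral>\<^sup>+x. indicator A (- y + x) * indicator B (- y + x + y) \<partial>M) \<partial>lborel)"
      by (intro nn_integral_cong trans[symmetric]) simp
    also have "\<dots> = (\<integral>\<^sup>+y. (\<integral>\<^sup>+x. indicator A (- y + x) * indicator B x \<partial>M) \<partial>lborel)"
      by simp
    also have "\<dots> = (\<integral>\<^sup>+x. (\<integral>\<^sup>+y. indicator A (- y + x) * indicator B x \<partial>lborel) \<partial>M)"
      by (rule MP.Fubini') simp
    also have "\<dots> = (\<integral>\<^sup>+x. (\<integral>\<^sup>+y. indicator A (x + y) * indicator B x \<partial>lborel) \<partial>M)"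
    proof (rule nn_integral_cong)
      fix x
      show "(\<integral>\<^sup>+y. indicator A (- y + x) * indicator B x \<partial>lborel)
          = (\<integral>\<^sup>+y. indicator A (x + y) * (indicator B x::ennreal) \<partial>lborel)"
        using nn_integral_lborel_uminus[of "\<lambda>y. indicator A (x + y) * (indicator B x::ennreal)"]
        by (simp add: add.commute)
    qed
    also have "\<dots> = (\<integral>\<^sup>+x. emeasure lborel A * indicator B x \<partial>M)"
      by (rule nn_integral_cong) (simp add: nn_integral_lborel_translate nn_integral_multc)
    also have "\<dots> = emeasure M B * emeasure lborel A"
      by (simp add: nn_integral_cmult mult.commute[of "emeasure M B"])
    finally show ?thesis .
  qed
  show "sets M = sets lborel" using sets by simp
  fix A assume "A \<in> sets M"
  then have A: "A \<in> sets borel" using sets by simp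
  \<comment> \<open>The unit ball serves as the normalising set \<open>B\<close>: its volume is
    finite and nonzero and can therefore be cancelled.\<close>
  have fin: "emeasure lborel (ball (0::'a) 1) \<noteq> \<infinity>" "emeasure lborel (ball (0::'a) 1) \<noteq> 0"
    using emeasure_lborel_ball_finite[of "0::'a" 1] content_ball_pos[of 1 "0::'a"]
    by (auto simp: less_top[symmetric] measure_def)
  from key[OF A, of "ball 0 1"] ball
  have "emeasure M A * emeasure lborel (ball (0::'a) 1) = emeasure lborel A * emeasure lborel (ball (0::'a) 1)"
    by (simp add: mult.commute)
  then show "emeasure M A = emeasure lborel A"
    using fin by (metis ennreal_mult_cancel_left infinity_ennreal_def mult.commute)
qed

text \<open>A linear isometry preserves the unit ball, and as it is onto, translating by c = f c'
  after f is translating by c' before f; so the pushforward inherits translation invariance and the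
  right normalisation.\<close>

lemma lborel_distr_orthogonal:
  fixes f :: "'a::euclidean_space \<Rightarrow> 'a"
  assumes f: "orthogonal_transformation f"
  shows "distr lborel borel f = lborel"
proof (rule translation_invariant_eq_lborel)
  have lin: "linear f" and nrm: "\<And>x. norm (f x) = norm x"
    using f by (auto simp: orthogonal_transformation)
  have [measurable]: "f \<in> borel_measurable borel"
    using lin by (simp add: borel_measurable_continuous_onI linear_continuous_on linear_linear)
  have "inj f"
    using linear_injective_0[OF lin] nrm by (metis norm_eq_zero)
  then have "surj f"
    using lin linear_injective_imp_surjective by blast
  have bl: "f -` ball 0 r = ball 0 r" for r
    using nrm by auto
  show "sets (distr lborel borel f) = sets borel" by simp
  show "sigma_finite_measure (distr lborel borel f)"
  proof
    show "\<exists>A. countable A \<and> A \<subseteq> sets (distr lborel borel f) \<and> \<Union> A = space (distr lborel borel f) \<and>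
        (\<forall>a\<in>A. emeasure (distr lborel borel f) a \<noteq> \<infinity>)"
    proof (intro exI conjI)
      show "countable (range (\<lambda>n::nat. ball (0::'a) (real n)))" by simp
      show "\<Union> (range (\<lambda>n::nat. ball (0::'a) (real n))) = space (distr lborel borel f)"
        by (auto simp: reals_Archimedean2)
      show "\<forall>a\<in>range (\<lambda>n::nat. ball (0::'a) (real n)). emeasure (distr lborel borel f) a \<noteq> \<infinity>"
        using emeasure_lborel_ball_finite[of "0::'a"] by (auto simp: emeasure_distr bl less_top[symmetric])
    qed auto
  qed
  show "emeasure (distr lborel borel f) (ball 0 1) = emeasure lborel (ball (0::'a) 1)"
    by (simp add: emeasure_distr bl)
  fix c :: 'a and g :: "'a \<Rightarrow> ennreal" assume [measurable]: "g \<in> borel_measurable borel"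
  obtain c' where c: "c = f c'" using \<open>surj f\<close> by (metis surj_def)
  have "(\<integral>\<^sup>+x. g (c + x) \<partial>distr lborel borel f) = (\<integral>\<^sup>+x. g (f (c' + x)) \<partial>lborel)"
    using lin by (simp add: nn_integral_distr c linear_add)
  also have "\<dots> = (\<integral>\<^sup>+x. g (f x) \<partial>lborel)"
    by (rule nn_integral_lborel_translate) simp
  finally show "(\<integral>\<^sup>+x. g (c + x) \<partial>distr lborel borel f) = (\<integral>\<^sup>+x. g x \<partial>distr lborel borel f)"
    by (simp add: nn_integral_distr)
qed

section \<open>Lebesgue measure in orthonormal coordinates\<close>

interpretation lborel_PiM: product_sigma_finite "\<lambda>_::'i. lborel :: real measure" ..

text \<open>Collects the conditions under which \<open>face_measure\<close> picks its basis.\<close>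

definition orthonormal_set :: "'a::real_inner set \<Rightarrow> bool" where
  "orthonormal_set B \<longleftrightarrow> pairwise orthogonal B \<and> (\<forall>b\<in>B. norm b = 1)"

lemma orthonormal_set_inner:
  assumes "orthonormal_set B" "b \<in> B" "c \<in> B"
  shows "b \<bullet> c = (if b = c then 1 else 0)"
  using assms by (auto simp: orthonormal_set_def pairwise_def orthogonal_def norm_eq_1)

lemma orthonormal_set_independent:
  assumes "orthonormal_set B" shows "independent B"
  using assms by (intro pairwise_orthogonal_independent) (auto simp: orthonormal_set_def)

lemma orthonormal_set_finite:
  fixes B :: "'a::euclidean_space set"
  assumes "orthonormal_set B" shows "finite B"
  using orthonormal_set_independent[OF assms] by (rule independent_imp_finite)

text \<open>Any bijection \<pi> of \<open>B\<close> with the standard basis gives product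
  coordinates, by comparison on boxes; the isometry that sends \<open>\<pi> b\<close> to
  \<open>b\<close> then rotates them into position without changing the measure.\<close>

lemma lborel_orthonormal_basis:
  fixes B :: "'a::euclidean_space set"
  assumes on: "orthonormal_set B" and card: "card B = DIM('a)"
  shows "lborel = distr (\<Pi>\<^sub>M b\<in>B. lborel) borel (\<lambda>t. \<Sum>b\<in>B. t b *\<^sub>R b)"
proof -
  have fin[simp]: "finite B" using on by (rule orthonormal_set_finite)
  obtain \<pi> where \<pi>: "bij_betw \<pi> B (Basis :: 'a set)"
    using card by (metis fin finite_Basis finite_same_card_bij)
  define \<rho> where "\<rho> = the_inv_into B \<pi>"
  have \<rho>: "bij_betw \<rho> Basis B" unfolding \<rho>_def using \<pi> by (rule bij_betw_the_inv_into)
  have \<rho>\<pi>: "\<rho> (\<pi> b) = b" if "b \<in> B" for b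
    using that \<pi> by (auto simp: \<rho>_def bij_betw_def the_inv_into_f_f)
  define f where "f x = (\<Sum>e\<in>Basis. (x \<bullet> e) *\<^sub>R \<rho> e)" for x :: 'a
  have linf: "linear f" unfolding f_def
    by (auto intro!: linearI simp: inner_add_left scaleR_add_left sum.distrib scaleR_sum_right)
  have "f v \<bullet> f w = v \<bullet> w" for v w
  proof -
    have "f v \<bullet> f w = (\<Sum>e\<in>Basis. \<Sum>e'\<in>Basis. (v \<bullet> e) * (w \<bullet> e') * (\<rho> e \<bullet> \<rho> e'))"
      by (simp add: f_def inner_sum_left inner_sum_right sum_distrib_left algebra_simps)
         (rule sum.swap)
    also have "\<dots> = (\<Sum>e\<in>Basis. \<Sum>e'\<in>Basis. (v \<bullet> e) * (w \<bullet> e') * (if e = e' then 1 else 0))"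
    proof (intro sum.cong refl)
      fix e e' :: 'a assume "e \<in> Basis" "e' \<in> Basis"
      then have "\<rho> e \<bullet> \<rho> e' = (if \<rho> e = \<rho> e' then 1 else 0)"
        using \<rho> by (intro orthonormal_set_inner[OF on]) (auto simp: bij_betw_def)
      also have "\<dots> = (if e = e' then 1 else 0)"
        using \<rho> \<open>e \<in> Basis\<close> \<open>e' \<in> Basis\<close> by (auto simp: bij_betw_def inj_on_def)
      finally show "(v \<bullet> e) * (w \<bullet> e') * (\<rho> e \<bullet> \<rho> e') = (v \<bullet> e) * (w \<bullet> e') * (if e = e' then 1 else 0)" by simp
    qed
    also have "\<dots> = v \<bullet> w"
      by (subst euclidean_inner) (simp add: if_distrib cong: if_cong)
    finally show ?thesis .
  qed
  then have orth: "orthogonal_transformation f"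
    using linf by (simp add: orthogonal_transformation_def)
  have fpi: "f (\<pi> b) = b" if "b \<in> B" for b
  proof -
    have "\<pi> b \<in> Basis" using \<pi> that by (auto simp: bij_betw_def)
    then show ?thesis
      using that \<rho>\<pi> by (simp add: f_def inner_Basis if_distrib[of "\<lambda>c. c *\<^sub>R _"] cong: if_cong)
  qed
  let ?P = "\<Pi>\<^sub>M b\<in>B. (lborel :: real measure)"
  have m1[measurable]: "(\<lambda>t. \<Sum>b\<in>B. t b *\<^sub>R h b) \<in> borel_measurable ?P" for h :: "'a \<Rightarrow> 'a"
    by measurable
  have Q: "lborel = distr ?P borel (\<lambda>t. \<Sum>b\<in>B. t b *\<^sub>R \<pi> b)"
  proof (rule lborel_eqI)
    fix l u :: 'a assume lu: "\<And>b. b \<in> Basis \<Longrightarrow> l \<bullet> b \<le> u \<bullet> b"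
    have coord: "(\<Sum>b\<in>B. t b *\<^sub>R \<pi> b) \<bullet> \<pi> c = t c" if "c \<in> B" for t c
    proof -
      have "(\<Sum>b\<in>B. t b *\<^sub>R \<pi> b) \<bullet> \<pi> c = (\<Sum>b\<in>B. t b * (if b = c then 1 else 0))"
        unfolding inner_sum_left inner_scaleR_left
      proof (intro sum.cong refl arg_cong2[where f="(*)"])
        fix b assume "b \<in> B"
        then have "\<pi> b \<in> Basis" "\<pi> c \<in> Basis" "\<pi> b = \<pi> c \<longleftrightarrow> b = c"
          using \<pi> that by (auto simp: bij_betw_def inj_on_def)
        then show "\<pi> b \<bullet> \<pi> c = (if b = c then 1 else 0)" by (simp add: inner_Basis)
      qed
      also have "\<dots> = t c" using that by (simp add: if_distrib cong: if_cong)
      finally show ?thesis .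
    qed
    have "(\<lambda>t. \<Sum>b\<in>B. t b *\<^sub>R \<pi> b) -` box l u \<inter> space ?P = Pi\<^sub>E B (\<lambda>b. {l \<bullet> \<pi> b <..< u \<bullet> \<pi> b})"
    proof -
      have "(\<Sum>b\<in>B. t b *\<^sub>R \<pi> b) \<in> box l u \<longleftrightarrow> (\<forall>b\<in>B. l \<bullet> \<pi> b < t b \<and> t b < u \<bullet> \<pi> b)" for t
      proof -
        have "(\<Sum>b\<in>B. t b *\<^sub>R \<pi> b) \<in> box l u \<longleftrightarrow> (\<forall>e\<in>\<pi> ` B. l \<bullet> e < (\<Sum>b\<in>B. t b *\<^sub>R \<pi> b) \<bullet> e \<and> (\<Sum>b\<in>B. t b *\<^sub>R \<pi> b) \<bullet> e < u \<bullet> e)"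
          using \<pi> by (simp add: box_def bij_betw_def)
        then show ?thesis by (simp add: coord)
      qed
      then show ?thesis by (auto simp: space_PiM PiE_iff)
    qed
    then have "emeasure (distr ?P borel (\<lambda>t. \<Sum>b\<in>B. t b *\<^sub>R \<pi> b)) (box l u)
       = emeasure ?P (Pi\<^sub>E B (\<lambda>b. {l \<bullet> \<pi> b <..< u \<bullet> \<pi> b}))"
      by (subst emeasure_distr) auto
    also have "\<dots> = (\<Prod>b\<in>B. emeasure lborel {l \<bullet> \<pi> b <..< u \<bullet> \<pi> b})"
      by (subst lborel_PiM.emeasure_PiM) auto
    also have "\<dots> = (\<Prod>b\<in>B. ennreal ((u - l) \<bullet> \<pi> b))"
      using \<pi> lu by (intro prod.cong refl) (force simp: bij_betw_def inner_diff_left)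
    also have "\<dots> = (\<Prod>e\<in>Basis. ennreal ((u - l) \<bullet> e))"
      using prod.reindex_bij_betw[OF \<pi>, of "\<lambda>e. ennreal ((u - l) \<bullet> e)"] by simp
    also have "\<dots> = (\<Prod>e\<in>Basis. (u - l) \<bullet> e)"
      using lu by (subst prod_ennreal) (auto simp: inner_diff_left)
    finally show "emeasure (distr ?P borel (\<lambda>t. \<Sum>b\<in>B. t b *\<^sub>R \<pi> b)) (box l u) = (\<Prod>e\<in>Basis. (u - l) \<bullet> e)" .
  qed simp
  have [measurable]: "f \<in> borel_measurable borel"
    using linf by (simp add: borel_measurable_continuous_onI linear_continuous_on linear_linear)
  have "lborel = distr (distr ?P borel (\<lambda>t. \<Sum>b\<in>B. t b *\<^sub>R \<pi> b)) borel f"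
    using lborel_distr_orthogonal[OF orth] Q by simp
  also have "\<dots> = distr ?P borel (\<lambda>t. f (\<Sum>b\<in>B. t b *\<^sub>R \<pi> b))"
    by (subst distr_distr) (auto simp: comp_def)
  also have "(\<lambda>t. f (\<Sum>b\<in>B. t b *\<^sub>R \<pi> b)) = (\<lambda>t. \<Sum>b\<in>B. t b *\<^sub>R b)"
    using linf by (auto simp: linear_sum linear_cmul fpi intro!: sum.cong)
  finally show ?thesis .
qed

text \<open>Source of the power of s in the cone formula: the slice of a cone at relative height s
  is its base under a homothety of ratio s, which gives one factor s for each of the
  \<open>card B\<close> directions.\<close>

lemma nn_integral_PiM_lborel_affine:
  fixes g :: "('i \<Rightarrow> real) \<Rightarrow> ennreal"
  assumes fin[simp]: "finite B" and s: "s > 0"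
    and [measurable]: "g \<in> borel_measurable (\<Pi>\<^sub>M b\<in>B. lborel)"
  shows "(\<integral>\<^sup>+t. g t \<partial>(\<Pi>\<^sub>M b\<in>B. lborel))
       = ennreal (s ^ card B) * (\<integral>\<^sup>+t. g (\<lambda>b\<in>B. c b + s * t b) \<partial>(\<Pi>\<^sub>M b\<in>B. lborel))"
proof -
  let ?P = "\<Pi>\<^sub>M b\<in>B. (lborel :: real measure)"
  let ?T = "\<lambda>t. \<lambda>b\<in>B. c b + s * t b"
  have [measurable]: "?T \<in> measurable ?P ?P" by (intro measurable_restrict) measurable
  have "density (distr ?P ?P ?T) (\<lambda>_. ennreal (s ^ card B)) = ?P"
  proof (rule lborel_PiM.PiM_eqI)
    fix A :: "'i \<Rightarrow> real set" assume A: "\<And>i. i \<in> B \<Longrightarrow> A i \<in> sets lborel"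
    have PA: "Pi\<^sub>E B A \<in> sets ?P" using A by (intro sets_PiM_I_finite) auto
    have "?T -` Pi\<^sub>E B A \<inter> space ?P = Pi\<^sub>E B (\<lambda>b. (\<lambda>x. c b + s * x) -` A b)"
      by (auto simp: space_PiM PiE_iff)
    then have "emeasure (density (distr ?P ?P ?T) (\<lambda>_. ennreal (s ^ card B))) (Pi\<^sub>E B A)
      = ennreal (s ^ card B) * emeasure ?P (Pi\<^sub>E B (\<lambda>b. (\<lambda>x. c b + s * x) -` A b))"
      using PA by (simp add: emeasure_density nn_integral_cmult_indicator emeasure_distr)
    also have "emeasure ?P (Pi\<^sub>E B (\<lambda>b. (\<lambda>x. c b + s * x) -` A b))
      = (\<Prod>b\<in>B. emeasure lborel ((\<lambda>x. c b + s * x) -` A b))"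
    proof (rule lborel_PiM.emeasure_PiM)
      fix b assume "b \<in> B"
      then have "A b \<in> sets borel" using A by simp
      then have "(\<lambda>x. c b + s * x) -` A b \<inter> space borel \<in> sets borel" by (intro measurable_sets) auto
      then show "(\<lambda>x. c b + s * x) -` A b \<in> sets lborel" by simp
    qed simp
    also have "ennreal (s ^ card B) * \<dots> = (\<Prod>b\<in>B. ennreal s * emeasure lborel ((\<lambda>x. c b + s * x) -` A b))"
      using s by (simp add: prod.distrib ennreal_power)
    also have "\<dots> = (\<Prod>b\<in>B. emeasure lborel (A b))"
    proof (intro prod.cong refl)
      fix b assume "b \<in> B"
      then have [measurable]: "A b \<in> sets borel" using A by simp
      have "(\<integral>\<^sup>+x. indicator (A b) x \<partial>lborel) = \<bar>s\<bar> * (\<integral>\<^sup>+x. indicator (A b) (c b + s * x) \<partial>lborel)"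
        using s by (intro nn_integral_real_affine) auto
      also have "(\<integral>\<^sup>+x. indicator (A b) (c b + s * x) \<partial>lborel) = (\<integral>\<^sup>+x. indicator ((\<lambda>x. c b + s * x) -` A b) x \<partial>lborel)"
        by (auto intro!: nn_integral_cong simp: indicator_def)
      also have "\<dots> = emeasure lborel ((\<lambda>x. c b + s * x) -` A b)"
        using measurable_sets[of "\<lambda>x. c b + s * x" borel borel "A b"] by (intro nn_integral_indicator) auto
      finally show "ennreal s * emeasure lborel ((\<lambda>x. c b + s * x) -` A b) = emeasure lborel (A b)"
        using s by simp
    qed
    finally show "emeasure (density (distr ?P ?P ?T) (\<lambda>_. ennreal (s ^ card B))) (Pi\<^sub>E B A)
        = (\<Prod>b\<in>B. emeasure lborel (A b))" .
  qed auto
  then have "(\<integral>\<^sup>+t. g t \<partial>?P) = (\<integral>\<^sup>+t. g t \<partial>density (distr ?P ?P ?T) (\<lambda>_. ennreal (s ^ card B)))"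
    by simp
  also have "\<dots> = ennreal (s ^ card B) * (\<integral>\<^sup>+t. g (?T t) \<partial>?P)"
    by (simp add: nn_integral_density nn_integral_distr nn_integral_cmult)
  finally show ?thesis .
qed

section \<open>Hyperplane slices and the cone formula\<close>

text \<open>\<open>face_measure\<close> with its base point and basis exposed as parameters.\<close>

definition plane_measure :: "'a::euclidean_space \<Rightarrow> 'a set \<Rightarrow> 'a measure" where
  "plane_measure a B = distr (\<Pi>\<^sub>M b\<in>B. (lborel :: real measure)) borel (\<lambda>t. a + (\<Sum>b\<in>B. t b *\<^sub>R b))"

lemma nn_integral_plane_measure:
  assumes "f \<in> borel_measurable borel"
  shows "(\<integral>\<^sup>+y. f y \<partial>plane_measure a B) = (\<integral>\<^sup>+t. f (a + (\<Sum>b\<in>B. t b *\<^sub>R b)) \<partial>(\<Pi>\<^sub>M b\<in>B. lborel))"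
  using assms unfolding plane_measure_def by (intro nn_integral_distr) auto

lemma nn_integral_lborel_slices:
  fixes n :: "'a::euclidean_space"
  assumes on: "orthonormal_set (insert n B)" and nB: "n \<notin> B" and card: "Suc (card B) = DIM('a)"
    and [measurable]: "f \<in> borel_measurable borel"
  shows "(\<integral>\<^sup>+x. f x \<partial>lborel)
       = (\<integral>\<^sup>+r. (\<integral>\<^sup>+t. f (a + r *\<^sub>R n + (\<Sum>b\<in>B. t b *\<^sub>R b)) \<partial>(\<Pi>\<^sub>M b\<in>B. lborel)) \<partial>lborel)"
proof -
  have fin[simp]: "finite B" using orthonormal_set_finite[OF on] by simp
  have c: "card (insert n B) = DIM('a)" using nB card by simp
  have "(\<integral>\<^sup>+x. f x \<partial>lborel) = (\<integral>\<^sup>+x. f (a + x) \<partial>lborel)"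
    by (rule nn_integral_lborel_translate[symmetric]) simp
  also have "\<dots> = (\<integral>\<^sup>+t. f (a + (\<Sum>b\<in>insert n B. t b *\<^sub>R b)) \<partial>(\<Pi>\<^sub>M b\<in>insert n B. lborel))"
    by (subst lborel_orthonormal_basis[OF on c]) (rule nn_integral_distr; measurable)
  also have "\<dots> = (\<integral>\<^sup>+r. (\<integral>\<^sup>+t. f (a + (\<Sum>b\<in>insert n B. (t(n := r)) b *\<^sub>R b)) \<partial>(\<Pi>\<^sub>M b\<in>B. lborel)) \<partial>lborel)"
    by (rule lborel_PiM.product_nn_integral_insert_rev[OF fin nB]) measurable
  also have "\<dots> = (\<integral>\<^sup>+r. (\<integral>\<^sup>+t. f (a + r *\<^sub>R n + (\<Sum>b\<in>B. t b *\<^sub>R b)) \<partial>(\<Pi>\<^sub>M b\<in>B. lborel)) \<partial>lborel)"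
  proof (intro nn_integral_cong arg_cong[where f=f])
    fix r t
    have "(\<Sum>b\<in>B. (t(n := r)) b *\<^sub>R b) = (\<Sum>b\<in>B. t b *\<^sub>R b)"
      using nB by (intro sum.cong) auto
    then show "a + (\<Sum>b\<in>insert n B. (t(n := r)) b *\<^sub>R b) = a + r *\<^sub>R n + (\<Sum>b\<in>B. t b *\<^sub>R b)"
      using nB by (simp add: algebra_simps)
  qed
  finally show ?thesis .
qed

text \<open>The plane at distance H s from the apex is the image of the base plane under the map
  from y to v + s (y - v). Fubini over the normal coordinate r = - H + H s gives the factor H, the
  homothety gives the power of s. Whole planes are integrated over a slab; a bounded base is
  obtained later by putting an indicator into \<open>f\<close>.\<close>

lemma nn_integral_cone:
  fixes n v a :: "'a::euclidean_space"
  assumes on: "orthonormal_set (insert n B)" and nB: "n \<notin> B" and card: "Suc (card B) = DIM('a)"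
    and H: "(a - v) \<bullet> n = H" "H > 0"
    and f[measurable]: "f \<in> borel_measurable borel"
  shows "(\<integral>\<^sup>+x. f x * indicator {x. 0 \<le> (x - v) \<bullet> n \<and> (x - v) \<bullet> n \<le> H} x \<partial>lborel)
       = (\<integral>\<^sup>+s. ennreal (H * s ^ card B) * (\<integral>\<^sup>+y. f (v + s *\<^sub>R (y - v)) \<partial>plane_measure a B)
            * indicator {0..1} s \<partial>lborel)"
proof -
  let ?P = "\<Pi>\<^sub>M b\<in>B. (lborel :: real measure)"
  have fin[simp]: "finite B" using orthonormal_set_finite[OF on] by simp
  have onB: "orthonormal_set B" using on by (auto simp: orthonormal_set_def pairwise_def)
  have nn: "n \<bullet> n = 1" using orthonormal_set_inner[OF on, of n n] by simp
  have nb: "b \<bullet> n = 0" if "b \<in> B" for b using orthonormal_set_inner[OF on, of b n] that nB by auto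
  define J where "J = {x. 0 \<le> (x - v) \<bullet> n \<and> (x - v) \<bullet> n \<le> H}"
  have J[measurable]: "J \<in> sets borel" unfolding J_def by measurable
  interpret PS: sigma_finite_measure ?P by (rule lborel_PiM.sigma_finite) simp
  interpret PP: pair_sigma_finite "lborel :: real measure" ?P ..
  define c where "c b = (v - a) \<bullet> b" for b
  have span: "span (insert n B) = UNIV"
  proof -
    have "dim (span (insert n B)) = DIM('a)"
      using orthonormal_set_independent[OF on] nB card by (simp add: dim_eq_card_independent del: independent_insert)
    then show ?thesis by (metis dim_eq_full span_span)
  qed
  have va: "v - a = - H *\<^sub>R n + (\<Sum>b\<in>B. c b *\<^sub>R b)"
  proof -
    have "(v - a) - (- H *\<^sub>R n + (\<Sum>b\<in>B. c b *\<^sub>R b)) = 0" (is "?d = 0")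
    proof -
      have "?d \<bullet> n = 0"
        using H nn nb by (simp add: inner_diff_left inner_add_left inner_sum_left)
      moreover have "?d \<bullet> b = 0" if "b \<in> B" for b
      proof -
        have "(\<Sum>b'\<in>B. c b' *\<^sub>R b') \<bullet> b = (\<Sum>b'\<in>B. c b' * (if b' = b then 1 else 0))"
          unfolding inner_sum_left using orthonormal_set_inner[OF onB _ that] by (intro sum.cong) auto
        also have "\<dots> = c b" using that by (simp add: if_distrib cong: if_cong)
        finally have "(\<Sum>b'\<in>B. c b' *\<^sub>R b') \<bullet> b = (v - a) \<bullet> b" by (simp add: c_def)
        moreover have "n \<bullet> b = 0" using nb[OF that] by (simp add: inner_commute)
        ultimately show ?thesis
          by (simp only: inner_diff_left inner_add_left inner_scaleR_left)
      qed
      ultimately have z: "orthogonal ?d z" if "z \<in> insert n B" for z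
        using that unfolding orthogonal_def by blast
      have "?d \<in> span (insert n B)" unfolding span by (rule UNIV_I)
      then have "orthogonal ?d ?d" using z by (rule orthogonal_to_span)
      then show ?thesis by (simp add: orthogonal_def)
    qed
    then show ?thesis by simp
  qed
  have "(\<integral>\<^sup>+x. f x * indicator J x \<partial>lborel)
     = (\<integral>\<^sup>+r. (\<integral>\<^sup>+t. f (a + r *\<^sub>R n + (\<Sum>b\<in>B. t b *\<^sub>R b)) * indicator J (a + r *\<^sub>R n + (\<Sum>b\<in>B. t b *\<^sub>R b)) \<partial>?P) \<partial>lborel)"
    by (rule nn_integral_lborel_slices[OF on nB card]) measurable
  also have "\<dots> = (\<integral>\<^sup>+r. (\<integral>\<^sup>+t. f (a + r *\<^sub>R n + (\<Sum>b\<in>B. t b *\<^sub>R b)) \<partial>?P) * indicator {-H..0} r \<partial>lborel)"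
  proof (rule nn_integral_cong)
    fix r
    have "indicator J (a + r *\<^sub>R n + (\<Sum>b\<in>B. t b *\<^sub>R b)) = (indicator {-H..0} r :: ennreal)" for t
    proof -
      have "(a + r *\<^sub>R n + (\<Sum>b\<in>B. t b *\<^sub>R b) - v) \<bullet> n = H + r"
        using H nn nb by (simp add: inner_diff_left inner_add_left inner_sum_left)
      then show ?thesis by (auto simp: J_def indicator_def)
    qed
    then show "(\<integral>\<^sup>+t. f (a + r *\<^sub>R n + (\<Sum>b\<in>B. t b *\<^sub>R b)) * indicator J (a + r *\<^sub>R n + (\<Sum>b\<in>B. t b *\<^sub>R b)) \<partial>?P)
      = (\<integral>\<^sup>+t. f (a + r *\<^sub>R n + (\<Sum>b\<in>B. t b *\<^sub>R b)) \<partial>?P) * indicator {-H..0} r"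
      by (simp add: nn_integral_multc)
  qed
  also have "\<dots> = \<bar>H\<bar> * (\<integral>\<^sup>+s. (\<integral>\<^sup>+t. f (a + (-H + H * s) *\<^sub>R n + (\<Sum>b\<in>B. t b *\<^sub>R b)) \<partial>?P) * indicator {-H..0} (-H + H * s) \<partial>lborel)"
    using H(2) by (intro nn_integral_real_affine) auto
  also have "\<dots> = (\<integral>\<^sup>+s. ennreal H * ((\<integral>\<^sup>+t. f (a + (-H + H * s) *\<^sub>R n + (\<Sum>b\<in>B. t b *\<^sub>R b)) \<partial>?P) * indicator {-H..0} (-H + H * s)) \<partial>lborel)"
    using H(2) by (subst nn_integral_cmult) auto
  also have "\<dots> = (\<integral>\<^sup>+s. ennreal (H * s ^ card B) * (\<integral>\<^sup>+y. f (v + s *\<^sub>R (y - v)) \<partial>plane_measure a B)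
            * indicator {0..1} s \<partial>lborel)"
  proof (rule nn_integral_cong_AE)
    \<comment> \<open>The level s = 0 is discarded, where the slice collapses to the apex and the
      homothety is not invertible.\<close>
    show "AE s in lborel. ennreal H * ((\<integral>\<^sup>+t. f (a + (-H + H * s) *\<^sub>R n + (\<Sum>b\<in>B. t b *\<^sub>R b)) \<partial>?P) * indicator {-H..0} (-H + H * s))
       = ennreal (H * s ^ card B) * (\<integral>\<^sup>+y. f (v + s *\<^sub>R (y - v)) \<partial>plane_measure a B) * indicator {0..1} s"
      using AE_lborel_singleton[of "0::real"]
    proof eventually_elim
      case (elim s)
      have ind: "indicator {-H..0} (-H + H * s) = (indicator {0..1} s :: ennreal)"
        using H(2) by (auto simp: indicator_def mult_le_cancel_left1 zero_le_mult_iff)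
      show ?case
      proof (cases "s \<in> {0..1}")
        case False then show ?thesis using ind by simp
      next
        case True
        then have s: "s > 0" using elim by auto
        have pt: "a + (-H + H * s) *\<^sub>R n + (\<Sum>b\<in>B. (\<lambda>b\<in>B. (1 - s) * c b + s * t b) b *\<^sub>R b)
           = v + s *\<^sub>R (a + (\<Sum>b\<in>B. t b *\<^sub>R b) - v)" for t
        proof -
          have "(\<Sum>b\<in>B. (\<lambda>b\<in>B. (1 - s) * c b + s * t b) b *\<^sub>R b)
             = (1 - s) *\<^sub>R (\<Sum>b\<in>B. c b *\<^sub>R b) + s *\<^sub>R (\<Sum>b\<in>B. t b *\<^sub>R b)"
            by (simp add: scaleR_sum_right sum.distrib[symmetric] scaleR_add_left)
          also have "(\<Sum>b\<in>B. c b *\<^sub>R b) = v - a + H *\<^sub>R n" using va by simp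
          finally show ?thesis by (simp add: algebra_simps)
        qed
        have "(\<integral>\<^sup>+t. f (a + (-H + H * s) *\<^sub>R n + (\<Sum>b\<in>B. t b *\<^sub>R b)) \<partial>?P)
          = ennreal (s ^ card B) * (\<integral>\<^sup>+t. f (a + (-H + H * s) *\<^sub>R n + (\<Sum>b\<in>B. (\<lambda>b\<in>B. (1 - s) * c b + s * t b) b *\<^sub>R b)) \<partial>?P)"
          using nn_integral_PiM_lborel_affine[OF fin s, of "\<lambda>t. f (a + (-H + H * s) *\<^sub>R n + (\<Sum>b\<in>B. t b *\<^sub>R b))" "\<lambda>b. (1 - s) * c b"]
          by simp
        also have "\<dots> = ennreal (s ^ card B) * (\<integral>\<^sup>+t. f (v + s *\<^sub>R (a + (\<Sum>b\<in>B. t b *\<^sub>R b) - v)) \<partial>?P)"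
          by (simp only: pt)
        also have "\<dots> = ennreal (s ^ card B) * (\<integral>\<^sup>+y. f (v + s *\<^sub>R (y - v)) \<partial>plane_measure a B)"
          by (subst nn_integral_plane_measure) auto
        finally show ?thesis
          unfolding ind using s H(2) by (simp add: ennreal_mult ac_simps)
      qed
    qed
  qed
  finally show ?thesis by (simp add: J_def)
qed

section \<open>Simplices\<close>

text \<open>The difference of both sides is orthogonal to a basis of the whole space. This is what
  leaves a facet with only two unit normals.\<close>

lemma orthonormal_expand_unique:
  fixes x :: "'a::euclidean_space"
  assumes on: "orthonormal_set (insert n B)" and nB: "n \<notin> B" and card: "Suc (card B) = DIM('a)"
    and B: "\<And>b. b \<in> B \<Longrightarrow> x \<bullet> b = 0"
  shows "x = (x \<bullet> n) *\<^sub>R n"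
proof -
  let ?d = "x - (x \<bullet> n) *\<^sub>R n"
  have "dim (span (insert n B)) = DIM('a)"
    using orthonormal_set_independent[OF on] orthonormal_set_finite[OF on] nB card
    by (simp add: dim_eq_card_independent del: independent_insert)
  then have "span (insert n B) = UNIV" by (metis dim_eq_full span_span)
  then have "?d \<in> span (insert n B)" by simp
  moreover have "orthogonal ?d z" if z: "z \<in> insert n B" for z
  proof (cases "z = n")
    case True
    then show ?thesis using orthonormal_set_inner[OF on, of n n]
      by (simp add: orthogonal_def inner_diff_left)
  next
    case False
    then show ?thesis using orthonormal_set_inner[OF on, of n z] B z
      by (simp add: orthogonal_def inner_diff_left)
  qed
  ultimately have "orthogonal ?d ?d" by (rule orthogonal_to_span)
  then show ?thesis by (simp add: orthogonal_def)
qed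

section \<open>Normals, heights and barycentric coordinates of a simplex\<close>

text \<open>Facets are indexed by the opposite vertex, as \<open>F v\<close>. The bound
  \<open>dim2\<close> gives every facet at least two vertices and hence a positive diameter.\<close>

locale full_simplex =
  fixes S :: "(real^'n) set"
  assumes indep: "\<not> affine_dependent S" and cardS: "card S = Suc CARD('n)"
    and dim2: "2 \<le> CARD('n)"
begin

abbreviation \<tau> :: "(real^'n) set" where "\<tau> \<equiv> convex hull S"
abbreviation F :: "real^'n \<Rightarrow> (real^'n) set" where "F v \<equiv> convex hull (S - {v})"
abbreviation nrm :: "real^'n \<Rightarrow> real^'n" where "nrm v \<equiv> outer_normal \<tau> (F v)"

text \<open>The same choice as the origin in \<open>face_measure\<close>, so that both refer to the
  same plane coordinates.\<close>

definition base :: "real^'n \<Rightarrow> real^'n" where "base v = (SOME a. a \<in> F v)"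
definition height :: "real^'n \<Rightarrow> real" where "height v = (base v - v) \<bullet> nrm v"
text \<open>The barycentric coordinate of \<open>v\<close>, taken as signed distance to the opposite
  facet over the height. In this form it is affine on the whole space, with gradient minus
  \<open>nrm v\<close> over \<open>height v\<close>.\<close>

definition bary :: "real^'n \<Rightarrow> real^'n \<Rightarrow> real" where
  "bary v x = ((base v - x) \<bullet> nrm v) / height v"

lemma finS[simp]: "finite S" using indep by (rule aff_independent_finite)

lemma F_nonempty: "v \<in> S \<Longrightarrow> F v \<noteq> {}"
proof -
  assume v: "v \<in> S"
  then have "card (S - {v}) = CARD('n)" using cardS by simp
  then have "S - {v} \<noteq> {}" using dim2 by force
  then show "F v \<noteq> {}" by simp
qed

lemma base_in_F: "v \<in> S \<Longrightarrow> base v \<in> F v"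
  unfolding base_def using F_nonempty by (metis ex_in_conv someI_ex)

lemma F_subset: "F v \<subseteq> \<tau>"
  by (intro hull_mono) auto

lemma in_F: "w \<in> S \<Longrightarrow> w \<noteq> v \<Longrightarrow> w \<in> F v"
  by (intro hull_inc) auto

lemma affine_hull_S: "affine hull S = UNIV"
proof -
  have "aff_dim S = int (card S) - 1"
    using indep by (simp add: aff_dim_affine_independent)
  then have "aff_dim S = int DIM(real^'n)" by (simp add: cardS)
  then show ?thesis using aff_dim_eq_full[of S] by simp
qed

text \<open>The directions of a facet span a space of dimension d - 1, whose complement is a line;
  its orientation is fixed by asking that the apex lie behind the facet. \<open>B\<close> is exposed
  as the very basis that \<open>face_measure\<close> uses.\<close>

lemma facet_normal_exists:
  assumes v: "v \<in> S"
  obtains n B where "orthonormal_set (insert n B)" "n \<notin> B" "Suc (card B) = CARD('n)"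
    "face_measure (F v) = plane_measure (base v) B" "span B = span {x - y | x y. x \<in> F v \<and> y \<in> F v}"
    "\<And>x y. x \<in> F v \<Longrightarrow> y \<in> F v \<Longrightarrow> (y - x) \<bullet> n = 0" "\<And>x. x \<in> F v \<Longrightarrow> (x - v) \<bullet> n > 0"
proof -
  define U where "U = span {x - y | x y. x \<in> F v \<and> y \<in> F v}"
  define a where "a = base v"
  have aF: "a \<in> F v" using v by (simp add: a_def base_in_F)
  have Ueq: "U = span ((\<lambda>x. - a + x) ` F v)"
  proof (rule antisym)
    show "span ((\<lambda>x. - a + x) ` F v) \<subseteq> U"
      unfolding U_def using aF by (intro span_mono) force
    have "{x - y | x y. x \<in> F v \<and> y \<in> F v} \<subseteq> span ((\<lambda>x. - a + x) ` F v)"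
    proof clarify
      fix x y assume "x \<in> F v" "y \<in> F v"
      then have "(- a + x) - (- a + y) \<in> span ((\<lambda>x. - a + x) ` F v)"
        by (intro span_diff span_base) auto
      then show "x - y \<in> span ((\<lambda>x. - a + x) ` F v)" by simp
    qed
    then show "U \<subseteq> span ((\<lambda>x. - a + x) ` F v)"
      unfolding U_def by (intro span_minimal) auto
  qed
  have iv: "\<not> affine_dependent (S - {v})" using indep by (rule affine_independent_Diff)
  have dimU: "dim U = CARD('n) - 1"
  proof -
    have "int (dim U) = aff_dim (F v)"
      unfolding Ueq dim_span using aF by (intro aff_dim_eq_dim[symmetric]) (rule hull_inc)
    also have "\<dots> = int (card (S - {v})) - 1"
      unfolding aff_dim_convex_hull using aff_dim_affine_independent[OF iv] by simp
    finally have "int (dim U) = int (card (S - {v})) - 1" .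
    moreover have "card (S - {v}) = CARD('n)" using v cardS by simp
    ultimately show ?thesis using dim2 by simp
  qed
  define B where "B = (SOME B. pairwise orthogonal B \<and> (\<forall>b\<in>B. norm b = 1) \<and> span B = U)"
  have "\<exists>B. pairwise orthogonal B \<and> (\<forall>b\<in>B. norm b = 1) \<and> span B = U"
  proof -
    have "subspace U" by (simp add: U_def)
    then show ?thesis by (rule orthonormal_basis_subspace) blast
  qed
  then have "pairwise orthogonal B \<and> (\<forall>b\<in>B. norm b = 1) \<and> span B = U"
    unfolding B_def by (rule someI_ex)
  then have onB: "orthonormal_set B" and spB: "span B = U" by (auto simp: orthonormal_set_def)
  have cardB: "card B = CARD('n) - 1"
    using orthonormal_set_independent[OF onB] spB dimU by (metis dim_eq_card_independent dim_span)
  have "dim U < DIM(real^'n)" using dimU dim2 by simp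
  then obtain m where m: "m \<noteq> 0" "\<And>y. y \<in> span U \<Longrightarrow> orthogonal m y"
    using orthogonal_to_subspace_exists by blast
  have spU: "span U = U" by (simp add: U_def)
  have flat: "(y - x) \<bullet> m = 0" if "x \<in> F v" "y \<in> F v" for x y
  proof -
    have "y - x \<in> U" unfolding U_def using that by (intro span_base) auto
    then have "orthogonal m (y - x)" by (intro m(2) span_base)
    then show ?thesis unfolding orthogonal_def by (simp only: inner_commute)
  qed
  \<comment> \<open>Otherwise all vertices lie in one hyperplane, against
    \<open>affine_hull_S\<close>; the point \<open>a + m\<close> exhibits the contradiction.\<close>
  have nz: "(a - v) \<bullet> m \<noteq> 0"
  proof
    assume z: "(a - v) \<bullet> m = 0"
    have "S \<subseteq> {x. m \<bullet> x = m \<bullet> a}"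
    proof
      fix x assume "x \<in> S"
      have "(a - x) \<bullet> m = 0"
      proof (cases "x = v")
        case True then show ?thesis using z by simp
      next
        case False then show ?thesis using flat[OF in_F[OF \<open>x \<in> S\<close>] aF] by blast
      qed
      then have "x \<bullet> m = a \<bullet> m" unfolding inner_diff_left by simp
      then show "x \<in> {x. m \<bullet> x = m \<bullet> a}" by (simp only: mem_Collect_eq inner_commute[of m])
    qed
    then have "affine hull S \<subseteq> {x. m \<bullet> x = m \<bullet> a}" by (intro hull_minimal affine_hyperplane)
    moreover have "a + m \<in> affine hull S" by (simp add: affine_hull_S)
    ultimately have "a + m \<in> {x. m \<bullet> x = m \<bullet> a}" by (rule subsetD)
    then show False using m(1) by (simp add: inner_add_right)
  qed
  define n where "n = (sgn ((a - v) \<bullet> m) / norm m) *\<^sub>R m"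
  have n1: "norm n = 1" using m(1) nz by (simp add: n_def abs_sgn_eq)
  have nU: "n \<bullet> y = 0" if "y \<in> U" for y
    using m(2)[of y] that spU by (simp add: n_def orthogonal_def)
  have BU: "B \<subseteq> U" using spB span_superset by blast
  have nB: "n \<notin> B" using nU[of n] BU n1 by (auto simp: norm_eq_1)
  show ?thesis
  proof (rule that[of n B])
    show "orthonormal_set (insert n B)"
      using onB n1 nU BU by (auto simp: orthonormal_set_def pairwise_insert orthogonal_def inner_commute)
    show "n \<notin> B" by fact
    show "Suc (card B) = CARD('n)" using cardB dim2 by simp
    show "face_measure (F v) = plane_measure (base v) B"
      by (simp add: face_measure_def plane_measure_def Let_def B_def U_def base_def)
    show "span B = span {x - y | x y. x \<in> F v \<and> y \<in> F v}" using spB by (simp add: U_def)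
    show f0: "(y - x) \<bullet> n = 0" if "x \<in> F v" "y \<in> F v" for x y
      using flat[OF that] by (simp add: n_def)
    show "(x - v) \<bullet> n > 0" if "x \<in> F v" for x
    proof -
      have "(x - v) \<bullet> n = (x - a) \<bullet> n + (a - v) \<bullet> n" by (simp add: inner_diff_left)
      also have "\<dots> = \<bar>(a - v) \<bullet> m\<bar> / norm m"
      proof -
        have "(a - v) \<bullet> n = sgn ((a - v) \<bullet> m) * ((a - v) \<bullet> m) / norm m" by (simp add: n_def)
        also have "sgn ((a - v) \<bullet> m) * ((a - v) \<bullet> m) = \<bar>(a - v) \<bullet> m\<bar>" by (simp only: abs_sgn mult.commute)
        finally show ?thesis using f0[OF aF that] by simp
      qed
      also have "\<dots> > 0" using nz m(1) by simp
      finally show ?thesis .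
    qed
  qed
qed

text \<open>Both vectors lie on the line orthogonal to the facet. Stated for arbitrary vectors, it
  also compares the normals that two simplices attach to a common facet.\<close>

lemma unit_normal_unique:
  assumes v: "v \<in> S" and z1: "norm z = 1" and z: "\<And>x y. x \<in> F v \<Longrightarrow> y \<in> F v \<Longrightarrow> (y - x) \<bullet> z = 0"
    and n1: "norm n = 1" and n: "\<And>x y. x \<in> F v \<Longrightarrow> y \<in> F v \<Longrightarrow> (y - x) \<bullet> n = 0"
  shows "z = n \<or> z = - n"
proof (rule facet_normal_exists[OF v])
  fix m B
  assume mB: "orthonormal_set (insert m B)" "m \<notin> B" "Suc (card B) = CARD('n)"
    "span B = span {x - y | x y. x \<in> F v \<and> y \<in> F v}"
  have orth: "z = (z \<bullet> m) *\<^sub>R m" if z: "\<And>x y. x \<in> F v \<Longrightarrow> y \<in> F v \<Longrightarrow> (y - x) \<bullet> z = 0" for z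
  proof (rule orthonormal_expand_unique[OF mB(1,2)])
    show "Suc (card B) = DIM(real^'n)" using mB(3) by simp
    fix b assume "b \<in> B"
    then have "b \<in> span {x - y | x y. x \<in> F v \<and> y \<in> F v}" using mB(4) span_base by blast
    then have "orthogonal z b"
    proof (rule orthogonal_to_span)
      fix w assume "w \<in> {x - y | x y. x \<in> F v \<and> y \<in> F v}"
      then obtain x y where "x \<in> F v" "y \<in> F v" and w: "w = x - y" by blast
      then have "(x - y) \<bullet> z = 0" by (intro z)
      then show "orthogonal z w" unfolding orthogonal_def w by (simp only: inner_commute)
    qed
    then show "z \<bullet> b = 0" by (simp add: orthogonal_def)
  qed
  have 1: "z = (z \<bullet> m) *\<^sub>R m" by (rule orth) (rule z)
  have 2: "n = (n \<bullet> m) *\<^sub>R m" by (rule orth) (rule n)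
  have m1: "norm m = 1" using mB(1) by (simp add: orthonormal_set_def)
  have "\<bar>z \<bullet> m\<bar> = 1" using arg_cong[OF 1, of norm] z1 m1 by simp
  moreover have "\<bar>n \<bullet> m\<bar> = 1" using arg_cong[OF 2, of norm] n1 m1 by simp
  ultimately have "z \<bullet> m = n \<bullet> m \<or> z \<bullet> m = - (n \<bullet> m)" by linarith
  then show ?thesis
  proof
    assume "z \<bullet> m = n \<bullet> m"
    then have "z = n" using 1 2 by (simp only:)
    then show ?thesis ..
  next
    assume "z \<bullet> m = - (n \<bullet> m)"
    then have "z = - ((n \<bullet> m) *\<^sub>R m)" using 1 by (metis scaleR_minus_left)
    then have "z = - n" using 2 by (simp only:)
    then show ?thesis ..
  qed
qed

text \<open>\<open>outer_normal\<close> is a definite description, so existence and uniqueness are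
  both due. The half-space inequality passes from the vertices to the hull; conversely it holds in
  both directions between points of the facet, which forces orthogonality, and the apex excludes the
  opposite sign.\<close>

lemma outer_normal_eqI:
  assumes v: "v \<in> S" and n1: "norm n = 1"
    and flat: "\<And>x y. x \<in> F v \<Longrightarrow> y \<in> F v \<Longrightarrow> (y - x) \<bullet> n = 0" and pos: "\<And>x. x \<in> F v \<Longrightarrow> (x - v) \<bullet> n > 0"
  shows "nrm v = n"
  unfolding outer_normal_def
proof (rule the_equality)
  show "norm n = 1 \<and> (\<forall>x\<in>F v. \<forall>y\<in>\<tau>. (y - x) \<bullet> n \<le> 0)"
  proof (intro conjI ballI n1)
    fix x y assume x: "x \<in> F v" and y: "y \<in> \<tau>"
    have "S \<subseteq> {y. n \<bullet> y \<le> n \<bullet> x}"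
    proof
      fix w assume "w \<in> S"
      have "w \<bullet> n \<le> x \<bullet> n"
      proof (cases "w = v")
        case True
        then show ?thesis using pos[OF x] unfolding inner_diff_left by simp
      next
        case False
        then show ?thesis using flat[OF x in_F[OF \<open>w \<in> S\<close>]] unfolding inner_diff_left by simp
      qed
      then show "w \<in> {y. n \<bullet> y \<le> n \<bullet> x}" by (simp add: inner_commute)
    qed
    then have "\<tau> \<subseteq> {y. n \<bullet> y \<le> n \<bullet> x}" by (intro hull_minimal convex_halfspace_le)
    then have "n \<bullet> y \<le> n \<bullet> x" using y by blast
    then show "(y - x) \<bullet> n \<le> 0" unfolding inner_diff_left by (simp add: inner_commute)
  qed
  fix n' assume n': "norm n' = 1 \<and> (\<forall>x\<in>F v. \<forall>y\<in>\<tau>. (y - x) \<bullet> n' \<le> 0)"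
  have "(y - x) \<bullet> n' = 0" if "x \<in> F v" "y \<in> F v" for x y
  proof -
    have "(x - y) \<bullet> n' \<le> 0" "(y - x) \<bullet> n' \<le> 0" using n' that F_subset by auto
    then show ?thesis by (simp add: inner_diff_left)
  qed
  then have "n' = n \<or> n' = - n"
    using n' n1 flat by (intro unit_normal_unique[OF v]) simp_all
  moreover have "n' \<noteq> - n"
  proof
    assume "n' = - n"
    moreover have "base v \<in> F v" using v by (rule base_in_F)
    moreover have "v \<in> \<tau>" using v by (rule hull_inc)
    ultimately have "(v - base v) \<bullet> (- n) \<le> 0" using n' by blast
    then show False using pos[OF base_in_F[OF v]] by (simp add: inner_diff_left)
  qed
  ultimately show "n' = n" by simp
qed

lemma facet_props:
  assumes v: "v \<in> S"
  obtains B where "orthonormal_set (insert (nrm v) B)" "nrm v \<notin> B" "Suc (card B) = CARD('n)"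
    "face_measure (F v) = plane_measure (base v) B"
    "\<And>x y. x \<in> F v \<Longrightarrow> y \<in> F v \<Longrightarrow> (y - x) \<bullet> nrm v = 0" "\<And>x. x \<in> F v \<Longrightarrow> (x - v) \<bullet> nrm v > 0"
proof (rule facet_normal_exists[OF v])
  fix n B
  assume nB: "orthonormal_set (insert n B)" "n \<notin> B" "Suc (card B) = CARD('n)"
    "face_measure (F v) = plane_measure (base v) B"
    and flat: "\<And>x y. x \<in> F v \<Longrightarrow> y \<in> F v \<Longrightarrow> (y - x) \<bullet> n = 0" and pos: "\<And>x. x \<in> F v \<Longrightarrow> (x - v) \<bullet> n > 0"
  have "norm n = 1" using nB(1) by (simp add: orthonormal_set_def)
  have eq: "nrm v = n"
  proof (rule outer_normal_eqI[OF v \<open>norm n = 1\<close>])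
    show "(y - x) \<bullet> n = 0" if "x \<in> F v" "y \<in> F v" for x y using that by (rule flat)
    show "(x - v) \<bullet> n > 0" if "x \<in> F v" for x using that by (rule pos)
  qed
  show thesis
  proof (rule that[of B])
    show "orthonormal_set (insert (nrm v) B)" unfolding eq by (rule nB)
    show "nrm v \<notin> B" unfolding eq by (rule nB)
    show "Suc (card B) = CARD('n)" by (rule nB)
    show "face_measure (F v) = plane_measure (base v) B" by (rule nB)
    show "(y - x) \<bullet> nrm v = 0" if "x \<in> F v" "y \<in> F v" for x y
      unfolding eq using that by (rule flat)
    show "(x - v) \<bullet> nrm v > 0" if "x \<in> F v" for x
      unfolding eq using that by (rule pos)
  qed
qed

lemma facet_flat:
  assumes "v \<in> S" "x \<in> F v" "y \<in> F v" shows "(y - x) \<bullet> nrm v = 0"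
proof (rule facet_props[OF assms(1)])
  assume *: "\<And>x y. x \<in> F v \<Longrightarrow> y \<in> F v \<Longrightarrow> (y - x) \<bullet> nrm v = 0"
  show ?thesis using assms(2,3) by (rule *)
qed

lemma facet_side:
  assumes "v \<in> S" "x \<in> F v" shows "(x - v) \<bullet> nrm v > 0"
proof (rule facet_props[OF assms(1)])
  assume *: "\<And>x. x \<in> F v \<Longrightarrow> (x - v) \<bullet> nrm v > 0"
  show ?thesis using assms(2) by (rule *)
qed

lemma norm_nrm:
  assumes "v \<in> S" shows "norm (nrm v) = 1"
proof (rule facet_props[OF assms])
  fix B assume "orthonormal_set (insert (nrm v) B)"
  then show ?thesis by (simp add: orthonormal_set_def)
qed

lemma height_pos: "v \<in> S \<Longrightarrow> height v > 0"
  unfolding height_def by (intro facet_side base_in_F)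

lemma bary_F:
  assumes "v \<in> S" "x \<in> F v" shows "bary v x = 0"
  using facet_flat[OF assms base_in_F[OF assms(1)]] by (simp add: bary_def)

lemma bary_vertex:
  assumes "v \<in> S" "w \<in> S" shows "bary v w = (if v = w then 1 else 0)"
proof (cases "v = w")
  case True
  have "bary v v = height v / height v" unfolding bary_def height_def ..
  then show ?thesis using True height_pos[OF assms(1)] by simp
next
  case False
  then have "w \<in> F v" using assms by (intro in_F) auto
  then show ?thesis using False bary_F[OF assms(1)] by simp
qed

lemma bary_affine:
  assumes "finite A" "sum c A = 1"
  shows "bary v (\<Sum>i\<in>A. c i *\<^sub>R x i) = (\<Sum>i\<in>A. c i * bary v (x i))"
proof -
  have "base v - (\<Sum>i\<in>A. c i *\<^sub>R x i) = (\<Sum>i\<in>A. c i *\<^sub>R (base v - x i))"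
    using assms by (simp add: scaleR_diff_right sum_subtractf flip: scaleR_sum_left)
  then show ?thesis
    by (simp add: bary_def inner_sum_left sum_divide_distrib)
qed

text \<open>Every point is an affine combination of the vertices, and applying the affine map
  \<open>bary v\<close> to it reads off the coefficient of \<open>v\<close>.\<close>

lemma bary_sums:
  shows sum_bary: "(\<Sum>v\<in>S. bary v x) = 1" and sum_bary_vertex: "(\<Sum>v\<in>S. bary v x *\<^sub>R v) = x"
proof -
  have "x \<in> affine hull S" by (simp add: affine_hull_S)
  then obtain c where c: "sum c S = 1" "(\<Sum>w\<in>S. c w *\<^sub>R w) = x"
    by (auto simp: affine_hull_finite)
  have "bary v x = c v" if "v \<in> S" for v
  proof -
    have "bary v x = (\<Sum>w\<in>S. c w * bary v w)"
      unfolding c(2)[symmetric] using c(1) by (intro bary_affine) auto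
    also have "\<dots> = (\<Sum>w\<in>S. c w * (if v = w then 1 else 0))"
      using bary_vertex[OF that] by (intro sum.cong) auto
    also have "\<dots> = c v" using that by (simp add: if_distrib cong: if_cong)
    finally show ?thesis .
  qed
  then show "(\<Sum>v\<in>S. bary v x) = 1" "(\<Sum>v\<in>S. bary v x *\<^sub>R v) = x" using c by simp_all
qed

lemma bary_diff: "bary v y - bary v x = - ((y - x) \<bullet> nrm v) / height v"
  by (simp add: bary_def diff_divide_distrib[symmetric] inner_diff_left)

lemma bary_segment: "bary w (v + s *\<^sub>R (y - v)) = (1 - s) * bary w v + s * bary w y"
proof -
  have "bary w (v + s *\<^sub>R (y - v)) - bary w v = s * (bary w y - bary w v)"
    unfolding bary_diff by simp
  then show ?thesis by (simp add: algebra_simps)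
qed

lemma continuous_bary[continuous_intros]: "continuous_on A (bary v)"
  unfolding bary_def divide_inverse by (intro continuous_intros)

lemma mem_simplex_iff: "x \<in> \<tau> \<longleftrightarrow> (\<forall>v\<in>S. 0 \<le> bary v x)"
proof
  assume "x \<in> \<tau>"
  then obtain c where c: "\<forall>w\<in>S. 0 \<le> c w" "sum c S = 1" "(\<Sum>w\<in>S. c w *\<^sub>R w) = x"
    by (auto simp: convex_hull_finite)
  show "\<forall>v\<in>S. 0 \<le> bary v x"
  proof
    fix v assume v: "v \<in> S"
    have "bary v x = (\<Sum>w\<in>S. c w * bary v w)"
      unfolding c(3)[symmetric] using c(2) by (intro bary_affine) auto
    also have "\<dots> \<ge> 0" using c(1) bary_vertex[OF v] by (intro sum_nonneg) auto
    finally show "0 \<le> bary v x" .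
  qed
next
  assume "\<forall>v\<in>S. 0 \<le> bary v x"
  then show "x \<in> \<tau>"
    using sum_bary[of x] sum_bary_vertex[of x] by (auto simp: convex_hull_finite)
qed

lemma bary_le_1: "x \<in> \<tau> \<Longrightarrow> v \<in> S \<Longrightarrow> bary v x \<le> 1"
  using sum_bary[of x] mem_simplex_iff member_le_sum[of v S "\<lambda>v. bary v x"] by auto

lemma mem_facet_iff: "v \<in> S \<Longrightarrow> x \<in> F v \<longleftrightarrow> x \<in> \<tau> \<and> bary v x = 0"
proof
  assume v: "v \<in> S" and "x \<in> F v" then show "x \<in> \<tau> \<and> bary v x = 0"
    using F_subset bary_F by auto
next
  assume v: "v \<in> S" and x: "x \<in> \<tau> \<and> bary v x = 0"
  then have "(\<Sum>w\<in>S - {v}. bary w x) = 1" "(\<Sum>w\<in>S - {v}. bary w x *\<^sub>R w) = x"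
    using sum_bary[of x] sum_bary_vertex[of x] by (simp_all add: sum_diff1)
  then show "x \<in> F v" using x unfolding mem_simplex_iff by (auto simp: convex_hull_finite)
qed

lemma open_bary_pos: "open {x. \<forall>v\<in>S. 0 < bary v x}"
proof -
  have "{x. \<forall>v\<in>S. 0 < bary v x} = (\<Inter>v\<in>S. {x. 0 < bary v x})" by auto
  moreover have "open {x. 0 < bary v x}" for v
    by (intro open_Collect_less continuous_intros)
  ultimately show ?thesis by (simp add: open_INT)
qed

lemma interior_simplex: "interior \<tau> = {x. \<forall>v\<in>S. 0 < bary v x}"
proof (rule antisym)
  show "{x. \<forall>v\<in>S. 0 < bary v x} \<subseteq> interior \<tau>"
    using open_bary_pos by (intro interior_maximal) (auto simp: mem_simplex_iff less_imp_le)
  show "interior \<tau> \<subseteq> {x. \<forall>v\<in>S. 0 < bary v x}"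
  proof clarify
    fix x v assume x: "x \<in> interior \<tau>" and v: "v \<in> S"
    then obtain e where e: "e > 0" "cball x e \<subseteq> \<tau>" by (meson mem_interior_cball)
    \<comment> \<open>Moving outwards by e lowers \<open>bary v\<close> by e /
      \<open>height v\<close>, so there must have been room.\<close>
    then have "x + e *\<^sub>R nrm v \<in> \<tau>" using norm_nrm[OF v] by (auto simp: dist_norm subset_iff)
    then have "0 \<le> bary v (x + e *\<^sub>R nrm v)" using v by (simp add: mem_simplex_iff)
    also have "\<dots> = bary v x - e / height v"
      using bary_diff[of v "x + e *\<^sub>R nrm v" x] norm_nrm[OF v] by (simp add: norm_eq_1)
    also have "\<dots> < bary v x" using e height_pos[OF v] by simp
    finally show "0 < bary v x" .
  qed
qed

lemma compact_simplex: "compact \<tau>" by (intro compact_convex_hull finite_imp_compact) simp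
lemma closed_simplex: "closed \<tau>" using compact_simplex by (rule compact_imp_closed)
lemma compact_F: "compact (F v)" by (intro compact_convex_hull finite_imp_compact) simp

lemma borel_simplex[measurable]: "\<tau> \<in> sets borel" using closed_simplex by auto
lemma borel_F[measurable]: "F v \<in> sets borel" using compact_imp_closed[OF compact_F] by auto

lemma interior_nonempty: "interior \<tau> \<noteq> {}"
proof -
  define c where "c = (\<Sum>w\<in>S. (1 / real (card S)) *\<^sub>R w)"
  have "bary v c = 1 / real (card S)" if "v \<in> S" for v
  proof -
    have "bary v c = (\<Sum>w\<in>S. (1 / real (card S)) * bary v w)"
      unfolding c_def using cardS by (intro bary_affine) auto
    also have "\<dots> = (\<Sum>w\<in>S. if v = w then 1 / real (card S) else 0)"
      using bary_vertex[OF that] by (intro sum.cong) auto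
    finally show ?thesis using that by simp
  qed
  then have "c \<in> interior \<tau>" using cardS by (simp add: interior_simplex)
  then show ?thesis by blast
qed

lemma closure_interior: "closure (interior \<tau>) = \<tau>"
  using convex_closure_interior[OF convex_convex_hull interior_nonempty] closed_simplex by simp

section \<open>Surface measure on a facet and the simplex as a cone\<close>

text \<open>A density instead of a restricted space keeps the Borel sets of the whole space, so that
  facet and volume integrands share one notion of measurability.\<close>

definition facet_measure :: "real^'n \<Rightarrow> (real^'n) measure" where
  "facet_measure v = density (face_measure (F v)) (indicator (F v))"

lemma sets_face_measure: "sets (face_measure A) = sets (borel :: (real^'n) measure)"
  by (simp add: face_measure_def Let_def)

lemma sets_facet_measure[simp, measurable_cong]: "sets (facet_measure v) = sets borel"
  by (simp add: facet_measure_def sets_face_measure)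

lemma space_facet_measure[simp]: "space (facet_measure v) = UNIV"
  using sets_eq_imp_space_eq[OF sets_facet_measure] by simp

lemma nn_integral_facet_measure:
  assumes "f \<in> borel_measurable borel"
  shows "(\<integral>\<^sup>+y. f y \<partial>facet_measure v) = (\<integral>\<^sup>+y. f y * indicator (F v) y \<partial>face_measure (F v))"
  unfolding facet_measure_def using assms sets_face_measure[of "F v"]
  by (subst nn_integral_density) (auto simp: mult.commute cong: measurable_cong_sets)

lemma AE_facet_measure: "AE y in facet_measure v. y \<in> F v"
  unfolding facet_measure_def using sets_face_measure[of "F v"]
  by (subst AE_density) (auto simp: indicator_def cong: measurable_cong_sets)

text \<open>The cone formula is applied to f times the indicator of the simplex. For y in the facet
  plane and 0 < s \<le> 1 the point v + s (y - v) has coordinates \<open>s * bary w y\<close> for w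
  \<noteq> v and 1 - s for v, so it lies in the simplex exactly when y lies in the facet.\<close>

lemma nn_integral_simplex_cone:
  assumes v: "v \<in> S" and f[measurable]: "f \<in> borel_measurable borel"
  shows "(\<integral>\<^sup>+x. f x * indicator \<tau> x \<partial>lborel)
       = (\<integral>\<^sup>+s. ennreal (height v * s ^ (CARD('n) - 1)) * (\<integral>\<^sup>+y. f (v + s *\<^sub>R (y - v)) \<partial>facet_measure v)
            * indicator {0..1} s \<partial>lborel)"
proof -
  obtain B where B: "orthonormal_set (insert (nrm v) B)" "nrm v \<notin> B" "Suc (card B) = CARD('n)"
    "face_measure (F v) = plane_measure (base v) B"
    by (rule facet_props[OF v])
  have cB: "card B = CARD('n) - 1" using B(3) by simp
  let ?J = "{x. 0 \<le> (x - v) \<bullet> nrm v \<and> (x - v) \<bullet> nrm v \<le> height v}"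
  have baryJ: "(x - v) \<bullet> nrm v = height v * (1 - bary v x)" for x
    using bary_diff[of v x v] bary_vertex[OF v v] height_pos[OF v] by (simp add: field_simps)
  have plane: "bary v (base v + (\<Sum>b\<in>B. t b *\<^sub>R b)) = 0" for t
  proof -
    have "(\<Sum>b\<in>B. t b *\<^sub>R b) \<bullet> nrm v = 0"
      unfolding inner_sum_left using orthonormal_set_inner[OF B(1)] B(2)
      by (intro sum.neutral) auto
    then show ?thesis by (simp add: bary_def)
  qed
  have "(\<integral>\<^sup>+x. f x * indicator \<tau> x \<partial>lborel) = (\<integral>\<^sup>+x. (f x * indicator \<tau> x) * indicator ?J x \<partial>lborel)"
  proof (rule nn_integral_cong)
    fix x
    have "x \<in> ?J" if "x \<in> \<tau>"
      using that v height_pos[OF v] bary_le_1[OF that v] unfolding baryJ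
      by (auto simp: mem_simplex_iff mult_le_cancel_left1)
    then show "f x * indicator \<tau> x = (f x * indicator \<tau> x) * indicator ?J x"
      by (auto simp: indicator_def)
  qed
  also have "\<dots> = (\<integral>\<^sup>+s. ennreal (height v * s ^ card B)
      * (\<integral>\<^sup>+y. f (v + s *\<^sub>R (y - v)) * indicator \<tau> (v + s *\<^sub>R (y - v)) \<partial>plane_measure (base v) B)
            * indicator {0..1} s \<partial>lborel)"
    using B height_pos[OF v] by (intro nn_integral_cone) (auto simp: height_def)
  also have "\<dots> = (\<integral>\<^sup>+s. ennreal (height v * s ^ (CARD('n) - 1)) * (\<integral>\<^sup>+y. f (v + s *\<^sub>R (y - v)) \<partial>facet_measure v)
            * indicator {0..1} s \<partial>lborel)"
  proof (rule nn_integral_cong_AE)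
    show "AE s in lborel. ennreal (height v * s ^ card B)
      * (\<integral>\<^sup>+y. f (v + s *\<^sub>R (y - v)) * indicator \<tau> (v + s *\<^sub>R (y - v)) \<partial>plane_measure (base v) B) * indicator {0..1} s
      = ennreal (height v * s ^ (CARD('n) - 1)) * (\<integral>\<^sup>+y. f (v + s *\<^sub>R (y - v)) \<partial>facet_measure v) * indicator {0..1} s"
      using AE_lborel_singleton[of "0::real"]
    proof eventually_elim
      case (elim s)
      show ?case
      proof (cases "s \<in> {0..1}")
        case True
        then have s: "0 < s" "s \<le> 1" using elim by auto
        have ind: "indicator \<tau> (v + s *\<^sub>R (y - v)) = (indicator (F v) y :: ennreal)" if "bary v y = 0" for y
        proof -
          have "v + s *\<^sub>R (y - v) \<in> \<tau> \<longleftrightarrow> y \<in> F v"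
          proof -
            have "v + s *\<^sub>R (y - v) \<in> \<tau> \<longleftrightarrow> (\<forall>w\<in>S. 0 \<le> bary w y)"
              unfolding mem_simplex_iff
            proof (intro ball_cong refl)
              fix w assume w: "w \<in> S"
              show "0 \<le> bary w (v + s *\<^sub>R (y - v)) \<longleftrightarrow> 0 \<le> bary w y"
                using that s bary_vertex[OF w v] by (cases "w = v") (auto simp: bary_segment zero_le_mult_iff)
            qed
            also have "\<dots> \<longleftrightarrow> y \<in> F v" using that v by (simp add: mem_facet_iff mem_simplex_iff)
            finally show ?thesis .
          qed
          then show ?thesis by (auto simp: indicator_def)
        qed
        have "(\<integral>\<^sup>+y. f (v + s *\<^sub>R (y - v)) * indicator \<tau> (v + s *\<^sub>R (y - v)) \<partial>plane_measure (base v) B)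
            = (\<integral>\<^sup>+y. f (v + s *\<^sub>R (y - v)) * indicator (F v) y \<partial>plane_measure (base v) B)"
          by (simp add: nn_integral_plane_measure ind plane)
        also have "\<dots> = (\<integral>\<^sup>+y. f (v + s *\<^sub>R (y - v)) \<partial>facet_measure v)"
          by (subst nn_integral_facet_measure) (auto simp: B(4))
        finally show ?thesis by (simp add: cB)
      qed simp
    qed
  qed
  finally show ?thesis .
qed

text \<open>Cancelling this weight carries finiteness and null sets from the volume over to the
  facet.\<close>

lemma cone_weight_nonzero:
  assumes v: "v \<in> S"
  shows "(\<integral>\<^sup>+s. ennreal (height v * s ^ (CARD('n) - 1)) * indicator {0..1} s \<partial>lborel) \<noteq> 0"
proof
  assume "(\<integral>\<^sup>+s. ennreal (height v * s ^ (CARD('n) - 1)) * indicator {0..1} s \<partial>lborel) = 0"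
  then have "AE s in lborel. ennreal (height v * s ^ (CARD('n) - 1)) * indicator {0..1} s = 0"
    by (subst (asm) nn_integral_0_iff_AE) auto
  then have "AE s in lborel. s \<notin> {0<..<1::real}"
    by eventually_elim (use height_pos[OF v] in \<open>auto simp: indicator_def mult_le_0_iff\<close>)
  then have "{0<..<1::real} \<in> null_sets lborel"
    using AE_iff_null_sets[of "{0<..<1::real}" lborel] by simp
  then show False by (auto dest: null_setsD1)
qed

text \<open>With f = 1 the cone formula reads weight times area equals volume, and the volume is
  finite.\<close>

lemma finite_facet_measure:
  assumes v: "v \<in> S" shows "finite_measure (facet_measure v)"
proof
  let ?I = "\<integral>\<^sup>+s. ennreal (height v * s ^ (CARD('n) - 1)) * indicator {0..1} s \<partial>lborel"
  have "?I * emeasure (facet_measure v) UNIV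
      = (\<integral>\<^sup>+s. ennreal (height v * s ^ (CARD('n) - 1)) * indicator {0..1} s * emeasure (facet_measure v) UNIV \<partial>lborel)"
    by (rule nn_integral_multc[symmetric]) measurable
  also have "\<dots> = (\<integral>\<^sup>+s. ennreal (height v * s ^ (CARD('n) - 1)) * (\<integral>\<^sup>+y. 1 \<partial>facet_measure v) * indicator {0..1} s \<partial>lborel)"
    by (rule nn_integral_cong) (simp add: mult_ac)
  also have "\<dots> = (\<integral>\<^sup>+x. 1 * indicator \<tau> x \<partial>lborel)"
    by (rule nn_integral_simplex_cone[OF v, symmetric]) simp
  also have "\<dots> = emeasure lborel \<tau>" by simp
  also have "\<dots> < \<infinity>" using compact_simplex by (intro emeasure_bounded_finite) (rule compact_imp_bounded)
  finally have "?I * emeasure (facet_measure v) UNIV < \<infinity>" .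
  then show "emeasure (facet_measure v) (space (facet_measure v)) \<noteq> \<infinity>"
    using cone_weight_nonzero[OF v] by (auto simp: ennreal_mult_less_top less_top[symmetric] ennreal_mult_eq_top_iff)
qed

text \<open>Read on indicators, the cone formula for nonnegative functions says that Lebesgue
  measure on the simplex is the image of a weighted product measure; integrals of vector valued
  functions then follow by change of variables.\<close>

lemma integral_simplex_cone:
  fixes f :: "real^'n \<Rightarrow> 'b::{banach, second_countable_topology}"
  assumes v: "v \<in> S" and f[measurable]: "f \<in> borel_measurable borel"
  shows "(\<integral>x. indicator \<tau> x *\<^sub>R f x \<partial>lborel)
       = (\<integral>(s,y). (height v * s ^ (CARD('n) - 1) * indicator {0..1} s) *\<^sub>R f (v + s *\<^sub>R (y - v)) \<partial>(lborel \<Otimes>\<^sub>M facet_measure v))"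
proof -
  interpret N: finite_measure "facet_measure v" using v by (rule finite_facet_measure)
  interpret LN: pair_sigma_finite "lborel :: real measure" "facet_measure v" ..
  let ?g = "\<lambda>(s::real, y::real^'n). ennreal (height v * s ^ (CARD('n) - 1) * indicator {0..1} s)"
  let ?h = "\<lambda>(s::real, y::real^'n). v + s *\<^sub>R (y - v)"
  let ?M = "density (lborel \<Otimes>\<^sub>M facet_measure v) ?g"
  have [measurable]: "?h \<in> borel_measurable (lborel \<Otimes>\<^sub>M facet_measure v)" by measurable
  have [measurable]: "?g \<in> borel_measurable (lborel \<Otimes>\<^sub>M facet_measure v)" by measurable
  have "density lborel (indicator \<tau>) = distr ?M borel ?h"
  proof (rule measure_eqI)
    fix A assume "A \<in> sets (density lborel (indicator \<tau>))"
    then have [measurable]: "A \<in> sets borel" by simp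
    have "emeasure (density lborel (indicator \<tau>)) A = (\<integral>\<^sup>+x. indicator A x * indicator \<tau> x \<partial>lborel)"
      by (simp add: emeasure_density mult.commute)
    also have "\<dots> = (\<integral>\<^sup>+s. ennreal (height v * s ^ (CARD('n) - 1)) * (\<integral>\<^sup>+y. indicator A (v + s *\<^sub>R (y - v)) \<partial>facet_measure v)
            * indicator {0..1} s \<partial>lborel)"
      by (rule nn_integral_simplex_cone[OF v]) simp
    also have "\<dots> = (\<integral>\<^sup>+s. (\<integral>\<^sup>+y. ?g (s, y) * indicator A (?h (s, y)) \<partial>facet_measure v) \<partial>lborel)"
      by (rule nn_integral_cong) (auto simp: nn_integral_cmult indicator_def)
    also have "\<dots> = (\<integral>\<^sup>+z. ?g z * indicator A (?h z) \<partial>(lborel \<Otimes>\<^sub>M facet_measure v))"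
      by (rule N.nn_integral_fst) measurable
    also have "\<dots> = (\<integral>\<^sup>+z. indicator A (?h z) \<partial>?M)"
      by (subst nn_integral_density) auto
    also have "\<dots> = (\<integral>\<^sup>+z. indicator A z \<partial>distr ?M borel ?h)"
      by (subst nn_integral_distr) auto
    also have "\<dots> = emeasure (distr ?M borel ?h) A" by simp
    finally show "emeasure (density lborel (indicator \<tau>)) A = emeasure (distr ?M borel ?h) A" .
  qed simp
  then have "(\<integral>x. f x \<partial>density lborel (indicator \<tau>)) = (\<integral>x. f x \<partial>distr ?M borel ?h)" by simp
  also have "(\<integral>x. f x \<partial>density lborel (indicator \<tau>)) = (\<integral>x. indicator \<tau> x *\<^sub>R f x \<partial>lborel)"
  proof -
    have "indicator \<tau> = (\<lambda>x. ennreal (indicator \<tau> x))" by (auto simp: indicator_def)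
    then show ?thesis using integral_density[of f lborel "indicator \<tau>"] by simp
  qed
  also have "(\<integral>x. f x \<partial>distr ?M borel ?h) = (\<integral>z. f (?h z) \<partial>?M)"
    by (rule integral_distr) auto
  also have "\<dots> = (\<integral>z. (case z of (s, y) \<Rightarrow> height v * s ^ (CARD('n) - 1) * indicator {0..1} s) *\<^sub>R f (?h z) \<partial>(lborel \<Otimes>\<^sub>M facet_measure v))"
  proof -
    have *: "?g = (\<lambda>z. ennreal (case z of (s, y) \<Rightarrow> height v * s ^ (CARD('n) - 1) * indicator {0..1} s))"
      by auto
    show ?thesis unfolding *
      using height_pos[OF v] by (intro integral_density) (auto simp: indicator_def)
  qed
  finally show ?thesis by (simp add: case_prod_unfold)
qed

end

section \<open>The inverse trace inequality\<close>

text \<open>The leading terms cancel, because the shift \<open>[:1, 1:]\<close> has leading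
  coefficient 1.\<close>

lemma poly_forward_difference_degree:
  fixes q :: "'a::idom poly"
  assumes "degree q \<le> Suc k"
  shows "degree (q - pcompose q [:1, 1:]) \<le> k"
proof (rule degree_le, intro allI impI)
  fix i assume i: "k < i"
  have d: "degree (pcompose q [:1, 1:]) = degree q" by (simp add: degree_pcompose)
  show "coeff (q - pcompose q [:1, 1:]) i = 0"
  proof (cases "i = degree q")
    case True
    have "lead_coeff (pcompose q [:1, 1:]) = lead_coeff q * lead_coeff [:1, 1:] ^ degree q"
      by (rule lead_coeff_comp) simp
    then show ?thesis using True d by simp
  next
    case False
    then have "degree q < i" using assms i by simp
    then show ?thesis using d by (simp add: coeff_eq_0)
  qed
qed

text \<open>The \<open>a i\<close> constructed here are the signed binomial coefficients of (1 -
  E)^(k+1), with E the shift by 1: the induction multiplies by 1 - E, which is Pascal's rule for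
  \<open>b\<close>. Their vanishing beyond k + 1 lets the sums of two consecutive stages be
  aligned.\<close>

lemma poly_difference_coeffs:
  "\<exists>a :: nat \<Rightarrow> real. a 0 = 1 \<and> (\<forall>i>Suc k. a i = 0) \<and>
     (\<forall>q :: complex poly. degree q \<le> k \<longrightarrow> (\<Sum>i\<le>Suc k. of_real (a i) * poly q (of_nat i)) = 0)"
proof (induction k)
  case 0
  define a :: "nat \<Rightarrow> real" where "a i = (if i = 0 then 1 else if i = 1 then -1 else 0)" for i
  have "(\<Sum>i\<le>Suc 0. of_real (a i) * poly q (of_nat i)) = 0" if "degree q \<le> 0" for q :: "complex poly"
  proof -
    obtain c where "q = [:c:]" using \<open>degree q \<le> 0\<close> by (metis degree_eq_zeroE le_zero_eq)
    then show ?thesis by (simp add: a_def)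
  qed
  then show ?case by (intro exI[of _ a]) (auto simp: a_def)
next
  case (Suc k)
  then obtain a :: "nat \<Rightarrow> real" where a: "a 0 = 1" "\<And>i. i > Suc k \<Longrightarrow> a i = 0"
    "\<And>q :: complex poly. degree q \<le> k \<Longrightarrow> (\<Sum>i\<le>Suc k. of_real (a i) * poly q (of_nat i)) = 0" by auto
  define b :: "nat \<Rightarrow> real" where "b i = (case i of 0 \<Rightarrow> 1 | Suc j \<Rightarrow> a (Suc j) - a j)" for i
  have "(\<Sum>i\<le>Suc (Suc k). of_real (b i) * poly q (of_nat i)) = 0" if q: "degree q \<le> Suc k" for q :: "complex poly"
  proof -
    have "(\<Sum>i\<le>Suc (Suc k). of_real (b i) * poly q (of_nat i))
        = of_real (b 0) * poly q (of_nat 0) + (\<Sum>i\<le>Suc k. of_real (b (Suc i)) * poly q (of_nat (Suc i)))"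
      by (rule sum.atMost_Suc_shift)
    also have "\<dots> = (of_real (a 0) * poly q (of_nat 0) + (\<Sum>i\<le>Suc k. of_real (a (Suc i)) * poly q (of_nat (Suc i))))
        - (\<Sum>i\<le>Suc k. of_real (a i) * poly q (of_nat (Suc i)))"
      by (simp add: b_def a(1) left_diff_distrib sum_subtractf del: sum.atMost_Suc)
    also have "of_real (a 0) * poly q (of_nat 0) + (\<Sum>i\<le>Suc k. of_real (a (Suc i)) * poly q (of_nat (Suc i)))
        = (\<Sum>i\<le>Suc (Suc k). of_real (a i) * poly q (of_nat i))"
      by (rule sum.atMost_Suc_shift[symmetric])
    also have "\<dots> = (\<Sum>i\<le>Suc k. of_real (a i) * poly q (of_nat i))"
      using a(2)[of "Suc (Suc k)"] by simp
    also have "\<dots> - (\<Sum>i\<le>Suc k. of_real (a i) * poly q (of_nat (Suc i)))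
        = (\<Sum>i\<le>Suc k. of_real (a i) * poly (q - pcompose q [:1, 1:]) (of_nat i))"
      by (simp add: sum_subtractf[symmetric] poly_pcompose right_diff_distrib del: sum.atMost_Suc)
    also have "\<dots> = 0" using poly_forward_difference_degree[OF q] by (rule a(3))
    finally show ?thesis .
  qed
  then show ?case using a(2) by (intro exI[of _ b]) (auto simp: b_def split: nat.split)
qed

lemma poly_space_along_line:
  assumes "p \<in> poly_space k"
  obtains q :: "complex poly" where "degree q \<le> k" "\<And>t::real. p (x + t *\<^sub>R w) = poly q (of_real t)"
proof -
  let ?A = "{\<alpha> :: 'a \<Rightarrow> nat. (\<Sum>j\<in>UNIV. \<alpha> j) \<le> k}"
  obtain c where c: "\<And>x. p x = (\<Sum>\<alpha>\<in>?A. c \<alpha> * (\<Prod>j\<in>UNIV. complex_of_real (x $ j) ^ \<alpha> j))"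
    using assms unfolding poly_space_def by blast
  define q where "q = (\<Sum>\<alpha>\<in>?A. smult (c \<alpha>) (\<Prod>j\<in>UNIV. [:complex_of_real (x $ j), complex_of_real (w $ j):] ^ \<alpha> j))"
  have "degree (smult (c \<alpha>) (\<Prod>j\<in>UNIV. [:complex_of_real (x $ j), complex_of_real (w $ j):] ^ \<alpha> j)) \<le> k"
    if "\<alpha> \<in> ?A" for \<alpha>
  proof -
    have "degree (smult (c \<alpha>) (\<Prod>j\<in>UNIV. [:complex_of_real (x $ j), complex_of_real (w $ j):] ^ \<alpha> j))
      \<le> degree (\<Prod>j\<in>UNIV. [:complex_of_real (x $ j), complex_of_real (w $ j):] ^ \<alpha> j)" by (rule degree_smult_le)
    also have "\<dots> \<le> (\<Sum>j\<in>UNIV. degree ([:complex_of_real (x $ j), complex_of_real (w $ j):] ^ \<alpha> j))"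
      using degree_prod_sum_le[of UNIV "\<lambda>j. [:complex_of_real (x $ j), complex_of_real (w $ j):] ^ \<alpha> j"] by (simp add: o_def)
    also have "\<dots> \<le> (\<Sum>j\<in>UNIV. \<alpha> j)"
    proof (rule sum_mono)
      fix j
      have "degree ([:complex_of_real (x $ j), complex_of_real (w $ j):] ^ \<alpha> j)
         \<le> degree [:complex_of_real (x $ j), complex_of_real (w $ j):] * \<alpha> j" by (rule degree_power_le)
      also have "\<dots> \<le> 1 * \<alpha> j" by (intro mult_right_mono) (auto simp: degree_pCons_le)
      finally show "degree ([:complex_of_real (x $ j), complex_of_real (w $ j):] ^ \<alpha> j) \<le> \<alpha> j" by simp
    qed
    also have "\<dots> \<le> k" using that by simp
    finally show ?thesis .
  qed
  \<comment> \<open>For an infinite \<open>?A\<close> the sum would be 0 by convention and the bound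
    trivial.\<close>
  then have "degree q \<le> k"
    unfolding q_def by (cases "finite ?A") (auto intro!: degree_sum_le)
  moreover have "p (x + t *\<^sub>R w) = poly q (of_real t)" for t
    by (simp add: c q_def poly_sum poly_prod mult.commute)
  ultimately show ?thesis by (rule that)
qed

section \<open>Continuously differentiable functions\<close>

text \<open>Continuity is asked for each fixed direction, which avoids a norm on derivatives and
  yields the coordinate form in \<open>test_function\<close> at once.\<close>

definition C1_fun :: "('a::real_normed_vector \<Rightarrow> 'b::real_normed_vector) \<Rightarrow> bool" where
  "C1_fun f \<longleftrightarrow> (\<forall>x. f differentiable (at x)) \<and> (\<forall>h. continuous_on UNIV (\<lambda>x. frechet_derivative f (at x) h))"

lemma C1_funI:
  assumes "\<And>x. (f has_derivative f' x) (at x)" "\<And>h. continuous_on UNIV (\<lambda>x. f' x h)"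
  shows "C1_fun f"
proof -
  have "frechet_derivative f (at x) = f' x" for x
    using assms(1) by (metis frechet_derivative_at)
  then show ?thesis using assms unfolding C1_fun_def differentiable_def by auto
qed

lemma C1_fun_deriv:
  assumes "C1_fun f" shows "(f has_derivative frechet_derivative f (at x)) (at x)"
  using assms frechet_derivative_works unfolding C1_fun_def by blast

lemma C1_fun_continuous:
  assumes "C1_fun f" shows "continuous_on A f"
  using assms C1_fun_deriv differentiable_imp_continuous_on
  by (meson C1_fun_def continuous_on_subset differentiable_at_imp_differentiable_on top_greatest)

lemma C1_fun_continuous_deriv:
  assumes "C1_fun f" shows "continuous_on A (\<lambda>x. frechet_derivative f (at x) h)"
  using assms continuous_on_subset unfolding C1_fun_def by blast

lemma C1_fun_const: "C1_fun (\<lambda>x. c)"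
  by (rule C1_funI[of _ "\<lambda>_ _. 0"]) (auto intro!: derivative_eq_intros)

lemma C1_fun_bounded_linear:
  assumes "bounded_linear f" shows "C1_fun f"
  using assms by (intro C1_funI[of _ "\<lambda>_. f"]) (auto intro: bounded_linear_imp_has_derivative)

lemma C1_fun_add:
  assumes "C1_fun f" "C1_fun g" shows "C1_fun (\<lambda>x. f x + g x)"
  using C1_fun_deriv[OF assms(1)] C1_fun_deriv[OF assms(2)]
    C1_fun_continuous_deriv[OF assms(1)] C1_fun_continuous_deriv[OF assms(2)]
  by (intro C1_funI[of _ "\<lambda>x h. frechet_derivative f (at x) h + frechet_derivative g (at x) h"])
     (auto intro!: has_derivative_add continuous_intros)

lemma C1_fun_mult:
  fixes f g :: "'a::real_normed_vector \<Rightarrow> 'b::real_normed_algebra"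
  assumes "C1_fun f" "C1_fun g" shows "C1_fun (\<lambda>x. f x * g x)"
  using C1_fun_deriv[OF assms(1)] C1_fun_deriv[OF assms(2)]
    C1_fun_continuous_deriv[OF assms(1)] C1_fun_continuous_deriv[OF assms(2)]
    C1_fun_continuous[OF assms(1)] C1_fun_continuous[OF assms(2)]
  by (intro C1_funI[of _ "\<lambda>x h. f x * frechet_derivative g (at x) h + frechet_derivative f (at x) h * g x"])
     (auto intro!: has_derivative_mult continuous_intros)

lemma C1_fun_sum:
  assumes "\<And>i. i \<in> I \<Longrightarrow> C1_fun (f i)" shows "C1_fun (\<lambda>x. \<Sum>i\<in>I. f i x)"
  using assms by (induction I rule: infinite_finite_induct) (auto intro: C1_fun_const C1_fun_add)

lemma C1_fun_prod:
  fixes f :: "'i \<Rightarrow> 'a::real_normed_vector \<Rightarrow> 'b::{real_normed_algebra, comm_ring_1}"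
  assumes "\<And>i. i \<in> I \<Longrightarrow> C1_fun (f i)" shows "C1_fun (\<lambda>x. \<Prod>i\<in>I. f i x)"
  using assms by (induction I rule: infinite_finite_induct) (auto intro: C1_fun_const C1_fun_mult)

lemma C1_fun_power:
  fixes f :: "'a::real_normed_vector \<Rightarrow> 'b::{real_normed_algebra, comm_ring_1}"
  assumes "C1_fun f" shows "C1_fun (\<lambda>x. f x ^ n)"
  using assms by (induction n) (auto intro: C1_fun_const C1_fun_mult)

lemma C1_fun_compose_linear:
  assumes "C1_fun f" "bounded_linear g" shows "C1_fun (\<lambda>x. g (f x))"
proof (rule C1_funI)
  show "((\<lambda>x. g (f x)) has_derivative (\<lambda>h. g (frechet_derivative f (at x) h))) (at x)" for x
    using C1_fun_deriv[OF assms(1)] assms(2) by (rule bounded_linear.has_derivative[rotated])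
  show "continuous_on UNIV (\<lambda>x. g (frechet_derivative f (at x) h))" for h
    using C1_fun_continuous_deriv[OF assms(1)] assms(2) by (rule bounded_linear.continuous_on[rotated])
qed

lemma poly_space_C1:
  assumes "p \<in> poly_space k" shows "C1_fun p"
proof -
  obtain c where c: "\<And>x. p x = (\<Sum>\<alpha> | (\<Sum>j\<in>UNIV. \<alpha> j) \<le> k. c \<alpha> * (\<Prod>j\<in>UNIV. complex_of_real (x $ j) ^ \<alpha> j))"
    using assms unfolding poly_space_def by blast
  have "C1_fun (\<lambda>x::real^'a. complex_of_real (x $ j))" for j
    by (intro C1_fun_bounded_linear bounded_linear_compose[OF bounded_linear_of_real bounded_linear_vec_nth])
  then have "C1_fun (\<lambda>x. \<Sum>\<alpha> | (\<Sum>j\<in>UNIV. \<alpha> j) \<le> k. c \<alpha> * (\<Prod>j\<in>UNIV. complex_of_real (x $ j) ^ \<alpha> j))"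
    by (intro C1_fun_sum C1_fun_mult C1_fun_prod C1_fun_power C1_fun_const) auto
  then show ?thesis unfolding c[abs_def] by (simp add: c[abs_def])
qed

text \<open>A coordinate-free substitute for being a polynomial of degree less than \<open>K\<close>: it is stable
  under partial differentiation because the identity can be differentiated in \<open>x\<close>.\<close>

definition difference_annihilated :: "(nat \<Rightarrow> real) \<Rightarrow> nat \<Rightarrow> ('a::real_vector \<Rightarrow> 'b::real_vector) \<Rightarrow> bool" where
  "difference_annihilated a K f \<longleftrightarrow> (\<forall>x w. (\<Sum>i\<le>K. a i *\<^sub>R f (x + real i *\<^sub>R w)) = 0)"

lemma poly_space_annihilated:
  assumes "p \<in> poly_space k"
    and a: "\<And>q :: complex poly. degree q \<le> k \<Longrightarrow> (\<Sum>i\<le>Suc k. of_real (a i) * poly q (of_nat i)) = 0"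
  shows "difference_annihilated a (Suc k) p"
  unfolding difference_annihilated_def
proof (intro allI)
  fix x w
  obtain q :: "complex poly" where "degree q \<le> k" "\<And>t::real. p (x + t *\<^sub>R w) = poly q (of_real t)"
    using poly_space_along_line[OF assms(1), of x w thesis for thesis] by blast
  then show "(\<Sum>i\<le>Suc k. a i *\<^sub>R p (x + real i *\<^sub>R w)) = 0"
    using a[of q] by (simp add: scaleR_conv_of_real[where 'a=complex] del: sum.atMost_Suc)
qed

lemma frechet_derivative_annihilated:
  assumes ann: "difference_annihilated a K f" and f: "C1_fun f"
  shows "difference_annihilated a K (\<lambda>x. frechet_derivative f (at x) h)"
  unfolding difference_annihilated_def
proof (intro allI)
  fix x w
  have "((\<lambda>x. f (x + real i *\<^sub>R w)) has_derivative frechet_derivative f (at (x + real i *\<^sub>R w))) (at x)" for i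
    by (rule has_derivative_compose[of "\<lambda>x. x + real i *\<^sub>R w" "\<lambda>h. h", OF _ C1_fun_deriv[OF f]])
       (auto intro!: derivative_eq_intros)
  then have "((\<lambda>x. \<Sum>i\<le>K. a i *\<^sub>R f (x + real i *\<^sub>R w)) has_derivative
     (\<lambda>h. \<Sum>i\<le>K. a i *\<^sub>R frechet_derivative f (at (x + real i *\<^sub>R w)) h)) (at x)"
    by (intro has_derivative_sum has_derivative_scaleR_right)
  moreover have "(\<lambda>x. \<Sum>i\<le>K. a i *\<^sub>R f (x + real i *\<^sub>R w)) = (\<lambda>x. 0)"
    using ann by (auto simp: difference_annihilated_def)
  ultimately have "(\<lambda>h. \<Sum>i\<le>K. a i *\<^sub>R frechet_derivative f (at (x + real i *\<^sub>R w)) h) = (\<lambda>h. 0)"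
    using has_derivative_unique[OF _ has_derivative_const[of 0 "at x"]] by simp
  then show "(\<Sum>i\<le>K. a i *\<^sub>R frechet_derivative f (at (x + real i *\<^sub>R w)) h) = 0" by (rule fun_cong)
qed

text \<open>The identity is solved for its term i = 0, whose coefficient is 1, and the rest is
  estimated by Cauchy-Schwarz. The step \<open>w\<close> remains free, to be averaged over.\<close>

lemma annihilated_norm_bound:
  fixes f :: "'a::real_vector \<Rightarrow> 'b::real_normed_vector"
  assumes "difference_annihilated a (Suc k) f" "a 0 = 1"
  shows "(norm (f x))\<^sup>2 \<le> (\<Sum>i\<le>k. (a (Suc i))\<^sup>2) * (\<Sum>i\<le>k. (norm (f (x + real (Suc i) *\<^sub>R w)))\<^sup>2)"
proof -
  have "0 = (\<Sum>i\<le>Suc k. a i *\<^sub>R f (x + real i *\<^sub>R w))"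
    using assms(1) by (simp add: difference_annihilated_def)
  also have "\<dots> = f x + (\<Sum>i\<le>k. a (Suc i) *\<^sub>R f (x + real (Suc i) *\<^sub>R w))"
    by (subst sum.atMost_Suc_shift) (simp add: assms(2))
  finally have "f x = - (\<Sum>i\<le>k. a (Suc i) *\<^sub>R f (x + real (Suc i) *\<^sub>R w))"
    by (simp add: eq_neg_iff_add_eq_0)
  then have "norm (f x) \<le> (\<Sum>i\<le>k. \<bar>a (Suc i)\<bar> * norm (f (x + real (Suc i) *\<^sub>R w)))"
    by (auto intro!: order_trans[OF norm_sum] sum_mono simp del: of_nat_Suc)
  then have "(norm (f x))\<^sup>2 \<le> (\<Sum>i\<le>k. \<bar>a (Suc i)\<bar> * norm (f (x + real (Suc i) *\<^sub>R w)))\<^sup>2"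
    by (intro power_mono) auto
  also have "\<dots> \<le> (\<Sum>i\<le>k. \<bar>a (Suc i)\<bar>\<^sup>2) * (\<Sum>i\<le>k. (norm (f (x + real (Suc i) *\<^sub>R w)))\<^sup>2)"
    by (rule Cauchy_Schwarz_ineq_sum)
  finally show ?thesis by simp
qed

section \<open>Averaging along the rays from a facet to the apex\<close>

context full_simplex begin

text \<open>At y in the facet the step - r (y - v) is used, so the sample points are v + s (y - v)
  with s = 1 - (i + 1) r. Integrating over y and over 0 \<le> r \<le> \<eta> turns each sample into
  an integral over slices, and the cone formula reassembles the slices into a volume
  integral.\<close>

lemma nn_inverse_trace:
  fixes f :: "real^'n \<Rightarrow> 'b::{real_normed_vector, second_countable_topology}"
  assumes v: "v \<in> S" and f: "continuous_on UNIV f"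
    and ann: "difference_annihilated a (Suc k) f" "a 0 = 1"
  shows "ennreal (height v / (2 * real (Suc k))) * (\<integral>\<^sup>+y. ennreal ((norm (f y))\<^sup>2) \<partial>facet_measure v)
     \<le> ennreal ((\<Sum>i\<le>k. (a (Suc i))\<^sup>2) * real (Suc k) * 2 ^ (CARD('n) - 1))
        * (\<integral>\<^sup>+x. ennreal ((norm (f x))\<^sup>2) * indicator \<tau> x \<partial>lborel)"
proof -
  interpret N: finite_measure "facet_measure v" using v by (rule finite_facet_measure)
  interpret LN: pair_sigma_finite "lborel :: real measure" "facet_measure v" ..
  define g where "g x = ennreal ((norm (f x))\<^sup>2)" for x
  \<comment> \<open>With this length of the averaging interval all k + 1 levels 1 - (i + 1) r stay
    in [1/2, 1], away from the apex, where the weight of the cone formula degenerates.\<close>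
  define \<eta> where "\<eta> = 1 / (2 * real (Suc k))"
  define A where "A = (\<Sum>i\<le>k. (a (Suc i))\<^sup>2)"
  define m where "m = CARD('n) - 1"
  define \<phi> where "\<phi> s = (\<integral>\<^sup>+y. g (v + s *\<^sub>R (y - v)) \<partial>facet_measure v)" for s :: real
  have [measurable]: "f \<in> borel_measurable borel" using f by (rule borel_measurable_continuous_onI)
  have [measurable]: "g \<in> borel_measurable borel" unfolding g_def by measurable
  have [measurable]: "\<phi> \<in> borel_measurable borel" unfolding \<phi>_def by measurable
  have A: "A \<ge> 0" unfolding A_def by (intro sum_nonneg) auto
  have \<eta>: "\<eta> > 0" by (simp add: \<eta>_def)
  have H: "height v > 0" using v by (rule height_pos)
  have bound: "g y \<le> ennreal A * (\<Sum>i\<le>k. g (v + (1 - real (Suc i) * r) *\<^sub>R (y - v)))" for y r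
  proof -
    have eq: "y + real (Suc i) *\<^sub>R (- r *\<^sub>R (y - v)) = v + (1 - real (Suc i) * r) *\<^sub>R (y - v)" for i
      by (simp add: algebra_simps)
    have "(norm (f y))\<^sup>2 \<le> A * (\<Sum>i\<le>k. (norm (f (v + (1 - real (Suc i) * r) *\<^sub>R (y - v))))\<^sup>2)"
      using annihilated_norm_bound[OF ann, of y "- r *\<^sub>R (y - v)"] unfolding A_def eq .
    then have "g y \<le> ennreal (A * (\<Sum>i\<le>k. (norm (f (v + (1 - real (Suc i) * r) *\<^sub>R (y - v))))\<^sup>2))"
      unfolding g_def by (rule ennreal_leI)
    also have "\<dots> = ennreal A * (\<Sum>i\<le>k. g (v + (1 - real (Suc i) * r) *\<^sub>R (y - v)))"
      unfolding g_def using A by (subst ennreal_mult) (auto intro!: sum_nonneg simp del: of_nat_Suc)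
    finally show ?thesis .
  qed
  let ?G = "\<integral>\<^sup>+y. g y \<partial>facet_measure v"
  let ?J = "\<integral>\<^sup>+s. \<phi> s * indicator {1/2..1} s \<partial>lborel"
  have step1: "?G \<le> ennreal A * (\<Sum>i\<le>k. \<phi> (1 - real (Suc i) * r))" for r
  proof -
    have "?G \<le> (\<integral>\<^sup>+y. ennreal A * (\<Sum>i\<le>k. g (v + (1 - real (Suc i) * r) *\<^sub>R (y - v))) \<partial>facet_measure v)"
      by (intro nn_integral_mono bound)
    also have "\<dots> = ennreal A * (\<Sum>i\<le>k. \<phi> (1 - real (Suc i) * r))"
      unfolding \<phi>_def by (subst nn_integral_cmult) (auto simp: nn_integral_sum)
    finally show ?thesis .
  qed
  \<comment> \<open>Substituting s = 1 - (i + 1) r produces the factor i + 1, which is at least 1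
    and is dropped.\<close>
  have step2: "(\<integral>\<^sup>+r. \<phi> (1 - real (Suc i) * r) * indicator {0..\<eta>} r \<partial>lborel) \<le> ?J" if "i \<le> k" for i
  proof -
    have "?J = \<bar>- real (Suc i)\<bar> * (\<integral>\<^sup>+r. \<phi> (1 + - real (Suc i) * r) * indicator {1/2..1} (1 + - real (Suc i) * r) \<partial>lborel)"
      by (rule nn_integral_real_affine) auto
    also have "\<dots> \<ge> 1 * (\<integral>\<^sup>+r. \<phi> (1 + - real (Suc i) * r) * indicator {1/2..1} (1 + - real (Suc i) * r) \<partial>lborel)"
      by (intro mult_right_mono) (auto simp: one_ennreal_def[symmetric] simp flip: ennreal_1 intro!: ennreal_leI)
    finally have "(\<integral>\<^sup>+r. \<phi> (1 + - real (Suc i) * r) * indicator {1/2..1} (1 + - real (Suc i) * r) \<partial>lborel) \<le> ?J"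
      by (simp only: mult_1)
    moreover have "(\<integral>\<^sup>+r. \<phi> (1 - real (Suc i) * r) * indicator {0..\<eta>} r \<partial>lborel)
        \<le> (\<integral>\<^sup>+r. \<phi> (1 + - real (Suc i) * r) * indicator {1/2..1} (1 + - real (Suc i) * r) \<partial>lborel)"
    proof -
      have "indicator {0..\<eta>} r \<le> (indicator {1/2..1} (1 + - real (Suc i) * r) :: ennreal)" for r
      proof (cases "r \<in> {0..\<eta>}")
        case True
        have "real (Suc i) * r \<le> real (Suc k) * \<eta>" using True that by (intro mult_mono) auto
        also have "\<dots> = 1/2" by (simp add: \<eta>_def field_simps)
        finally have "real (Suc i) * r \<le> 1/2" .
        moreover have "0 \<le> real (Suc i) * r" using True by (intro mult_nonneg_nonneg) auto
        ultimately show ?thesis using True by (simp add: indicator_def del: of_nat_Suc)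
      qed simp
      then have "(\<integral>\<^sup>+r. \<phi> (1 - real (Suc i) * r) * indicator {0..\<eta>} r \<partial>lborel)
         \<le> (\<integral>\<^sup>+r. \<phi> (1 + - real (Suc i) * r) * indicator {1/2..1} (1 + - real (Suc i) * r) \<partial>lborel)"
        by (intro nn_integral_mono) (simp add: mult_left_mono del: of_nat_Suc)
      then show ?thesis .
    qed
    ultimately show ?thesis by (rule order_trans[rotated])
  qed
  have "ennreal \<eta> * ?G = (\<integral>\<^sup>+r. ?G * indicator {0..\<eta>} r \<partial>lborel)"
    using \<eta> by (subst nn_integral_cmult_indicator) (auto simp: mult.commute)
  also have "\<dots> \<le> (\<integral>\<^sup>+r. (ennreal A * (\<Sum>i\<le>k. \<phi> (1 - real (Suc i) * r))) * indicator {0..\<eta>} r \<partial>lborel)"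
    by (intro nn_integral_mono mult_right_mono step1) auto
  also have "\<dots> = (\<integral>\<^sup>+r. ennreal A * (\<Sum>i\<le>k. \<phi> (1 - real (Suc i) * r) * indicator {0..\<eta>} r) \<partial>lborel)"
    by (simp add: mult.assoc sum_distrib_right)
  also have "\<dots> = ennreal A * (\<integral>\<^sup>+r. (\<Sum>i\<le>k. \<phi> (1 - real (Suc i) * r) * indicator {0..\<eta>} r) \<partial>lborel)"
    by (rule nn_integral_cmult) measurable
  also have "(\<integral>\<^sup>+r. (\<Sum>i\<le>k. \<phi> (1 - real (Suc i) * r) * indicator {0..\<eta>} r) \<partial>lborel)
      = (\<Sum>i\<le>k. \<integral>\<^sup>+r. \<phi> (1 - real (Suc i) * r) * indicator {0..\<eta>} r \<partial>lborel)"
    by (rule nn_integral_sum) measurable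
  also have "ennreal A * \<dots> \<le> ennreal A * (\<Sum>i\<le>k. ?J)"
    by (intro mult_left_mono sum_mono step2) auto
  also have "\<dots> = ennreal (A * real (Suc k)) * ?J"
    using A by (simp add: ennreal_mult ennreal_of_nat_eq_real_of_nat mult.assoc del: of_nat_Suc)
  finally have 1: "ennreal \<eta> * ?G \<le> ennreal (A * real (Suc k)) * ?J" .
  have "ennreal (height v) * ?J = (\<integral>\<^sup>+s. ennreal (height v) * (\<phi> s * indicator {1/2..1} s) \<partial>lborel)"
    by (rule nn_integral_cmult[symmetric]) measurable
  also have "\<dots> \<le> (\<integral>\<^sup>+s. ennreal (2 ^ m) * (ennreal (height v * s ^ m) * \<phi> s * indicator {0..1} s) \<partial>lborel)"
  proof (rule nn_integral_mono)
    fix s :: real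
    show "ennreal (height v) * (\<phi> s * indicator {1/2..1} s)
      \<le> ennreal (2 ^ m) * (ennreal (height v * s ^ m) * \<phi> s * indicator {0..1} s)"
    proof (cases "s \<in> {1/2..1}")
      case True
      \<comment> \<open>The weight s^m is at least 2^(-m) on the upper half of the cone; this is the
        source of the power of 2 in the constant.\<close>
      have "1 \<le> (2 * s) ^ m" using True by (intro one_le_power) auto
      then have "height v * 1 \<le> height v * (2 ^ m * s ^ m)"
        unfolding power_mult_distrib using H by (intro mult_left_mono) auto
      then have "ennreal (height v) \<le> ennreal (2 ^ m) * ennreal (height v * s ^ m)"
        using True H by (subst ennreal_mult[symmetric]) (auto intro!: ennreal_leI simp: mult_ac)
      then have "ennreal (height v) * \<phi> s \<le> ennreal (2 ^ m) * ennreal (height v * s ^ m) * \<phi> s"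
        by (rule mult_right_mono) simp
      then show ?thesis using True by (simp add: mult.assoc)
    qed simp
  qed
  also have "\<dots> = ennreal (2 ^ m) * (\<integral>\<^sup>+s. ennreal (height v * s ^ m) * \<phi> s * indicator {0..1} s \<partial>lborel)"
    by (rule nn_integral_cmult) measurable
  also have "(\<integral>\<^sup>+s. ennreal (height v * s ^ m) * \<phi> s * indicator {0..1} s \<partial>lborel) = (\<integral>\<^sup>+x. g x * indicator \<tau> x \<partial>lborel)"
    unfolding \<phi>_def m_def by (rule nn_integral_simplex_cone[OF v, symmetric]) measurable
  finally have 2: "ennreal (height v) * ?J \<le> ennreal (2 ^ m) * (\<integral>\<^sup>+x. g x * indicator \<tau> x \<partial>lborel)" .
  have "ennreal (height v * \<eta>) * ?G = ennreal (height v) * (ennreal \<eta> * ?G)"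
    using H \<eta> by (simp add: ennreal_mult mult.assoc)
  also have "\<dots> \<le> ennreal (height v) * (ennreal (A * real (Suc k)) * ?J)"
    using 1 by (rule mult_left_mono) simp
  also have "\<dots> = ennreal (A * real (Suc k)) * (ennreal (height v) * ?J)"
    by (rule mult.left_commute)
  also have "\<dots> \<le> ennreal (A * real (Suc k)) * (ennreal (2 ^ m) * (\<integral>\<^sup>+x. g x * indicator \<tau> x \<partial>lborel))"
    using 2 by (rule mult_left_mono) simp
  also have "\<dots> = ennreal (A * real (Suc k) * 2 ^ m) * (\<integral>\<^sup>+x. g x * indicator \<tau> x \<partial>lborel)"
    using A by (simp add: ennreal_mult mult.assoc del: of_nat_Suc)
  finally show ?thesis by (simp add: g_def A_def m_def \<eta>_def)
qed

lemma integrable_facet_measure: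
  fixes f :: "real^'n \<Rightarrow> 'b::{banach, second_countable_topology}"
  assumes v: "v \<in> S" and f: "continuous_on (F v) f"
  shows "integrable (facet_measure v) (\<lambda>x. indicator (F v) x *\<^sub>R f x)"
proof -
  interpret N: finite_measure "facet_measure v" using v by (rule finite_facet_measure)
  have "bounded (f ` F v)" using f compact_F by (intro compact_imp_bounded compact_continuous_image)
  then obtain B where B: "\<And>x. x \<in> F v \<Longrightarrow> norm (f x) \<le> B" unfolding bounded_iff by blast
  show ?thesis
  proof (rule N.integrable_const_bound)
    show "AE x in facet_measure v. norm (indicator (F v) x *\<^sub>R f x) \<le> \<bar>B\<bar>"
      using B by (intro AE_I2) (force simp: indicator_def)
    show "(\<lambda>x. indicator (F v) x *\<^sub>R f x) \<in> borel_measurable (facet_measure v)"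
      using borel_measurable_continuous_on_indicator[OF borel_F f] by simp
  qed
qed

lemma integrable_simplex:
  fixes f :: "real^'n \<Rightarrow> 'b::{banach, second_countable_topology}"
  assumes f: "continuous_on \<tau> f"
  shows "integrable lborel (\<lambda>x. indicator \<tau> x *\<^sub>R f x)"
  using borel_integrable_compact[OF compact_simplex f] by (simp add: indicator_scaleR_eq_if)

lemma inverse_trace:
  fixes f :: "real^'n \<Rightarrow> 'b::{banach, second_countable_topology}"
  assumes v: "v \<in> S" and f: "continuous_on UNIV f"
    and ann: "difference_annihilated a (Suc k) f" "a 0 = 1"
  shows "height v * (\<integral>y. indicator (F v) y * (norm (f y))\<^sup>2 \<partial>facet_measure v)
     \<le> (\<Sum>i\<le>k. (a (Suc i))\<^sup>2) * (real (Suc k))\<^sup>2 * 2 ^ CARD('n) * (\<integral>x. indicator \<tau> x * (norm (f x))\<^sup>2 \<partial>lborel)"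
proof -
  have [measurable]: "f \<in> borel_measurable borel" using f by (rule borel_measurable_continuous_onI)
  let ?A = "\<Sum>i\<le>k. (a (Suc i))\<^sup>2"
  let ?I = "\<integral>y. indicator (F v) y * (norm (f y))\<^sup>2 \<partial>facet_measure v"
  let ?J = "\<integral>x. indicator \<tau> x * (norm (f x))\<^sup>2 \<partial>lborel"
  have cf: "continuous_on A (\<lambda>y. (norm (f y))\<^sup>2)" for A
    using f by (intro continuous_intros) (rule continuous_on_subset, auto)
  have H: "height v > 0" using v by (rule height_pos)
  have A: "?A \<ge> 0" by (intro sum_nonneg) auto
  have "(\<integral>\<^sup>+y. ennreal ((norm (f y))\<^sup>2) \<partial>facet_measure v) = (\<integral>\<^sup>+y. ennreal (indicator (F v) y * (norm (f y))\<^sup>2) \<partial>facet_measure v)"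
  proof (rule nn_integral_cong_AE)
    show "AE y in facet_measure v. ennreal ((norm (f y))\<^sup>2) = ennreal (indicator (F v) y * (norm (f y))\<^sup>2)"
      using AE_facet_measure[of v] by eventually_elim simp
  qed
  also have "\<dots> = ennreal ?I"
    using integrable_facet_measure[OF v cf] by (intro nn_integral_eq_integral) auto
  finally have I: "(\<integral>\<^sup>+y. ennreal ((norm (f y))\<^sup>2) \<partial>facet_measure v) = ennreal ?I" .
  have "(\<integral>\<^sup>+x. ennreal ((norm (f x))\<^sup>2) * indicator \<tau> x \<partial>lborel) = (\<integral>\<^sup>+x. ennreal (indicator \<tau> x * (norm (f x))\<^sup>2) \<partial>lborel)"
    by (rule nn_integral_cong) (auto simp: indicator_def)
  also have "\<dots> = ennreal ?J"
    using integrable_simplex[OF cf] by (intro nn_integral_eq_integral) auto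
  finally have J: "(\<integral>\<^sup>+x. ennreal ((norm (f x))\<^sup>2) * indicator \<tau> x \<partial>lborel) = ennreal ?J" .
  have J0: "?J \<ge> 0" by (intro integral_nonneg_AE) auto
  have I0: "?I \<ge> 0" by (intro integral_nonneg_AE) auto
  have e1: "ennreal (height v / (2 * real (Suc k)) * ?I) = ennreal (height v / (2 * real (Suc k))) * ennreal ?I"
    using H I0 by (intro ennreal_mult) auto
  have e2: "ennreal (?A * real (Suc k) * 2 ^ (CARD('n) - 1) * ?J) = ennreal (?A * real (Suc k) * 2 ^ (CARD('n) - 1)) * ennreal ?J"
    using A J0 by (intro ennreal_mult mult_nonneg_nonneg) auto
  have "ennreal (height v / (2 * real (Suc k)) * ?I) \<le> ennreal (?A * real (Suc k) * 2 ^ (CARD('n) - 1) * ?J)"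
    using nn_inverse_trace[OF v f ann] unfolding I J e1 e2 .
  then have "height v / (2 * real (Suc k)) * ?I \<le> ?A * real (Suc k) * 2 ^ (CARD('n) - 1) * ?J"
    using A J0 by (subst (asm) ennreal_le_iff) (auto intro!: mult_nonneg_nonneg)
  \<comment> \<open>Multiplying by 1 / \<eta> = 2 (k + 1) makes the constant quadratic in k + 1 and
    completes the power 2^d.\<close>
  then have "2 * real (Suc k) * (height v / (2 * real (Suc k)) * ?I)
    \<le> 2 * real (Suc k) * (?A * real (Suc k) * 2 ^ (CARD('n) - 1) * ?J)"
    by (intro mult_left_mono) auto
  also have "2 * real (Suc k) * (height v / (2 * real (Suc k)) * ?I) = height v * ?I" by simp
  also have "2 * real (Suc k) * (?A * real (Suc k) * 2 ^ (CARD('n) - 1) * ?J)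
     = ?A * (real (Suc k))\<^sup>2 * (2 * 2 ^ (CARD('n) - 1)) * ?J"
    by (simp add: power2_eq_square mult_ac del: of_nat_Suc)
  also have "2 * 2 ^ (CARD('n) - 1) = (2::real) ^ CARD('n)"
    using dim2 by (cases "CARD('n)") auto
  finally show ?thesis .
qed

section \<open>Heights, inscribed balls and diameters\<close>

text \<open>The two extreme points of an inscribed ball of radius r along \<open>nrm v\<close>
  differ by 2 r / \<open>height v\<close> in \<open>bary v\<close>, while both values lie in [0, 1].
  Through this, shape regularity bounds the diameter by a multiple of every height.\<close>

lemma inball_le_height:
  assumes v: "v \<in> S" shows "inball_diameter \<tau> \<le> height v"
  unfolding inball_diameter_def
proof (rule cSup_least)
  obtain x where "x \<in> \<tau>" using v by (meson hull_inc)
  then have "2 * 0 \<in> {2 * r | r c. 0 \<le> r \<and> cball c r \<subseteq> \<tau>}"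
    by (intro CollectI exI[of _ 0] exI[of _ x]) auto
  then show "{2 * r | r c. 0 \<le> r \<and> cball c r \<subseteq> \<tau>} \<noteq> {}" by blast
  fix d assume "d \<in> {2 * r | r c. 0 \<le> r \<and> cball c r \<subseteq> \<tau>}"
  then obtain r c where d: "d = 2 * r" and r: "0 \<le> r" "cball c r \<subseteq> \<tau>" by blast
  have "c + r *\<^sub>R nrm v \<in> cball c r" "c - r *\<^sub>R nrm v \<in> cball c r"
    using r norm_nrm[OF v] by (auto simp: dist_norm)
  then have p: "c + r *\<^sub>R nrm v \<in> \<tau>" "c - r *\<^sub>R nrm v \<in> \<tau>" using r by auto
  have "nrm v \<bullet> nrm v = 1" using norm_nrm[OF v] by (simp add: norm_eq_1)
  then have "bary v (c + r *\<^sub>R nrm v) - bary v (c - r *\<^sub>R nrm v) = - (2 * r) / height v"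
  proof -
    have "c + r *\<^sub>R nrm v - (c - r *\<^sub>R nrm v) = (2 * r) *\<^sub>R nrm v"
      unfolding mult_2 scaleR_left_distrib by simp
    then show ?thesis unfolding bary_diff by (simp add: \<open>nrm v \<bullet> nrm v = 1\<close>)
  qed
  moreover have "0 \<le> bary v (c + r *\<^sub>R nrm v)" using p v by (simp add: mem_simplex_iff)
  moreover have "bary v (c - r *\<^sub>R nrm v) \<le> 1" using p v by (simp add: bary_le_1)
  ultimately have "2 * r / height v \<le> 1" by simp
  then show "d \<le> height v" using height_pos[OF v] by (simp add: d)
qed

lemma diameter_F_le: "diameter (F v) \<le> diameter \<tau>"
  by (intro diameter_subset F_subset compact_imp_bounded compact_simplex)

lemma diameter_F_pos:
  assumes v: "v \<in> S" shows "diameter (F v) > 0"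
proof -
  have "card (S - {v}) = CARD('n)" using v cardS by simp
  then have "S - {v} \<noteq> {}" using dim2 by force
  then obtain x where x: "x \<in> S - {v}" by blast
  have "card (S - {v} - {x}) = CARD('n) - 1" using x \<open>card (S - {v}) = CARD('n)\<close> by simp
  then have "S - {v} - {x} \<noteq> {}" using dim2 by force
  then obtain y where y: "y \<in> S - {v}" "y \<noteq> x" by blast
  have "dist x y \<le> diameter (F v)"
    using x y by (intro diameter_bounded_bound compact_imp_bounded compact_F hull_inc) auto
  moreover have "0 < dist x y" using y(2) by simp
  ultimately show ?thesis by linarith
qed

end

section \<open>Lipschitz continuity from bounded weak derivatives\<close>

text \<open>Over N equal subintervals the quadratic errors add up to M / N, which vanishes as N
  grows. This takes the place of a mean value argument when only increments of \<open>F\<close> are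
  controlled.\<close>

lemma quadratic_increment_bound:
  fixes F :: "real \<Rightarrow> real"
  assumes F: "\<And>s t. 0 \<le> s \<Longrightarrow> s \<le> t \<Longrightarrow> t \<le> 1 \<Longrightarrow> \<bar>F t - F s\<bar> \<le> L * (t - s) + M * (t - s)\<^sup>2"
  shows "\<bar>F 1 - F 0\<bar> \<le> L"
proof -
  have bound: "\<bar>F 1 - F 0\<bar> \<le> L + M / real N" if N: "N > 0" for N :: nat
  proof -
    have "F 1 - F 0 = (\<Sum>i<N. F (real (Suc i) / real N) - F (real i / real N))"
      using N by (subst sum_lessThan_telescope) auto
    then have "\<bar>F 1 - F 0\<bar> \<le> (\<Sum>i<N. \<bar>F (real (Suc i) / real N) - F (real i / real N)\<bar>)"
      by (metis sum_abs)
    also have "\<dots> \<le> (\<Sum>i<N. L / real N + M / (real N)\<^sup>2)"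
    proof (rule sum_mono)
      fix i assume i: "i \<in> {..<N}"
      have d: "real (Suc i) / real N - real i / real N = 1 / real N"
        by (simp add: diff_divide_distrib[symmetric])
      have "\<bar>F (real (Suc i) / real N) - F (real i / real N)\<bar>
          \<le> L * (real (Suc i) / real N - real i / real N) + M * (real (Suc i) / real N - real i / real N)\<^sup>2"
        using N i by (intro F divide_right_mono) (auto simp: divide_le_eq)
      then show "\<bar>F (real (Suc i) / real N) - F (real i / real N)\<bar> \<le> L / real N + M / (real N)\<^sup>2"
        unfolding d by (simp add: power_divide)
    qed
    also have "\<dots> = L + M / real N"
      using N by (simp add: power2_eq_square field_simps)
    finally show ?thesis .
  qed
  have "(\<lambda>N. L + M / real N) \<longlonglongrightarrow> L + 0"
    by (intro tendsto_intros lim_const_over_n)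
  moreover have "eventually (\<lambda>N. \<bar>F 1 - F 0\<bar> \<le> L + M / real N) sequentially"
    using eventually_gt_at_top[of 0] by eventually_elim (rule bound)
  ultimately have "\<bar>F 1 - F 0\<bar> \<le> L + 0"
    by (rule tendsto_lowerbound) simp
  then show ?thesis by simp
qed

section \<open>A compactly supported bump function\<close>

text \<open>Squaring the positive part makes the bump continuously differentiable, which is the
  regularity demanded by \<open>test_function\<close>, and its simple form gives explicit Taylor
  remainders.\<close>

definition bump :: "real \<Rightarrow> 'a::real_inner \<Rightarrow> real" where
  "bump \<delta> w = (max 0 (\<delta>\<^sup>2 - w \<bullet> w))\<^sup>2"

text \<open>A first-order Taylor expansion with quadratic remainder, valid although the squared
  positive part has no second derivative at 0. It yields the derivative and also the increments of
  the bump.\<close>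

lemma max0_square_expand:
  fixes t t' :: real
  shows "\<bar>(max 0 t')\<^sup>2 - (max 0 t)\<^sup>2 - 2 * max 0 t * (t' - t)\<bar> \<le> (t' - t)\<^sup>2"
proof -
  consider "t \<ge> 0" "t' \<ge> 0" | "t \<ge> 0" "t' < 0" | "t < 0" "t' \<ge> 0" | "t < 0" "t' < 0" by linarith
  then show ?thesis
  proof cases
    case 1
    then have "(max 0 t')\<^sup>2 - (max 0 t)\<^sup>2 - 2 * max 0 t * (t' - t) = (t' - t)\<^sup>2"
      by (simp add: max_def power2_eq_square algebra_simps)
    then show ?thesis by simp
  next
    case 2
    then have eq: "(max 0 t')\<^sup>2 - (max 0 t)\<^sup>2 - 2 * max 0 t * (t' - t) = (t' - t)\<^sup>2 - t'\<^sup>2"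
      by (simp add: max_def power2_eq_square algebra_simps)
    have "t'\<^sup>2 \<le> (t' - t)\<^sup>2" using 2 by (simp add: abs_le_square_iff[symmetric])
    then show ?thesis unfolding eq using zero_le_power2[of t'] by linarith
  next
    case 3
    then have eq: "(max 0 t')\<^sup>2 - (max 0 t)\<^sup>2 - 2 * max 0 t * (t' - t) = t'\<^sup>2"
      by (simp add: max_def)
    have "t'\<^sup>2 \<le> (t' - t)\<^sup>2" using 3 by (simp add: abs_le_square_iff[symmetric])
    then show ?thesis unfolding eq by simp
  next
    case 4
    then show ?thesis by (simp add: max_def)
  qed
qed

lemma has_derivative_max0_square:
  "((\<lambda>t::real. (max 0 t)\<^sup>2) has_derivative (\<lambda>h. 2 * max 0 t * h)) (at t)"
proof -
  have "((\<lambda>t'. ((max 0 t')\<^sup>2 - (max 0 t)\<^sup>2 - 2 * max 0 t * (t' - t)) / (t' - t)) \<longlongrightarrow> 0) (at t)"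
  proof (rule Lim_null_comparison)
    show "\<forall>\<^sub>F t' in at t. norm (((max 0 t')\<^sup>2 - (max 0 t)\<^sup>2 - 2 * max 0 t * (t' - t)) / (t' - t)) \<le> \<bar>t' - t\<bar>"
    proof (rule eventuallyI)
      fix t'
      have "\<bar>(max 0 t')\<^sup>2 - (max 0 t)\<^sup>2 - 2 * max 0 t * (t' - t)\<bar> \<le> \<bar>t' - t\<bar> * \<bar>t' - t\<bar>"
        using max0_square_expand[of t' t] by (simp add: power2_eq_square)
      then show "norm (((max 0 t')\<^sup>2 - (max 0 t)\<^sup>2 - 2 * max 0 t * (t' - t)) / (t' - t)) \<le> \<bar>t' - t\<bar>"
        by (simp add: divide_le_eq)
    qed
    show "((\<lambda>t'. \<bar>t' - t\<bar>) \<longlongrightarrow> 0) (at t)"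
      using tendsto_rabs[OF LIM_zero[OF tendsto_ident_at[of t UNIV]]] by simp
  qed
  moreover have "eventually (\<lambda>t'. ((max 0 t')\<^sup>2 - (max 0 t)\<^sup>2 - 2 * max 0 t * (t' - t)) / (t' - t)
      = ((max 0 t')\<^sup>2 - (max 0 t)\<^sup>2) / (t' - t) - 2 * max 0 t) (at t)"
    by (auto simp: eventually_at_filter diff_divide_distrib)
  ultimately have "((\<lambda>t'. ((max 0 t')\<^sup>2 - (max 0 t)\<^sup>2) / (t' - t) - 2 * max 0 t) \<longlongrightarrow> 0) (at t)"
    using tendsto_cong by fast
  then have "((\<lambda>t'. ((max 0 t')\<^sup>2 - (max 0 t)\<^sup>2) / (t' - t)) \<longlongrightarrow> 2 * max 0 t) (at t)"
    by (simp add: LIM_zero_iff)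
  then have "((\<lambda>t. (max 0 t)\<^sup>2) has_field_derivative 2 * max 0 t) (at t)"
    by (simp add: has_field_derivative_iff)
  then show ?thesis by (simp add: has_field_derivative_def)
qed

lemma bump_translate_deriv:
  "((\<lambda>z. bump \<delta> (z - c)) has_derivative (\<lambda>v. - 4 * max 0 (\<delta>\<^sup>2 - (z - c) \<bullet> (z - c)) * ((z - c) \<bullet> v))) (at z)"
proof -
  have "((\<lambda>z. \<delta>\<^sup>2 - (z - c) \<bullet> (z - c)) has_derivative (\<lambda>v. - 2 * ((z - c) \<bullet> v))) (at z)"
    by (auto intro!: derivative_eq_intros simp: inner_commute)
  from has_derivative_compose[OF this has_derivative_max0_square]
  show ?thesis by (simp add: bump_def[abs_def] mult_ac)
qed

lemma continuous_on_bump[continuous_intros]: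
  assumes "continuous_on A f" shows "continuous_on A (\<lambda>x. bump \<delta> (f x))"
  unfolding bump_def using assms by (intro continuous_intros)

lemma bump_nonneg: "0 \<le> bump \<delta> w" by (simp add: bump_def)

lemma bump_eq_0: "0 \<le> \<delta> \<Longrightarrow> \<delta> \<le> norm w \<Longrightarrow> bump \<delta> w = 0"
  by (simp add: bump_def max_def dot_square_norm power_mono)

lemma bump_pos: "norm w < \<delta> \<Longrightarrow> 0 < bump \<delta> w"
  using power_strict_mono[of "norm w" \<delta> 2] by (simp add: bump_def dot_square_norm)

lemma test_function_C1:
  assumes "C1_fun \<phi>" "compact K" "K \<subseteq> \<Omega>" "\<And>x. x \<notin> K \<Longrightarrow> \<phi> x = 0"
  shows "test_function \<Omega> \<phi>"
proof -
  have "closure {x. \<phi> x \<noteq> 0} \<subseteq> K"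
    using assms by (intro closure_minimal compact_imp_closed) auto
  moreover from this have "compact (closure {x. \<phi> x \<noteq> 0})"
    using assms(2) by (meson bounded_subset closed_closure compact_eq_bounded_closed)
  ultimately show ?thesis
    using assms(1,3) unfolding test_function_def C1_fun_def partial_deriv_def by auto
qed

lemma C1_fun_bump: "C1_fun (\<lambda>z. bump \<delta> (z - c))"
  by (rule C1_funI, rule bump_translate_deriv) (intro continuous_intros)

lemma set_integrable_mult_supported:
  fixes f \<phi> :: "real^'n \<Rightarrow> real"
  assumes f: "f absolutely_integrable_on K" and \<phi>: "continuous_on UNIV \<phi>"
    and K: "compact K" "K \<subseteq> \<Omega>" and z: "\<And>x. x \<notin> K \<Longrightarrow> \<phi> x = 0"
  shows "set_integrable lebesgue \<Omega> (\<lambda>x. f x * \<phi> x)"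
    and "(LINT x:\<Omega>|lebesgue. f x * \<phi> x) = (LINT x:K|lebesgue. f x * \<phi> x)"
proof -
  have eq: "indicator \<Omega> x *\<^sub>R (f x * \<phi> x) = indicator K x *\<^sub>R (f x * \<phi> x)" for x
    using K(2) z[of x] by (auto simp: indicator_def)
  then show "(LINT x:\<Omega>|lebesgue. f x * \<phi> x) = (LINT x:K|lebesgue. f x * \<phi> x)"
    unfolding set_lebesgue_integral_def by (simp only:)
  have "bounded (\<phi> ` K)" using \<phi> K by (meson compact_continuous_image compact_imp_bounded continuous_on_subset top_greatest)
  then obtain B where B: "\<And>x. x \<in> K \<Longrightarrow> \<bar>\<phi> x\<bar> \<le> B" unfolding bounded_iff by auto
  have fK: "integrable lebesgue (\<lambda>x. indicator K x *\<^sub>R f x)" using f by (simp add: set_integrable_def)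
  have [measurable]: "\<phi> \<in> borel_measurable lebesgue"
    using borel_measurable_continuous_onI[OF \<phi>] by (simp add: measurable_completion)
  show "set_integrable lebesgue \<Omega> (\<lambda>x. f x * \<phi> x)"
    unfolding set_integrable_def eq
  proof (rule Bochner_Integration.integrable_bound)
    show "integrable lebesgue (\<lambda>x. B * (indicator K x *\<^sub>R f x))" using fK by simp
    have "(\<lambda>x. indicator K x *\<^sub>R (f x * \<phi> x)) = (\<lambda>x. (indicator K x *\<^sub>R f x) * \<phi> x)" by auto
    then show "(\<lambda>x. indicator K x *\<^sub>R (f x * \<phi> x)) \<in> borel_measurable lebesgue"
      using borel_measurable_integrable[OF fK] by simp
    show "AE x in lebesgue. norm (indicator K x *\<^sub>R (f x * \<phi> x)) \<le> norm (B * (indicator K x *\<^sub>R f x))"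
    proof (rule AE_I2)
      fix x
      show "norm (indicator K x *\<^sub>R (f x * \<phi> x)) \<le> norm (B * (indicator K x *\<^sub>R f x))"
      proof (cases "x \<in> K")
        case True
        then have "\<bar>f x\<bar> * \<bar>\<phi> x\<bar> \<le> \<bar>f x\<bar> * \<bar>B\<bar>" using B[of x] by (intro mult_left_mono) auto
        then show ?thesis using True by (simp add: abs_mult mult.commute)
      qed simp
    qed
  qed
qed


text \<open>With a remainder of order t^2 that is locally uniform in \<open>w\<close>, the
  increments of an integral against moving bumps can be estimated without differentiating under the
  integral sign.\<close>

lemma bump_increment:
  fixes w u :: "'a::real_inner"
  shows "\<bar>bump \<delta> (w - t *\<^sub>R u) - bump \<delta> w - t * (4 * max 0 (\<delta>\<^sup>2 - w \<bullet> w) * (w \<bullet> u))\<bar>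
     \<le> t\<^sup>2 * (2 * \<delta>\<^sup>2 * (u \<bullet> u) + (2 * (norm w * norm u) + \<bar>t\<bar> * (u \<bullet> u))\<^sup>2)"
proof -
  let ?q = "\<delta>\<^sup>2 - w \<bullet> w" and ?q' = "\<delta>\<^sup>2 - (w - t *\<^sub>R u) \<bullet> (w - t *\<^sub>R u)"
  have qq: "?q' - ?q = t * (2 * (w \<bullet> u) - t * (u \<bullet> u))"
    by (simp add: inner_diff_left inner_diff_right inner_commute algebra_simps)
  have 1: "\<bar>bump \<delta> (w - t *\<^sub>R u) - bump \<delta> w - 2 * max 0 ?q * (t * (2 * (w \<bullet> u) - t * (u \<bullet> u)))\<bar>
      \<le> (t * (2 * (w \<bullet> u) - t * (u \<bullet> u)))\<^sup>2"
    using max0_square_expand[of ?q' ?q] unfolding qq bump_def .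
  have "\<bar>2 * (w \<bullet> u) - t * (u \<bullet> u)\<bar> \<le> 2 * (norm w * norm u) + \<bar>t\<bar> * (u \<bullet> u)"
  proof -
    have "\<bar>2 * (w \<bullet> u) - t * (u \<bullet> u)\<bar> \<le> \<bar>2 * (w \<bullet> u)\<bar> + \<bar>t * (u \<bullet> u)\<bar>" by (rule abs_triangle_ineq4)
    also have "\<dots> \<le> 2 * (norm w * norm u) + \<bar>t\<bar> * (u \<bullet> u)"
      using Cauchy_Schwarz_ineq2[of w u] by (simp add: abs_mult)
    finally show ?thesis .
  qed
  then have "\<bar>2 * (w \<bullet> u) - t * (u \<bullet> u)\<bar>\<^sup>2 \<le> (2 * (norm w * norm u) + \<bar>t\<bar> * (u \<bullet> u))\<^sup>2"
    by (rule power_mono) simp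
  then have 2: "(t * (2 * (w \<bullet> u) - t * (u \<bullet> u)))\<^sup>2 \<le> t\<^sup>2 * (2 * (norm w * norm u) + \<bar>t\<bar> * (u \<bullet> u))\<^sup>2"
    unfolding power_mult_distrib by (intro mult_left_mono) auto
  have 3: "\<bar>2 * max 0 ?q * (t * (t * (u \<bullet> u)))\<bar> \<le> t\<^sup>2 * (2 * \<delta>\<^sup>2 * (u \<bullet> u))"
  proof -
    have E: "2 * max 0 ?q * (t * (t * (u \<bullet> u))) = t\<^sup>2 * (2 * max 0 ?q * (u \<bullet> u))"
      by (simp add: power2_eq_square)
    have "max 0 ?q \<le> \<delta>\<^sup>2" by simp
    then have U: "t\<^sup>2 * (2 * max 0 ?q * (u \<bullet> u)) \<le> t\<^sup>2 * (2 * \<delta>\<^sup>2 * (u \<bullet> u))"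
      by (intro mult_left_mono mult_right_mono) auto
    have "0 \<le> t\<^sup>2 * (2 * max 0 ?q * (u \<bullet> u))" by simp
    with U show ?thesis unfolding E by (simp only: abs_of_nonneg)
  qed
  have "bump \<delta> (w - t *\<^sub>R u) - bump \<delta> w - t * (4 * max 0 ?q * (w \<bullet> u))
    = (bump \<delta> (w - t *\<^sub>R u) - bump \<delta> w - 2 * max 0 ?q * (t * (2 * (w \<bullet> u) - t * (u \<bullet> u))))
      - 2 * max 0 ?q * (t * (t * (u \<bullet> u)))"
    by (simp add: algebra_simps)
  then have "\<bar>bump \<delta> (w - t *\<^sub>R u) - bump \<delta> w - t * (4 * max 0 ?q * (w \<bullet> u))\<bar>
    \<le> \<bar>bump \<delta> (w - t *\<^sub>R u) - bump \<delta> w - 2 * max 0 ?q * (t * (2 * (w \<bullet> u) - t * (u \<bullet> u)))\<bar>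
      + \<bar>2 * max 0 ?q * (t * (t * (u \<bullet> u)))\<bar>"
    by (metis abs_triangle_ineq4)
  then show ?thesis using 1 2 3 unfolding distrib_left by linarith
qed

lemma integrable_bump: "integrable lborel (\<lambda>z :: real^'n. bump \<delta> (z - c))" if "\<delta> \<ge> 0"
proof -
  have "integrable lborel (\<lambda>z. indicator (cball c \<delta>) z *\<^sub>R bump \<delta> (z - c))"
    using borel_integrable_compact[OF compact_cball, of c \<delta> "\<lambda>z. bump \<delta> (z - c)"]
    by (simp add: indicator_scaleR_eq_if continuous_intros)
  moreover have "(\<lambda>z. indicator (cball c \<delta>) z *\<^sub>R bump \<delta> (z - c)) = (\<lambda>z. bump \<delta> (z - c))"
  proof
    fix z
    show "indicator (cball c \<delta>) z *\<^sub>R bump \<delta> (z - c) = bump \<delta> (z - c)"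
    proof (cases "z \<in> cball c \<delta>")
      case False
      then have "bump \<delta> (z - c) = 0"
        by (intro bump_eq_0 that) (simp add: dist_norm norm_minus_commute)
      then show ?thesis by simp
    qed simp
  qed
  ultimately show ?thesis by simp
qed

lemma integral_lborel_translate:
  fixes f :: "'a::euclidean_space \<Rightarrow> 'b::{banach, second_countable_topology}"
  assumes "f \<in> borel_measurable borel"
  shows "(\<integral>x. f (c + x) \<partial>lborel) = (\<integral>x. f x \<partial>lborel)"
  by (subst (2) lborel_distr_plus[of c, symmetric]) (simp add: integral_distr assms)

lemma integral_bump_pos:
  assumes \<delta>: "\<delta> > 0" shows "0 < (\<integral>z. bump \<delta> (z :: real^'n) \<partial>lborel)"
proof -
  have int: "integrable lborel (\<lambda>z :: real^'n. bump \<delta> z)"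
    using integrable_bump[of \<delta> 0] \<delta> by simp
  have "(\<integral>z. bump \<delta> (z :: real^'n) \<partial>lborel) \<noteq> 0"
  proof
    assume "(\<integral>z. bump \<delta> (z :: real^'n) \<partial>lborel) = 0"
    then have "AE z :: real^'n in lborel. bump \<delta> z = 0"
      using int by (subst (asm) integral_nonneg_eq_0_iff_AE) (auto simp: bump_nonneg)
    then have "AE z :: real^'n in lborel. z \<notin> ball 0 \<delta>"
      by eventually_elim (use bump_pos in force)
    then have "ball (0 :: real^'n) \<delta> \<in> null_sets lborel"
      using AE_iff_null_sets[of "ball (0 :: real^'n) \<delta>" lborel] by simp
    then have "emeasure lborel (ball (0 :: real^'n) \<delta>) = 0" by (rule null_setsD1)
    then show False using content_ball_pos[OF \<delta>, of "0 :: real^'n"] by (simp add: measure_def)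
  qed
  moreover have "0 \<le> (\<integral>z. bump \<delta> (z :: real^'n) \<partial>lborel)" by (intro integral_nonneg_AE) (simp add: bump_nonneg)
  ultimately show ?thesis by linarith
qed

text \<open>With \<open>F s = \<integral> f(z) \<rho>(z - s h) dz\<close> for a bump \<open>\<rho>\<close> near \<open>x\<close> and \<open>h = y - x\<close>, moving the derivative to the
  weak gradient gives \<open>\<bar>F'\<bar> \<le> C \<bar>h\<bar>\<^sub>1 \<integral> \<rho>\<close>, whereas \<open>F 1 - F 0\<close> is about \<open>(f y - f x) \<integral> \<rho>\<close>.\<close>

lemma weak_gradient_bound:
  fixes f :: "real^'n \<Rightarrow> real"
  assumes \<Omega>: "open \<Omega>" and f: "continuous_on \<Omega> f"
    and wp: "\<And>j. has_weak_partial \<Omega> j f (g j)"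
    and g: "\<And>j. AE z in lebesgue_on \<Omega>. \<bar>g j z\<bar> \<le> C"
    and seg: "closed_segment x y \<subseteq> \<Omega>"
  shows "f y - f x \<le> C * (\<Sum>j\<in>UNIV. \<bar>(y - x) $ j\<bar>)"
proof (rule ccontr)
  define h where "h = y - x"
  define L where "L = C * (\<Sum>j\<in>UNIV. \<bar>h $ j\<bar>)"
  assume "\<not> f y - f x \<le> C * (\<Sum>j\<in>UNIV. \<bar>(y - x) $ j\<bar>)"
  then have less: "L < f y - f x" by (simp add: L_def h_def)
  \<comment> \<open>One third of the excess is lost near \<open>x\<close>, one third near
    \<open>y\<close>, and one third remains for the contradiction.\<close>
  define \<kappa> where "\<kappa> = (f y - f x - L) / 3"
  have \<kappa>: "\<kappa> > 0" using less by (simp add: \<kappa>_def)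
  have xy: "x \<in> \<Omega>" "y \<in> \<Omega>" using seg by auto
  obtain e0 where e0: "e0 > 0" "(\<Union>p\<in>closed_segment x y. cball p e0) \<subseteq> \<Omega>"
    using compact_subset_open_imp_cball_epsilon_subset[OF compact_segment \<Omega> seg] by blast
  obtain e1 where e1: "e1 > 0" "\<And>z. z \<in> \<Omega> \<Longrightarrow> dist z x < e1 \<Longrightarrow> \<bar>f z - f x\<bar> < \<kappa>"
    using f xy(1) \<kappa> unfolding continuous_on_iff by (force simp: dist_real_def)
  obtain e2 where e2: "e2 > 0" "\<And>z. z \<in> \<Omega> \<Longrightarrow> dist z y < e2 \<Longrightarrow> \<bar>f z - f y\<bar> < \<kappa>"
    using f xy(2) \<kappa> unfolding continuous_on_iff by (force simp: dist_real_def)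
  \<comment> \<open>Halving makes the radius strictly smaller than \<open>e1\<close> and
    \<open>e2\<close>; \<open>e0\<close> keeps the tube around the segment inside \<Omega>.\<close>
  define \<delta> where "\<delta> = min e0 (min (e1/2) (e2/2))"
  have \<delta>: "\<delta> > 0" "\<delta> \<le> e0" "\<delta> < e1" "\<delta> < e2" using e0 e1 e2 by (auto simp: \<delta>_def)
  define c where "c s = x + s *\<^sub>R h" for s
  define K where "K = {p + q | p q. p \<in> closed_segment x y \<and> q \<in> cball 0 \<delta>}"
  have K: "compact K" unfolding K_def by (intro compact_sums compact_segment compact_cball)
  have K\<Omega>: "K \<subseteq> \<Omega>"
  proof
    fix z assume "z \<in> K"
    then obtain p q where pq: "z = p + q" "p \<in> closed_segment x y" "norm q \<le> \<delta>" by (auto simp: K_def)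
    then have "z \<in> cball p e0" using \<delta> by (simp add: dist_norm)
    then show "z \<in> \<Omega>" using e0(2) pq(2) by blast
  qed
  have cK: "z \<in> K" if s: "0 \<le> s" "s \<le> 1" and z: "norm (z - c s) \<le> \<delta>" for s z
  proof -
    have "c s \<in> closed_segment x y"
      using s by (auto simp: closed_segment_def c_def h_def algebra_simps intro!: exI[of _ s])
    then show ?thesis unfolding K_def using z by (intro CollectI exI[of _ "c s"] exI[of _ "z - c s"]) auto
  qed
  \<comment> \<open>Cut off to the tube \<open>K\<close>, which contains the supports of all the
    bumps, \<open>f\<close> becomes Borel measurable and integrable on the whole space.\<close>
  define fK where "fK z = indicator K z * f z" for z
  have fcK: "continuous_on K f" using f K\<Omega> by (rule continuous_on_subset)
  have Kb: "K \<in> sets borel" using compact_imp_closed[OF K] by auto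
  have fKm[measurable]: "fK \<in> borel_measurable borel"
    using borel_measurable_continuous_on_indicator[OF Kb fcK] by (simp add: fK_def[abs_def])
  have fKi: "integrable lborel fK"
    using borel_integrable_compact[OF K fcK]
    by (simp add: fK_def[abs_def] indicator_scaleR_eq_if[symmetric, where 'a=real, simplified] if_distrib indicator_def cong: if_cong)
  have bK: "bounded K" using K by (rule compact_imp_bounded)
  obtain R where R: "\<And>z. z \<in> K \<Longrightarrow> norm z \<le> R" using bK unfolding bounded_iff by blast
  define P where "P = (\<integral>z. bump \<delta> (z :: real^'n) \<partial>lborel)"
  have P: "P > 0" unfolding P_def using \<delta>(1) by (rule integral_bump_pos)
  define \<rho> where "\<rho> s z = bump \<delta> (z - c s)" for s z
  \<comment> \<open>The derivative of \<open>\<rho> s z\<close> in s, equal to minus the derivative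
    of \<open>\<rho> s\<close> in the direction \<open>h\<close>.\<close>
  define D where "D s z = 4 * max 0 (\<delta>\<^sup>2 - (z - c s) \<bullet> (z - c s)) * ((z - c s) \<bullet> h)" for s z
  define F where "F s = (\<integral>z. fK z * \<rho> s z \<partial>lborel)" for s
  have out: "\<delta> < norm (z - c s)" if "0 \<le> s" "s \<le> 1" "z \<notin> K" for s z
    using cK[OF that(1,2), of z] that(3) by (meson not_le_imp_less)
  have \<rho>0: "\<rho> s z = 0" if "0 \<le> s" "s \<le> 1" "z \<notin> K" for s z
    unfolding \<rho>_def using out[OF that] \<delta>(1) by (intro bump_eq_0) auto
  have contD: "continuous_on UNIV (\<lambda>z. max 0 (\<delta>\<^sup>2 - (z - c s) \<bullet> (z - c s)) * ((z - c s) \<bullet> v))" for s v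
    by (intro continuous_intros)
  have D0: "max 0 (\<delta>\<^sup>2 - (z - c s) \<bullet> (z - c s)) = 0" if "0 \<le> s" "s \<le> 1" "z \<notin> K" for s z
  proof -
    have "\<delta> \<le> norm (z - c s)" using out[OF that] by simp
    then have "\<delta>\<^sup>2 \<le> (norm (z - c s))\<^sup>2" using \<delta> by (intro power_mono) auto
    then show ?thesis by (simp add: dot_square_norm)
  qed
  have intf: "integrable lborel (\<lambda>z. fK z * \<phi> z)" if "continuous_on UNIV \<phi>" for \<phi>
  proof -
    have "continuous_on K (\<lambda>z. f z * \<phi> z)"
      using fcK that by (intro continuous_intros) (auto intro: continuous_on_subset)
    from borel_integrable_compact[OF K this] show ?thesis
      by (simp add: fK_def indicator_def mult.assoc if_distrib cong: if_cong)
  qed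
  have leb: "(LINT z:\<Omega>|lebesgue. f z * \<phi> z) = (\<integral>z. fK z * \<phi> z \<partial>lborel)"
    if \<phi>: "continuous_on UNIV \<phi>" and z: "\<And>z. z \<notin> K \<Longrightarrow> \<phi> z = 0" for \<phi>
  proof -
    have "(LINT z:\<Omega>|lebesgue. f z * \<phi> z) = (\<integral>z. fK z * \<phi> z \<partial>lebesgue)"
      unfolding set_lebesgue_integral_def
    proof (rule Bochner_Integration.integral_cong[OF refl])
      fix w
      show "indicator \<Omega> w *\<^sub>R (f w * \<phi> w) = fK w * \<phi> w"
      proof (cases "w \<in> K")
        case True
        then have "w \<in> \<Omega>" using K\<Omega> by (rule subsetD[rotated])
        then show ?thesis using True by (simp add: fK_def)
      next
        case False
        then show ?thesis using z[OF False] by (simp add: fK_def)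
      qed
    qed
    also have "\<dots> = (\<integral>z. fK z * \<phi> z \<partial>lborel)"
      using borel_measurable_continuous_onI[OF \<phi>] by (intro integral_completion) simp
    finally show ?thesis .
  qed
  \<comment> \<open>Expanding the directional derivative in coordinates moves each partial
    derivative onto \<open>g j\<close>, which \<open>C\<close> bounds; \<open>C\<close> times the
    sum of the \<open>\<bar>h $ j\<bar>\<close> is \<open>L\<close>.\<close>
  have weak: "\<bar>\<integral>z. fK z * D s z \<partial>lborel\<bar> \<le> L * P" if s: "0 \<le> s" "s \<le> 1" for s
  proof -
    let ?d = "\<lambda>j z. partial_deriv j (\<rho> s) z"
    have pd: "?d j z = - 4 * max 0 (\<delta>\<^sup>2 - (z - c s) \<bullet> (z - c s)) * ((z - c s) $ j)" for j z
      unfolding partial_deriv_def \<rho>_def frechet_derivative_at[OF bump_translate_deriv, symmetric]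
      by (simp add: inner_axis)
    have tf: "test_function \<Omega> (\<rho> s)"
    proof (rule test_function_C1[OF _ K K\<Omega> \<rho>0[OF s]])
      show "C1_fun (\<rho> s)" unfolding \<rho>_def by (rule C1_fun_bump)
    qed
    have c\<rho>: "continuous_on UNIV (\<rho> s)" unfolding \<rho>_def by (intro continuous_intros)
    have each: "\<bar>\<integral>z. fK z * ?d j z \<partial>lborel\<bar> \<le> C * P" for j
    proof -
      have cd: "continuous_on UNIV (?d j)" unfolding pd by (intro continuous_intros)
      have gK: "(g j) absolutely_integrable_on K" using wp[of j] K K\<Omega> unfolding has_weak_partial_def by blast
      have gi: "set_integrable lebesgue \<Omega> (\<lambda>z. g j z * \<rho> s z)"
        by (rule set_integrable_mult_supported(1)[OF gK c\<rho> K K\<Omega> \<rho>0[OF s]])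
      have "(\<integral>z. fK z * ?d j z \<partial>lborel) = (LINT z:\<Omega>|lebesgue. f z * ?d j z)"
        by (rule leb[OF cd, symmetric]) (simp add: pd D0[OF s])
      also have "\<dots> = - (LINT z:\<Omega>|lebesgue. g j z * \<rho> s z)"
        using wp[of j] tf unfolding has_weak_partial_def by blast
      finally have "\<bar>\<integral>z. fK z * ?d j z \<partial>lborel\<bar> = \<bar>LINT z:\<Omega>|lebesgue. g j z * \<rho> s z\<bar>" by simp
      also have "\<dots> \<le> (\<integral>z. \<bar>indicator \<Omega> z *\<^sub>R (g j z * \<rho> s z)\<bar> \<partial>lebesgue)"
        unfolding set_lebesgue_integral_def by (rule integral_abs_bound)
      also have "\<dots> \<le> (\<integral>z. C * \<rho> s z \<partial>lebesgue)"
      proof (rule integral_mono_AE)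
        show "integrable lebesgue (\<lambda>z. \<bar>indicator \<Omega> z *\<^sub>R (g j z * \<rho> s z)\<bar>)"
          using gi by (simp add: set_integrable_def)
        show "integrable lebesgue (\<lambda>z. C * \<rho> s z)"
          using integrable_bump[of \<delta> "c s"] \<delta>(1) unfolding \<rho>_def by (intro integrable_mult_right integrable_completion[THEN iffD2]) auto
        have "AE z in lebesgue. z \<in> \<Omega> \<longrightarrow> \<bar>g j z\<bar> \<le> C"
          using g[of j] \<Omega> by (subst (asm) AE_restrict_space_iff) auto
        then show "AE z in lebesgue. \<bar>indicator \<Omega> z *\<^sub>R (g j z * \<rho> s z)\<bar> \<le> C * \<rho> s z"
        proof eventually_elim
          case (elim z)
          have r: "0 \<le> \<rho> s z" by (simp add: \<rho>_def bump_nonneg)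
          show ?case
          proof (cases "z \<in> \<Omega>")
            case True
            then show ?thesis using elim r by (simp add: abs_mult mult_right_mono)
          next
            case False
            then have "\<rho> s z = 0" using \<rho>0[OF s] K\<Omega> by blast
            then show ?thesis by simp
          qed
        qed
      qed
      also have "\<dots> = C * (\<integral>z. \<rho> s z \<partial>lborel)"
        using borel_measurable_continuous_onI[OF c\<rho>] by (subst integral_completion) auto
      also have "(\<integral>z. \<rho> s z \<partial>lborel) = P"
        unfolding \<rho>_def P_def using integral_lborel_translate[of "\<lambda>z. bump \<delta> z" "- c s"]
        by (simp add: borel_measurable_continuous_onI continuous_intros)
      finally show ?thesis .
    qed
    have "(\<integral>z. fK z * D s z \<partial>lborel) = - (\<integral>z. (\<Sum>j\<in>UNIV. h $ j * (fK z * ?d j z)) \<partial>lborel)"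
    proof -
      have "(\<Sum>j\<in>UNIV. h $ j * (fK z * ?d j z)) = - (fK z * D s z)" for z
      proof -
        have "(\<Sum>j\<in>UNIV. h $ j * (fK z * ?d j z))
           = (\<Sum>j\<in>UNIV. - (fK z * (4 * max 0 (\<delta>\<^sup>2 - (z - c s) \<bullet> (z - c s)))) * ((z - c s) $ j * h $ j))"
          unfolding pd by (intro sum.cong refl) simp
        also have "\<dots> = - (fK z * D s z)"
          unfolding sum_distrib_left[symmetric] D_def inner_vec_def[of "z - c s" h] by simp
        finally show ?thesis .
      qed
      then show ?thesis by simp
    qed
    also have "(\<integral>z. (\<Sum>j\<in>UNIV. h $ j * (fK z * ?d j z)) \<partial>lborel) = (\<Sum>j\<in>UNIV. h $ j * (\<integral>z. fK z * ?d j z \<partial>lborel))"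
    proof (subst Bochner_Integration.integral_sum)
      show "integrable lborel (\<lambda>z. h $ j * (fK z * ?d j z))" for j
        unfolding pd by (intro integrable_mult_right intf continuous_intros)
    qed simp
    finally have "\<bar>\<integral>z. fK z * D s z \<partial>lborel\<bar> \<le> (\<Sum>j\<in>UNIV. \<bar>h $ j * (\<integral>z. fK z * ?d j z \<partial>lborel)\<bar>)"
      by (simp add: sum_abs)
    also have "\<dots> \<le> (\<Sum>j\<in>UNIV. \<bar>h $ j\<bar> * (C * P))"
      unfolding abs_mult by (intro sum_mono mult_left_mono each) auto
    also have "\<dots> = L * P" by (simp add: L_def sum_distrib_right[symmetric])
    finally show ?thesis .
  qed
  define R' where "R' = R + norm x + norm h"
  \<comment> \<open>The remainder of \<open>bump_increment\<close>, made uniform over the tube by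
    \<open>norm (z - c s) \<le> R'\<close> and \<open>\<bar>t - s\<bar> \<le> 1\<close>.\<close>
  define M0 where "M0 = 2 * \<delta>\<^sup>2 * (h \<bullet> h) + (2 * (R' * norm h) + h \<bullet> h)\<^sup>2"
  define M where "M = M0 * (\<integral>z. \<bar>fK z\<bar> \<partial>lborel)"
  have "\<bar>F 1 - F 0\<bar> \<le> L * P"
  proof (rule quadratic_increment_bound)
    fix s t :: real assume st: "0 \<le> s" "s \<le> t" "t \<le> 1"
    have s01: "0 \<le> s" "s \<le> 1" using st by auto
    have c1: "continuous_on UNIV (\<rho> s)" "continuous_on UNIV (\<rho> t)" unfolding \<rho>_def by (intro continuous_intros)+
    have c2: "continuous_on UNIV (\<lambda>z. (t - s) * D s z)" unfolding D_def by (intro continuous_intros)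
    have pt: "\<bar>fK z * \<rho> t z - fK z * \<rho> s z - fK z * ((t - s) * D s z)\<bar> \<le> (t - s)\<^sup>2 * M0 * \<bar>fK z\<bar>" for z
    proof (cases "z \<in> K")
      case True
      let ?w = "z - c s"
      have "z - c t = ?w - (t - s) *\<^sub>R h" by (simp add: c_def algebra_simps)
      then have "\<bar>\<rho> t z - \<rho> s z - (t - s) * D s z\<bar>
         \<le> (t - s)\<^sup>2 * (2 * \<delta>\<^sup>2 * (h \<bullet> h) + (2 * (norm ?w * norm h) + \<bar>t - s\<bar> * (h \<bullet> h))\<^sup>2)"
        using bump_increment[of \<delta> ?w "t - s" h] by (simp only: \<rho>_def D_def)
      also have "\<dots> \<le> (t - s)\<^sup>2 * M0"
      proof -
        have "norm ?w \<le> norm z + norm (c s)" by (rule norm_triangle_ineq4)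
        also have "norm (c s) \<le> norm x + norm (s *\<^sub>R h)" unfolding c_def by (rule norm_triangle_ineq)
        also have "norm (s *\<^sub>R h) \<le> norm h" using s01 by (simp add: mult_left_le_one_le)
        finally have "norm ?w \<le> R'" using R[OF True] by (simp add: R'_def)
        then have "2 * (norm ?w * norm h) + \<bar>t - s\<bar> * (h \<bullet> h) \<le> 2 * (R' * norm h) + 1 * (h \<bullet> h)"
          using st by (intro add_mono mult_left_mono mult_right_mono) auto
        then show ?thesis unfolding M0_def by (intro mult_left_mono add_left_mono power_mono) auto
      qed
      finally have "\<bar>\<rho> t z - \<rho> s z - (t - s) * D s z\<bar> * \<bar>fK z\<bar> \<le> (t - s)\<^sup>2 * M0 * \<bar>fK z\<bar>"
        by (rule mult_right_mono) simp
      moreover have "fK z * \<rho> t z - fK z * \<rho> s z - fK z * ((t - s) * D s z) = (\<rho> t z - \<rho> s z - (t - s) * D s z) * fK z"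
        by (simp add: algebra_simps)
      ultimately show ?thesis by (simp add: abs_mult)
    qed (simp add: fK_def)
    have E: "F t - F s - (t - s) * (\<integral>z. fK z * D s z \<partial>lborel)
       = (\<integral>z. fK z * \<rho> t z - fK z * \<rho> s z - fK z * ((t - s) * D s z) \<partial>lborel)"
    proof -
      have "(\<integral>z. fK z * ((t - s) * D s z) \<partial>lborel) = (\<integral>z. (t - s) * (fK z * D s z) \<partial>lborel)"
        by (simp add: mult.left_commute)
      also have "\<dots> = (t - s) * (\<integral>z. fK z * D s z \<partial>lborel)" by simp
      finally show ?thesis
        unfolding F_def using intf[OF c1(1)] intf[OF c1(2)] intf[OF c2] by simp
    qed
    have "\<bar>F t - F s - (t - s) * (\<integral>z. fK z * D s z \<partial>lborel)\<bar> \<le> (\<integral>z. \<bar>fK z * \<rho> t z - fK z * \<rho> s z - fK z * ((t - s) * D s z)\<bar> \<partial>lborel)"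
      unfolding E by (rule integral_abs_bound)
    also have "\<dots> \<le> (\<integral>z. (t - s)\<^sup>2 * M0 * \<bar>fK z\<bar> \<partial>lborel)"
    proof (rule integral_mono)
      show "integrable lborel (\<lambda>z. \<bar>fK z * \<rho> t z - fK z * \<rho> s z - fK z * ((t - s) * D s z)\<bar>)"
        by (rule integrable_abs[OF Bochner_Integration.integrable_diff[OF
              Bochner_Integration.integrable_diff[OF intf[OF c1(2)] intf[OF c1(1)]] intf[OF c2]]])
      show "integrable lborel (\<lambda>z. (t - s)\<^sup>2 * M0 * \<bar>fK z\<bar>)"
        using integrable_mult_right[OF integrable_abs[OF fKi], of "(t - s)\<^sup>2 * M0"] by simp
    qed (rule pt)
    also have "\<dots> = M * (t - s)\<^sup>2" by (simp add: M_def)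
    finally have "\<bar>F t - F s - (t - s) * (\<integral>z. fK z * D s z \<partial>lborel)\<bar> \<le> M * (t - s)\<^sup>2" .
    moreover have "\<bar>(t - s) * (\<integral>z. fK z * D s z \<partial>lborel)\<bar> \<le> (t - s) * (L * P)"
      using weak[OF s01] st unfolding abs_mult by (intro mult_mono) auto
    ultimately show "\<bar>F t - F s\<bar> \<le> L * P * (t - s) + M * (t - s)\<^sup>2"
      by (simp add: mult.commute)
  qed
  \<comment> \<open>After translation both integrals carry the same bump, so the values of
    \<open>f\<close> near \<open>y\<close> are compared pointwise with those near
    \<open>x\<close>.\<close>
  moreover have "F 1 - F 0 \<ge> (L + \<kappa>) * P"
  proof -
    have tr: "F s = (\<integral>w. fK (c s + w) * bump \<delta> w \<partial>lborel)" for s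
    proof -
      have "continuous_on UNIV (\<rho> s)" unfolding \<rho>_def by (intro continuous_intros)
      from borel_measurable_continuous_onI[OF this]
      have "(\<lambda>z. fK z * \<rho> s z) \<in> borel_measurable borel" by simp
      from integral_lborel_translate[OF this, of "c s"] show ?thesis by (simp add: F_def \<rho>_def)
    qed
    have tri: "integrable lborel (\<lambda>w. fK (c s + w) * bump \<delta> w)" for s
    proof -
      have "integrable (distr lborel borel ((+) (c s))) (\<lambda>z. fK z * \<rho> s z)"
        unfolding lborel_distr_plus \<rho>_def by (rule intf) (intro continuous_intros)
      then have "integrable lborel (\<lambda>w. fK (c s + w) * \<rho> s (c s + w))"
        by (rule integrable_distr[rotated]) simp
      then show ?thesis by (simp add: \<rho>_def)
    qed
    have "(L + \<kappa>) * P = (\<integral>w. (L + \<kappa>) * bump \<delta> (w :: real^'n) \<partial>lborel)" by (simp add: P_def)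
    also have "\<dots> \<le> (\<integral>w. fK (c 1 + w) * bump \<delta> w - fK (c 0 + w) * bump \<delta> w \<partial>lborel)"
    proof (rule integral_mono)
      show "integrable lborel (\<lambda>w. (L + \<kappa>) * bump \<delta> (w :: real^'n))"
        using integrable_bump[of \<delta> "0 :: real^'n"] \<delta>(1) by simp
      show "integrable lborel (\<lambda>w. fK (c 1 + w) * bump \<delta> w - fK (c 0 + w) * bump \<delta> w)"
        using tri by simp
      fix w :: "real^'n"
      show "(L + \<kappa>) * bump \<delta> w \<le> fK (c 1 + w) * bump \<delta> w - fK (c 0 + w) * bump \<delta> w"
      proof (cases "norm w < \<delta>")
        case True
        have in_K: "c 1 + w \<in> K" "c 0 + w \<in> K" using True by (auto intro: cK[of 1] cK[of 0])
        have "\<bar>f (c 1 + w) - f y\<bar> < \<kappa>"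
        proof (rule e2)
          show "c 1 + w \<in> \<Omega>" using K\<Omega> in_K(1) by (rule subsetD)
          show "dist (c 1 + w) y < e2" using True \<delta>(4) by (simp add: c_def h_def dist_norm)
        qed
        moreover have "\<bar>f (c 0 + w) - f x\<bar> < \<kappa>"
        proof (rule e1)
          show "c 0 + w \<in> \<Omega>" using K\<Omega> in_K(2) by (rule subsetD)
          show "dist (c 0 + w) x < e1" using True \<delta>(3) by (simp add: c_def dist_norm)
        qed
        moreover have "f y - f x = L + 3 * \<kappa>" by (simp add: \<kappa>_def field_simps)
        ultimately have "L + \<kappa> \<le> fK (c 1 + w) - fK (c 0 + w)" using in_K by (simp add: fK_def)
        from mult_right_mono[OF this bump_nonneg[of \<delta> w]] show ?thesis
          by (simp only: left_diff_distrib)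
      next
        case False
        then show ?thesis using bump_eq_0[of \<delta> w] \<delta> by simp
      qed
    qed
    also have "\<dots> = F 1 - F 0" unfolding tr by (rule Bochner_Integration.integral_diff[OF tri tri])
    finally show ?thesis .
  qed
  ultimately have "(L + \<kappa>) * P \<le> L * P" by simp
  then show False using P \<kappa> by (simp add: distrib_right mult_le_0_iff)
qed

text \<open>Convexity of \<open>D\<close> keeps the segment between two points inside \<Omega>, so
  that the gradient bound applies. On \<Omega> itself, possibly nonconvex, segments may leave the
  domain; the interiors of the simplices play the role of \<open>D\<close>.\<close>

lemma W1_infty_lipschitz:
  fixes f :: "real^'n \<Rightarrow> real"
  assumes \<Omega>: "open \<Omega>" and f: "continuous_on \<Omega> f" and W: "f \<in> W1_infty \<Omega>"
    and D: "convex D" "D \<subseteq> \<Omega>"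
  shows "\<exists>L. L-lipschitz_on D f"
proof -
  have "\<forall>j. \<exists>g\<in>L_infty \<Omega>. has_weak_partial \<Omega> j f g" using W unfolding W1_infty_def by blast
  then obtain g where g: "\<And>j. g j \<in> L_infty \<Omega>" "\<And>j. has_weak_partial \<Omega> j f (g j)" by metis
  then have "\<forall>j. \<exists>C. AE x in lebesgue_on \<Omega>. \<bar>g j x\<bar> \<le> C" by (simp add: L_infty_def)
  then obtain C0 where C0: "\<And>j. AE x in lebesgue_on \<Omega>. \<bar>g j x\<bar> \<le> C0 j" by metis
  define C where "C = (\<Sum>j\<in>UNIV. \<bar>C0 j\<bar>)"
  have C: "C0 j \<le> C" "0 \<le> C" for j
    using member_le_sum[of j UNIV "\<lambda>j. \<bar>C0 j\<bar>"] by (auto simp: C_def intro: sum_nonneg)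
  have gC: "AE x in lebesgue_on \<Omega>. \<bar>g j x\<bar> \<le> C" for j
    using C0[of j] by eventually_elim (use C(1)[of j] in linarith)
  have one: "f y - f x \<le> C * real CARD('n) * norm (y - x)" if "x \<in> D" "y \<in> D" for x y
  proof -
    have "closed_segment x y \<subseteq> \<Omega>" using D that by (meson closed_segment_subset subset_trans)
    then have "f y - f x \<le> C * (\<Sum>j\<in>UNIV. \<bar>(y - x) $ j\<bar>)" by (rule weak_gradient_bound[OF \<Omega> f g(2) gC])
    also have "\<dots> \<le> C * (\<Sum>j\<in>(UNIV::'n set). norm (y - x))"
      using C by (intro mult_left_mono sum_mono component_le_norm_cart) auto
    finally show ?thesis by simp
  qed
  have "(C * real CARD('n))-lipschitz_on D f"
  proof (rule lipschitz_onI)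
    fix x y assume "x \<in> D" "y \<in> D"
    then show "dist (f x) (f y) \<le> C * real CARD('n) * dist x y"
      using one[of x y] one[of y x] by (simp add: dist_norm norm_minus_commute abs_le_iff)
  qed (use C in simp)
  then show ?thesis by blast
qed

section \<open>The divergence theorem on a simplex\<close>

text \<open>The continuously differentiable quadratic spline that rises from 0 to 1 on [0, 1], with
  inner knot 1/2.\<close>

definition smoothstep :: "real \<Rightarrow> real" where
  "smoothstep t = 2 * (max 0 t)\<^sup>2 - 4 * (max 0 (t - 1/2))\<^sup>2 + 2 * (max 0 (t - 1))\<^sup>2"

text \<open>The hat function on [0, 1], of height 2 and integral 1.\<close>

definition smoothstep' :: "real \<Rightarrow> real" where
  "smoothstep' t = 4 * max 0 t - 8 * max 0 (t - 1/2) + 4 * max 0 (t - 1)"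

lemma has_derivative_smoothstep: "(smoothstep has_derivative (\<lambda>h. smoothstep' t * h)) (at t)"
proof -
  have shift: "((\<lambda>t::real. (max 0 (t - c))\<^sup>2) has_derivative (\<lambda>h. 2 * max 0 (t - c) * h)) (at t)" for c
    by (rule has_derivative_compose[of "\<lambda>t. t - c" "\<lambda>h. h", OF _ has_derivative_max0_square])
       (auto intro!: derivative_eq_intros)
  have "((\<lambda>t. 2 * (max 0 (t - 0))\<^sup>2 - 4 * (max 0 (t - 1/2))\<^sup>2 + 2 * (max 0 (t - 1))\<^sup>2) has_derivative
     (\<lambda>h. 2 * (2 * max 0 (t - 0) * h) - 4 * (2 * max 0 (t - 1/2) * h) + 2 * (2 * max 0 (t - 1) * h))) (at t)"
    by (intro has_derivative_add has_derivative_diff has_derivative_mult_right shift)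
  then show ?thesis
    by (simp add: smoothstep_def[abs_def] smoothstep'_def algebra_simps)
qed

lemma smoothstep_0: "t \<le> 0 \<Longrightarrow> smoothstep t = 0" by (simp add: smoothstep_def)
lemma smoothstep'_0: "t \<le> 0 \<Longrightarrow> smoothstep' t = 0" by (simp add: smoothstep'_def)
lemma smoothstep_1: "1 \<le> t \<Longrightarrow> smoothstep t = 1"
  by (simp add: smoothstep_def power2_eq_square algebra_simps)
lemma smoothstep'_1: "1 \<le> t \<Longrightarrow> smoothstep' t = 0" by (simp add: smoothstep'_def)

lemma smoothstep'_bounds: "0 \<le> smoothstep' t" "smoothstep' t \<le> 2"
  by (auto simp: smoothstep'_def max_def)

lemma smoothstep_bounds: "0 \<le> smoothstep t" "smoothstep t \<le> 1"
proof -
  have "0 \<le> smoothstep t \<and> smoothstep t \<le> 1"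
  proof -
    consider "t \<le> 0" | "0 \<le> t" "t \<le> 1/2" | "1/2 \<le> t" "t \<le> 1" | "1 \<le> t" by linarith
    then show ?thesis
    proof cases
      case 2
      then have "smoothstep t = 2 * t\<^sup>2" by (simp add: smoothstep_def)
      moreover have "t\<^sup>2 \<le> (1/2)\<^sup>2" using 2 by (intro power_mono) auto
      ultimately show ?thesis by (simp add: power2_eq_square)
    next
      case 3
      then have "smoothstep t = 1 - 2 * (1 - t)\<^sup>2"
        by (simp add: smoothstep_def power2_eq_square algebra_simps)
      moreover have "(1 - t)\<^sup>2 \<le> (1/2)\<^sup>2" using 3 by (intro power_mono) auto
      ultimately show ?thesis by (simp add: power2_eq_square)
    qed (simp_all add: smoothstep_0 smoothstep_1)
  qed
  then show "0 \<le> smoothstep t" "smoothstep t \<le> 1" by auto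
qed

lemma continuous_on_smoothstep[continuous_intros]:
  "continuous_on A f \<Longrightarrow> continuous_on A (\<lambda>x. smoothstep (f x))"
  unfolding smoothstep_def by (intro continuous_intros)

lemma continuous_on_smoothstep'[continuous_intros]:
  "continuous_on A f \<Longrightarrow> continuous_on A (\<lambda>x. smoothstep' (f x))"
  unfolding smoothstep'_def by (intro continuous_intros)

lemma borel_smoothstep[measurable]:
  "smoothstep \<in> borel_measurable borel" "smoothstep' \<in> borel_measurable borel"
  by (intro borel_measurable_continuous_onI continuous_intros)+

lemma integral_smoothstep':
  "integrable lborel (\<lambda>r. smoothstep' r * indicator {0..1} r)"
  "(\<integral>r. smoothstep' r * indicator {0..1} r \<partial>lborel) = 1"
proof -
  have d: "(smoothstep has_real_derivative smoothstep' x) (at x)" for x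
    using has_derivative_smoothstep[of x] by (simp add: has_field_derivative_def)
  have c: "isCont smoothstep' x" for x
    using continuous_on_smoothstep'[of UNIV "\<lambda>x. x"] by (simp add: continuous_on_eq_continuous_at)
  have "has_bochner_integral lborel (\<lambda>x. smoothstep' x * indicator {0..1} x) (smoothstep 1 - smoothstep 0)"
    by (rule has_bochner_integral_FTC_Icc_real) (simp_all add: d c)
  then show "integrable lborel (\<lambda>r. smoothstep' r * indicator {0..1} r)"
    "(\<integral>r. smoothstep' r * indicator {0..1} r \<partial>lborel) = 1"
    by (auto simp: has_bochner_integral_iff smoothstep_0 smoothstep_1)
qed

text \<open>The sequence is constant from some index on. The cutoff width is 1 / (m + 3) throughout;
  the summand 3 keeps it at most 1/3, which \<open>layer_integral\<close> requires.\<close>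

lemma smoothstep_tends_1:
  assumes "0 < c" and a: "\<And>m. c \<le> a m"
  shows "(\<lambda>m. smoothstep ((a m - 1 / (real m + 3)) / (1 / (real m + 3)))) \<longlonglongrightarrow> 1"
proof (rule tendsto_eventually)
  have "eventually (\<lambda>m. 2 / c < real m) sequentially"
    using filterlim_real_sequentially by (simp add: filterlim_at_top_dense)
  then show "eventually (\<lambda>m. smoothstep ((a m - 1 / (real m + 3)) / (1 / (real m + 3))) = 1) sequentially"
  proof eventually_elim
    case (elim m)
    have "2 < c * real m" using elim assms(1) by (simp add: divide_less_eq mult.commute)
    also have "\<dots> \<le> a m * (real m + 3)" using assms(1) a[of m] by (intro mult_mono) auto
    finally have "1 \<le> a m * (real m + 3) - 1" by simp
    moreover have "(a m - 1 / (real m + 3)) / (1 / (real m + 3)) = a m * (real m + 3) - 1"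
      by (simp add: field_simps)
    ultimately show ?case by (simp add: smoothstep_1)
  qed
qed

lemma linear_expand_axis:
  fixes f :: "real^'n \<Rightarrow> 'b::real_vector"
  assumes "linear f" shows "f b = (\<Sum>j\<in>UNIV. (b $ j) *\<^sub>R f (axis j 1))"
proof -
  have "b = (\<Sum>j\<in>UNIV. (b $ j) *\<^sub>R axis j 1)"
    using basis_expansion[of b] by (simp add: scalar_mult_eq_scaleR)
  then have "f b = f (\<Sum>j\<in>UNIV. (b $ j) *\<^sub>R axis j 1)" by simp
  then show ?thesis using assms by (simp add: linear_sum linear_cmul)
qed

text \<open>Only the sum of the weak partial derivatives vanishes, so the components are tested with
  one common function and added before the condition is used.\<close>

lemma divergence_free_tested:
  fixes \<beta> :: "real^'n \<Rightarrow> real^'n"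
  assumes df: "divergence_free \<Omega> \<beta>" and \<psi>: "C1_fun \<psi>" and K: "compact K" "K \<subseteq> \<Omega>" "\<And>x. x \<notin> K \<Longrightarrow> \<psi> x = 0"
    and \<Omega>: "open \<Omega>"
  shows "(\<Sum>j\<in>UNIV. LINT x:\<Omega>|lebesgue. \<beta> x $ j * partial_deriv j \<psi> x) = 0"
proof -
  obtain g where g: "\<And>i. has_weak_partial \<Omega> i (\<lambda>x. \<beta> x $ i) (g i)"
    "AE x in lebesgue_on \<Omega>. (\<Sum>i\<in>UNIV. g i x) = 0"
    using df unfolding divergence_free_def by blast
  have tf: "test_function \<Omega> \<psi>" by (rule test_function_C1[OF \<psi> K])
  have gi: "set_integrable lebesgue \<Omega> (\<lambda>x. g j x * \<psi> x)" for j
  proof (rule set_integrable_mult_supported(1)[OF _ C1_fun_continuous[OF \<psi>] K])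
    show "g j absolutely_integrable_on K" using g(1)[of j] K(1,2) unfolding has_weak_partial_def by blast
  qed
  have "(\<Sum>j\<in>UNIV. LINT x:\<Omega>|lebesgue. \<beta> x $ j * partial_deriv j \<psi> x)
      = (\<Sum>j\<in>UNIV. - (LINT x:\<Omega>|lebesgue. g j x * \<psi> x))"
    using g(1) tf unfolding has_weak_partial_def by (intro sum.cong refl) blast
  also have "\<dots> = - (\<integral>x. (\<Sum>j\<in>UNIV. indicator \<Omega> x *\<^sub>R (g j x * \<psi> x)) \<partial>lebesgue)"
    using gi unfolding set_lebesgue_integral_def set_integrable_def
    by (subst Bochner_Integration.integral_sum) (simp_all add: sum_negf)
  also have "(\<integral>x. (\<Sum>j\<in>UNIV. indicator \<Omega> x *\<^sub>R (g j x * \<psi> x)) \<partial>lebesgue) = 0"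
  proof (rule integral_eq_zero_AE)
    have "AE x in lebesgue. x \<in> \<Omega> \<longrightarrow> (\<Sum>i\<in>UNIV. g i x) = 0"
      using g(2) \<Omega> by (subst (asm) AE_restrict_space_iff) auto
    then show "AE x in lebesgue. (\<Sum>j\<in>UNIV. indicator \<Omega> x *\<^sub>R (g j x * \<psi> x)) = 0"
    proof eventually_elim
      case (elim x)
      have "(\<Sum>j\<in>UNIV. indicator \<Omega> x *\<^sub>R (g j x * \<psi> x)) = indicator \<Omega> x * ((\<Sum>j\<in>UNIV. g j x) * \<psi> x)"
        by (simp add: sum_distrib_left sum_distrib_right)
      then show ?case using elim by (cases "x \<in> \<Omega>") simp_all
    qed
  qed
  finally show ?thesis by simp
qed

section \<open>Cutoff functions inside a simplex\<close>

context full_simplex begin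

lemma AE_interior: "AE x in lborel. x \<in> \<tau> \<longrightarrow> x \<in> interior \<tau>"
proof -
  have "frontier \<tau> \<in> null_sets lebesgue"
    using negligible_convex_frontier[OF convex_convex_hull] by (simp add: negligible_iff_null_sets)
  moreover have "frontier \<tau> \<in> sets lborel" using closed_simplex by simp
  ultimately have "frontier \<tau> \<in> null_sets lborel" using null_sets_completion_iff by blast
  then have "AE x in lborel. x \<notin> frontier \<tau>" by (rule AE_not_in)
  then show ?thesis by eventually_elim (use closed_simplex in \<open>simp add: frontier_def\<close>)
qed

text \<open>For w \<noteq> v the set \<open>bary w\<close> = 0 contains the apex v and is invariant
  under homotheties centred there, so the cone formula writes its null volume in the simplex as a
  nonzero weight times its surface measure. Off this null set the cutoff factors on a facet tend to
  1.\<close>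

lemma AE_facet_bary_pos:
  assumes v: "v \<in> S"
  shows "AE y in facet_measure v. \<forall>w\<in>S - {v}. 0 < bary w y"
proof -
  have "AE y in facet_measure v. bary w y \<noteq> 0" if w: "w \<in> S - {v}" for w
  proof -
    have [measurable]: "bary w \<in> borel_measurable borel"
      by (intro borel_measurable_continuous_onI continuous_bary)
    let ?Z = "{x. bary w x = 0}"
    have Zb: "?Z \<in> sets borel" by measurable
    let ?I = "\<integral>\<^sup>+s. ennreal (height v * s ^ (CARD('n) - 1)) * indicator {0..1} s \<partial>lborel"
    have "?I * emeasure (facet_measure v) ?Z
        = (\<integral>\<^sup>+s. ennreal (height v * s ^ (CARD('n) - 1)) * indicator {0..1} s * emeasure (facet_measure v) ?Z \<partial>lborel)"
      by (rule nn_integral_multc[symmetric]) measurable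
    also have "\<dots> = (\<integral>\<^sup>+s. ennreal (height v * s ^ (CARD('n) - 1)) * (\<integral>\<^sup>+y. indicator ?Z (v + s *\<^sub>R (y - v)) \<partial>facet_measure v) * indicator {0..1} s \<partial>lborel)"
    proof (rule nn_integral_cong_AE)
      show "AE s in lborel. ennreal (height v * s ^ (CARD('n) - 1)) * indicator {0..1} s * emeasure (facet_measure v) ?Z
        = ennreal (height v * s ^ (CARD('n) - 1)) * (\<integral>\<^sup>+y. indicator ?Z (v + s *\<^sub>R (y - v)) \<partial>facet_measure v) * indicator {0..1} s"
        using AE_lborel_singleton[of "0::real"]
      proof eventually_elim
        case (elim s)
        have "bary w (v + s *\<^sub>R (y - v)) = s * bary w y" for y
          using bary_vertex[of w v] w v by (simp add: bary_segment)
        then have "(\<integral>\<^sup>+y. indicator ?Z (v + s *\<^sub>R (y - v)) \<partial>facet_measure v) = (\<integral>\<^sup>+y. indicator ?Z y \<partial>facet_measure v)"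
          using elim by (intro nn_integral_cong) (simp add: indicator_def)
        also have "\<dots> = emeasure (facet_measure v) ?Z" using Zb by (intro nn_integral_indicator) simp
        finally show ?case by (simp add: mult_ac)
      qed
    qed
    also have "\<dots> = (\<integral>\<^sup>+x. indicator ?Z x * indicator \<tau> x \<partial>lborel)"
      by (rule nn_integral_simplex_cone[OF v, symmetric]) measurable
    also have "\<dots> = (\<integral>\<^sup>+x. 0 \<partial>(lborel :: (real^'n) measure))"
    proof (rule nn_integral_cong_AE)
      show "AE x in lborel. indicator ?Z x * indicator \<tau> x = (0::ennreal)"
        using AE_interior by eventually_elim (use w in \<open>auto simp: interior_simplex indicator_def\<close>)
    qed
    finally have "?I * emeasure (facet_measure v) ?Z = 0" by simp
    then have "emeasure (facet_measure v) ?Z = 0" using cone_weight_nonzero[OF v] by simp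
    then have "?Z \<in> null_sets (facet_measure v)" using Zb by (intro null_setsI) auto
    then show ?thesis using AE_iff_null_sets[of ?Z "facet_measure v"] Zb by simp
  qed
  then have "AE y in facet_measure v. \<forall>w\<in>S - {v}. bary w y \<noteq> 0"
    by (intro AE_finite_allI) auto
  then show ?thesis
    using AE_facet_measure[of v]
  proof eventually_elim
    case (elim y)
    have "y \<in> \<tau>" using elim(2) F_subset by blast
    show ?case
    proof
      fix w assume w: "w \<in> S - {v}"
      then have "0 \<le> bary w y" using \<open>y \<in> \<tau>\<close> by (simp add: mem_simplex_iff)
      then show "0 < bary w y" using elim(1) w by (simp add: less_le)
    qed
  qed
qed

text \<open>For \<epsilon> > 0 each factor is 0 where \<open>bary v\<close> \<le> \<epsilon> and 1
  where \<open>bary v\<close> \<ge> 2 \<epsilon>. The shift by \<epsilon> makes the support a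
  compact subset of the open simplex, as a test function needs.\<close>

definition cutoff :: "real \<Rightarrow> real^'n \<Rightarrow> real" where
  "cutoff \<epsilon> x = (\<Prod>v\<in>S. smoothstep ((bary v x - \<epsilon>) / \<epsilon>))"

text \<open>The part of the gradient of the cutoff that comes from the facet opposite to \<open>v\<close>.\<close>

definition layer :: "real \<Rightarrow> real^'n \<Rightarrow> real^'n \<Rightarrow> real" where
  "layer \<epsilon> v x = smoothstep' ((bary v x - \<epsilon>) / \<epsilon>) / \<epsilon> * (\<Prod>w\<in>S - {v}. smoothstep ((bary w x - \<epsilon>) / \<epsilon>))"

lemma has_derivative_bary: "(bary v has_derivative (\<lambda>h. - (h \<bullet> nrm v) / height v)) (at x)"
proof -
  have "((\<lambda>x. (base v - x) \<bullet> nrm v) has_derivative (\<lambda>h. (0 - h) \<bullet> nrm v)) (at x)"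
    by (intro has_derivative_inner_left has_derivative_diff has_derivative_const has_derivative_ident)
  then have "((\<lambda>x. (base v - x) \<bullet> nrm v / height v) has_derivative (\<lambda>h. (0 - h) \<bullet> nrm v / height v)) (at x)"
    by (rule bounded_linear.has_derivative[OF bounded_linear_divide])
  then show ?thesis by (simp add: bary_def[abs_def])
qed

lemma has_derivative_cutoff:
  "(cutoff \<epsilon> has_derivative (\<lambda>h. - (\<Sum>v\<in>S. (h \<bullet> nrm v) / height v * layer \<epsilon> v x))) (at x)"
proof -
  have "((\<lambda>x. smoothstep ((bary v x - \<epsilon>) / \<epsilon>)) has_derivative
      (\<lambda>h. smoothstep' ((bary v x - \<epsilon>) / \<epsilon>) * ((- (h \<bullet> nrm v) / height v - 0) / \<epsilon>))) (at x)" for v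
    by (rule has_derivative_compose[OF _ has_derivative_smoothstep])
       (intro bounded_linear.has_derivative[OF bounded_linear_divide] has_derivative_diff has_derivative_bary has_derivative_const)
  then have "((\<lambda>x. \<Prod>v\<in>S. smoothstep ((bary v x - \<epsilon>) / \<epsilon>)) has_derivative
      (\<lambda>h. \<Sum>v\<in>S. smoothstep' ((bary v x - \<epsilon>) / \<epsilon>) * ((- (h \<bullet> nrm v) / height v - 0) / \<epsilon>)
        * (\<Prod>w\<in>S - {v}. smoothstep ((bary w x - \<epsilon>) / \<epsilon>)))) (at x)"
    by (rule has_derivative_prod)
  then show ?thesis
    unfolding cutoff_def[abs_def] layer_def sum_negf[symmetric]
    by (rule has_derivative_eq_rhs) (auto intro!: sum.cong)
qed

lemma continuous_cutoff: "\<epsilon> > 0 \<Longrightarrow> continuous_on A (cutoff \<epsilon>)"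
  unfolding cutoff_def[abs_def] by (intro continuous_intros) auto

lemma continuous_layer: "\<epsilon> > 0 \<Longrightarrow> continuous_on A (layer \<epsilon> v)"
  unfolding layer_def[abs_def] by (intro continuous_intros) auto

lemma C1_fun_cutoff:
  assumes "\<epsilon> > 0" shows "C1_fun (cutoff \<epsilon>)"
proof (rule C1_funI[OF has_derivative_cutoff])
  show "continuous_on UNIV (\<lambda>x. - (\<Sum>v\<in>S. (h \<bullet> nrm v) / height v * layer \<epsilon> v x))" for h
    by (intro continuous_intros continuous_layer assms)
qed

definition core :: "real \<Rightarrow> (real^'n) set" where "core \<epsilon> = {x. \<forall>v\<in>S. \<epsilon> \<le> bary v x}"

lemma core_interior: "\<epsilon> > 0 \<Longrightarrow> core \<epsilon> \<subseteq> interior \<tau>"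
  by (force simp: core_def interior_simplex)

lemma compact_core: assumes "\<epsilon> > 0" shows "compact (core \<epsilon>)"
proof -
  have "core \<epsilon> = (\<Inter>v\<in>S. {x. \<epsilon> \<le> bary v x})" by (auto simp: core_def)
  moreover have "closed {x. \<epsilon> \<le> bary v x}" for v
    by (intro closed_Collect_le continuous_intros)
  ultimately have "closed (core \<epsilon>)" by (simp add: closed_INT)
  moreover have "core \<epsilon> \<subseteq> \<tau>" using core_interior[OF assms] interior_subset by blast
  ultimately show ?thesis using compact_simplex by (meson bounded_subset compact_eq_bounded_closed)
qed

lemma cutoff_outside:
  assumes \<epsilon>: "\<epsilon> > 0" and x: "x \<notin> core \<epsilon>"
  shows "cutoff \<epsilon> x = 0" "layer \<epsilon> v x = 0"
proof -
  obtain u where u: "u \<in> S" "bary u x < \<epsilon>" using x by (auto simp: core_def not_le)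
  have neg: "(bary u x - \<epsilon>) / \<epsilon> \<le> 0" using \<epsilon> u by (simp add: divide_le_0_iff)
  show "cutoff \<epsilon> x = 0"
    unfolding cutoff_def using u(1) smoothstep_0[OF neg] by (intro prod_zero) auto
  show "layer \<epsilon> v x = 0"
  proof (cases "u = v")
    case True
    then show ?thesis using smoothstep'_0[OF neg] by (simp add: layer_def)
  next
    case False
    then have "(\<Prod>w\<in>S - {v}. smoothstep ((bary w x - \<epsilon>) / \<epsilon>)) = 0"
      using u(1) smoothstep_0[OF neg] by (intro prod_zero) auto
    then show ?thesis by (simp add: layer_def)
  qed
qed

lemma prod_smoothstep_bounds: "0 \<le> (\<Prod>w\<in>A. smoothstep (f w))" "(\<Prod>w\<in>A. smoothstep (f w)) \<le> 1"
  by (auto intro!: prod_nonneg prod_le_1 simp: smoothstep_bounds)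

text \<open>The test function is \<phi> times the cutoff, and the two sides are the two terms of its
  product rule. \<open>B\<close> stands in for \<beta> so that the integrands make sense up to the
  boundary of the simplex; on the support of the cutoff both agree.\<close>

lemma tested_on_simplex:
  fixes \<beta> B :: "real^'n \<Rightarrow> real^'n"
  assumes \<Omega>: "open \<Omega>" "interior \<tau> \<subseteq> \<Omega>" and df: "divergence_free \<Omega> \<beta>"
    and B: "continuous_on \<tau> B" "\<And>x. x \<in> interior \<tau> \<Longrightarrow> B x = \<beta> x" and \<phi>: "C1_fun \<phi>" and \<epsilon>: "\<epsilon> > 0"
  shows "(\<integral>x. indicator \<tau> x * (frechet_derivative \<phi> (at x) (B x) * cutoff \<epsilon> x) \<partial>lborel)
     = (\<Sum>v\<in>S. (\<integral>x. indicator \<tau> x * (\<phi> x * (B x \<bullet> nrm v) / height v * layer \<epsilon> v x) \<partial>lborel))"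
proof -
  define \<psi> where "\<psi> x = \<phi> x * cutoff \<epsilon> x" for x
  define d\<psi> where "d\<psi> x h = \<phi> x * (- (\<Sum>v\<in>S. (h \<bullet> nrm v) / height v * layer \<epsilon> v x))
       + frechet_derivative \<phi> (at x) h * cutoff \<epsilon> x" for x h
  have der: "(\<psi> has_derivative d\<psi> x) (at x)" for x
    unfolding \<psi>_def[abs_def] d\<psi>_def[abs_def]
    by (rule has_derivative_mult[OF C1_fun_deriv[OF \<phi>] has_derivative_cutoff])
  have \<psi>: "C1_fun \<psi>"
    unfolding \<psi>_def[abs_def] by (intro C1_fun_mult \<phi> C1_fun_cutoff \<epsilon>)
  have pd: "partial_deriv j \<psi> x = d\<psi> x (axis j 1)" for j x
    unfolding partial_deriv_def using frechet_derivative_at[OF der] by simp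
  have out: "\<psi> x = 0" "d\<psi> x h = 0" if "x \<notin> core \<epsilon>" for x h
    unfolding \<psi>_def d\<psi>_def using cutoff_outside[OF \<epsilon> that] by simp_all
  have lin: "linear (d\<psi> x)" for x using der has_derivative_linear by blast
  have core\<Omega>: "core \<epsilon> \<subseteq> \<Omega>" using core_interior[OF \<epsilon>] \<Omega>(2) by (rule subset_trans)
  have cd: "continuous_on A (\<lambda>x. d\<psi> x h)" for A h
    unfolding d\<psi>_def
    by (intro continuous_intros continuous_layer continuous_cutoff \<epsilon> C1_fun_continuous[OF \<phi>] C1_fun_continuous_deriv[OF \<phi>])
  have cBj: "continuous_on \<tau> (\<lambda>x. B x $ j)" for j
    using B(1) by (intro continuous_intros)
  have each: "(LINT x:\<Omega>|lebesgue. \<beta> x $ j * partial_deriv j \<psi> x)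
     = (\<integral>x. indicator \<tau> x *\<^sub>R (B x $ j * d\<psi> x (axis j 1)) \<partial>lborel)" for j
  proof -
    have "indicator \<Omega> x *\<^sub>R (\<beta> x $ j * partial_deriv j \<psi> x) = indicator \<tau> x *\<^sub>R (B x $ j * d\<psi> x (axis j 1))" for x
    proof (cases "x \<in> core \<epsilon>")
      case True
      then have "x \<in> interior \<tau>" using core_interior[OF \<epsilon>] by (rule subsetD[rotated])
      moreover from this have "x \<in> \<tau>" using interior_subset by (rule subsetD[rotated])
      moreover have "x \<in> \<Omega>" using core\<Omega> True by (rule subsetD)
      ultimately show ?thesis by (simp add: pd B(2))
    next
      case False
      then show ?thesis by (simp add: pd out)
    qed
    then have "(LINT x:\<Omega>|lebesgue. \<beta> x $ j * partial_deriv j \<psi> x)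
      = (\<integral>x. indicator \<tau> x *\<^sub>R (B x $ j * d\<psi> x (axis j 1)) \<partial>lebesgue)"
      unfolding set_lebesgue_integral_def by simp
    also have "\<dots> = (\<integral>x. indicator \<tau> x *\<^sub>R (B x $ j * d\<psi> x (axis j 1)) \<partial>lborel)"
    proof (rule integral_completion)
      have "(\<lambda>x. indicator \<tau> x *\<^sub>R (B x $ j * d\<psi> x (axis j 1))) \<in> borel_measurable borel"
        by (intro borel_measurable_continuous_on_indicator borel_simplex continuous_on_mult cBj cd)
      then show "(\<lambda>x. indicator \<tau> x *\<^sub>R (B x $ j * d\<psi> x (axis j 1))) \<in> borel_measurable lborel" by simp
    qed
    finally show ?thesis .
  qed
  have int1: "integrable lborel (\<lambda>x. indicator \<tau> x *\<^sub>R (B x $ j * d\<psi> x (axis j 1)))" for j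
    by (intro integrable_simplex continuous_on_mult cBj cd)
  have "0 = (\<Sum>j\<in>UNIV. LINT x:\<Omega>|lebesgue. \<beta> x $ j * partial_deriv j \<psi> x)"
    by (rule divergence_free_tested[OF df \<psi> compact_core[OF \<epsilon>] core\<Omega> out(1) \<Omega>(1), symmetric])
  also have "\<dots> = (\<integral>x. (\<Sum>j\<in>UNIV. indicator \<tau> x *\<^sub>R (B x $ j * d\<psi> x (axis j 1))) \<partial>lborel)"
    unfolding each by (rule Bochner_Integration.integral_sum[symmetric]) (rule int1)
  also have "\<dots> = (\<integral>x. indicator \<tau> x * (frechet_derivative \<phi> (at x) (B x) * cutoff \<epsilon> x)
      - (\<Sum>v\<in>S. indicator \<tau> x * (\<phi> x * (B x \<bullet> nrm v) / height v * layer \<epsilon> v x)) \<partial>lborel)"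
  proof (rule Bochner_Integration.integral_cong[OF refl])
    fix x
    have "(\<Sum>j\<in>UNIV. indicator \<tau> x *\<^sub>R (B x $ j * d\<psi> x (axis j 1))) = indicator \<tau> x * (\<Sum>j\<in>UNIV. (B x $ j) *\<^sub>R d\<psi> x (axis j 1))"
      by (simp add: sum_distrib_left)
    also have "(\<Sum>j\<in>UNIV. (B x $ j) *\<^sub>R d\<psi> x (axis j 1)) = d\<psi> x (B x)"
      by (rule linear_expand_axis[OF lin, symmetric])
    also have "indicator \<tau> x * d\<psi> x (B x) = indicator \<tau> x * (frechet_derivative \<phi> (at x) (B x) * cutoff \<epsilon> x)
      - (\<Sum>v\<in>S. indicator \<tau> x * (\<phi> x * (B x \<bullet> nrm v) / height v * layer \<epsilon> v x))"
      by (simp add: d\<psi>_def right_diff_distrib sum_distrib_left mult_ac)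
    finally show "(\<Sum>j\<in>UNIV. indicator \<tau> x *\<^sub>R (B x $ j * d\<psi> x (axis j 1)))
      = indicator \<tau> x * (frechet_derivative \<phi> (at x) (B x) * cutoff \<epsilon> x)
      - (\<Sum>v\<in>S. indicator \<tau> x * (\<phi> x * (B x \<bullet> nrm v) / height v * layer \<epsilon> v x))" .
  qed
  also have "\<dots> = (\<integral>x. indicator \<tau> x * (frechet_derivative \<phi> (at x) (B x) * cutoff \<epsilon> x) \<partial>lborel)
     - (\<Sum>v\<in>S. (\<integral>x. indicator \<tau> x * (\<phi> x * (B x \<bullet> nrm v) / height v * layer \<epsilon> v x) \<partial>lborel))"
  proof -
    have "continuous_on \<tau> (\<lambda>x. \<Sum>j\<in>UNIV. (B x $ j) *\<^sub>R frechet_derivative \<phi> (at x) (axis j 1))"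
      by (intro continuous_intros cBj C1_fun_continuous_deriv[OF \<phi>])
    moreover have "(\<Sum>j\<in>UNIV. (B x $ j) *\<^sub>R frechet_derivative \<phi> (at x) (axis j 1)) = frechet_derivative \<phi> (at x) (B x)" for x
      using has_derivative_linear[OF C1_fun_deriv[OF \<phi>]] by (rule linear_expand_axis[symmetric])
    ultimately have "continuous_on \<tau> (\<lambda>x. frechet_derivative \<phi> (at x) (B x) * cutoff \<epsilon> x)"
      by (intro continuous_on_mult continuous_cutoff \<epsilon>) simp
    then have i1: "integrable lborel (\<lambda>x. indicator \<tau> x * (frechet_derivative \<phi> (at x) (B x) * cutoff \<epsilon> x))"
      using integrable_simplex by fastforce
    have i2: "integrable lborel (\<lambda>x. indicator \<tau> x * (\<phi> x * (B x \<bullet> nrm v) / height v * layer \<epsilon> v x))" if "v \<in> S" for v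
    proof -
      have "continuous_on \<tau> (\<lambda>x. \<phi> x * (B x \<bullet> nrm v) / height v * layer \<epsilon> v x)"
        using height_pos[OF that] by (intro continuous_intros continuous_layer \<epsilon> C1_fun_continuous[OF \<phi>] B(1)) simp
      then show ?thesis using integrable_simplex by fastforce
    qed
    have "(\<integral>x. (\<Sum>v\<in>S. indicator \<tau> x * (\<phi> x * (B x \<bullet> nrm v) / height v * layer \<epsilon> v x)) \<partial>lborel)
       = (\<Sum>v\<in>S. (\<integral>x. indicator \<tau> x * (\<phi> x * (B x \<bullet> nrm v) / height v * layer \<epsilon> v x) \<partial>lborel))"
      using i2 by (rule Bochner_Integration.integral_sum)
    moreover have i3: "integrable lborel (\<lambda>x. \<Sum>v\<in>S. indicator \<tau> x * (\<phi> x * (B x \<bullet> nrm v) / height v * layer \<epsilon> v x))"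
      using i2 by (rule Bochner_Integration.integrable_sum)
    ultimately show ?thesis
      unfolding Bochner_Integration.integral_diff[OF i1 i3] by (simp only:)
  qed
  finally show ?thesis by simp
qed


lemma continuous_on_simplex_bounded:
  fixes f :: "real^'n \<Rightarrow> real"
  assumes "continuous_on \<tau> f"
  shows "\<exists>C\<ge>0. \<forall>x\<in>\<tau>. \<bar>f x\<bar> \<le> C"
proof -
  have "bounded (f ` \<tau>)" using assms compact_simplex by (intro compact_imp_bounded compact_continuous_image)
  then obtain C where C: "\<forall>x\<in>\<tau>. \<bar>f x\<bar> \<le> C" unfolding bounded_iff by auto
  show ?thesis
  proof (intro exI[of _ "\<bar>C\<bar>"] conjI ballI)
    show "\<bar>f x\<bar> \<le> \<bar>C\<bar>" if "x \<in> \<tau>" for x using C that by (meson abs_ge_self order_trans)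
  qed simp
qed

lemma cutoff_integral_limit:
  fixes f :: "real^'n \<Rightarrow> real"
  assumes f: "continuous_on \<tau> f"
  shows "(\<lambda>m. \<integral>x. indicator \<tau> x * (f x * cutoff (1 / (real m + 3)) x) \<partial>lborel)
      \<longlonglongrightarrow> (\<integral>x. indicator \<tau> x * f x \<partial>lborel)"
proof (rule integral_dominated_convergence[where w="\<lambda>x. \<bar>indicator \<tau> x * f x\<bar>"])
  have b: "(\<lambda>x. indicator \<tau> x * f x) \<in> borel_measurable borel"
    using borel_measurable_continuous_on_indicator[OF borel_simplex f] by simp
  then show "(\<lambda>x. indicator \<tau> x * f x) \<in> borel_measurable lborel" by simp
  show "(\<lambda>x. indicator \<tau> x * (f x * cutoff (1 / (real m + 3)) x)) \<in> borel_measurable lborel" for m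
  proof -
    have "cutoff (1 / (real m + 3)) \<in> borel_measurable borel"
      by (intro borel_measurable_continuous_onI continuous_cutoff) simp
    from borel_measurable_times[OF b this] show ?thesis by (simp add: mult.assoc)
  qed
  show "integrable lborel (\<lambda>x. \<bar>indicator \<tau> x * f x\<bar>)"
    using integrable_abs[OF integrable_simplex[OF f]] by simp
  show "AE x in lborel. norm (indicator \<tau> x * (f x * cutoff (1 / (real m + 3)) x)) \<le> \<bar>indicator \<tau> x * f x\<bar>" for m
  proof (rule AE_I2)
    fix x
    have "\<bar>cutoff (1 / (real m + 3)) x\<bar> \<le> 1"
      unfolding cutoff_def by (simp add: prod_smoothstep_bounds)
    then have "\<bar>indicator \<tau> x * f x\<bar> * \<bar>cutoff (1 / (real m + 3)) x\<bar> \<le> \<bar>indicator \<tau> x * f x\<bar> * 1"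
      by (rule mult_left_mono) simp
    then show "norm (indicator \<tau> x * (f x * cutoff (1 / (real m + 3)) x)) \<le> \<bar>indicator \<tau> x * f x\<bar>"
      by (simp add: abs_mult mult.assoc)
  qed
  show "AE x in lborel. (\<lambda>m. indicator \<tau> x * (f x * cutoff (1 / (real m + 3)) x)) \<longlonglongrightarrow> indicator \<tau> x * f x"
    using AE_interior
  proof eventually_elim
    case (elim x)
    show ?case
    proof (cases "x \<in> \<tau>")
      case False then show ?thesis by simp
    next
      case True
      then have pos: "0 < bary v x" if "v \<in> S" for v using elim that by (simp add: interior_simplex)
      have "(\<lambda>m. cutoff (1 / (real m + 3)) x) \<longlonglongrightarrow> (\<Prod>v\<in>S. 1)"
        unfolding cutoff_def by (intro tendsto_prod smoothstep_tends_1[OF pos order_refl])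
      then have "(\<lambda>m. indicator \<tau> x * (f x * cutoff (1 / (real m + 3)) x)) \<longlonglongrightarrow> indicator \<tau> x * (f x * 1)"
        by (intro tendsto_intros) simp
      then show ?thesis by simp
    qed
  qed
qed

section \<open>Boundary layers concentrating on the facets\<close>

lemma integral_simplex_cone_iterated:
  fixes f :: "real^'n \<Rightarrow> real"
  assumes v: "v \<in> S" and f[measurable]: "f \<in> borel_measurable borel" and C: "\<And>x. \<bar>f x\<bar> \<le> C"
  shows "(\<integral>x. indicator \<tau> x * f x \<partial>lborel)
       = (\<integral>s. height v * s ^ (CARD('n) - 1) * indicator {0..1} s * (\<integral>y. f (v + s *\<^sub>R (y - v)) \<partial>facet_measure v) \<partial>lborel)"
proof -
  interpret N: finite_measure "facet_measure v" using v by (rule finite_facet_measure)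
  interpret LN: pair_sigma_finite "lborel :: real measure" "facet_measure v" ..
  let ?M = "CARD('n) - 1"
  let ?h = "\<lambda>(s::real, y). (height v * s ^ ?M * indicator {0..1} s) * f (v + s *\<^sub>R (y - v))"
  have H: "0 < height v" using v by (rule height_pos)
  have int: "integrable (lborel \<Otimes>\<^sub>M facet_measure v) ?h"
  proof (rule integrableI_bounded_set[where A="{0..1::real} \<times> UNIV" and B="height v * C"])
    show "{0..1::real} \<times> UNIV \<in> sets (lborel \<Otimes>\<^sub>M facet_measure v)" by (intro pair_measureI) auto
    show "?h \<in> borel_measurable (lborel \<Otimes>\<^sub>M facet_measure v)" by measurable
    have "emeasure (lborel \<Otimes>\<^sub>M facet_measure v) ({0..1::real} \<times> UNIV) = emeasure lborel {0..1::real} * emeasure (facet_measure v) UNIV"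
      by (rule N.emeasure_pair_measure_Times) auto
    also have "\<dots> < \<infinity>" using N.emeasure_finite by (simp add: less_top[symmetric])
    finally show "emeasure (lborel \<Otimes>\<^sub>M facet_measure v) ({0..1::real} \<times> UNIV) < \<infinity>" .
    show "AE z in lborel \<Otimes>\<^sub>M facet_measure v. z \<in> {0..1} \<times> UNIV \<longrightarrow> norm (?h z) \<le> height v * C"
    proof (intro AE_I2 impI)
      fix z :: "real \<times> (real^'n)" assume "z \<in> {0..1} \<times> UNIV"
      then obtain s y where z: "z = (s, y)" "0 \<le> s" "s \<le> 1" by (cases z) auto
      have "s ^ ?M \<le> 1" using z by (intro power_le_one)
      then have "height v * s ^ ?M \<le> height v * 1" using H by (intro mult_left_mono) auto
      moreover have "0 \<le> height v * s ^ ?M" using H z by simp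
      ultimately have "(height v * s ^ ?M) * \<bar>f (v + s *\<^sub>R (y - v))\<bar> \<le> height v * C"
        using C[of "v + s *\<^sub>R (y - v)"] H by (intro mult_mono) auto
      then show "norm (?h z) \<le> height v * C"
        using z H by (simp add: abs_mult)
    qed
    show "AE z in lborel \<Otimes>\<^sub>M facet_measure v. z \<notin> {0..1} \<times> UNIV \<longrightarrow> ?h z = 0"
    proof (intro AE_I2 impI)
      fix z :: "real \<times> (real^'n)" assume "z \<notin> {0..1} \<times> UNIV"
      then have "fst z \<notin> {0..1}" by (metis SigmaI UNIV_I prod.collapse)
      then show "?h z = 0" by (simp add: case_prod_unfold)
    qed
  qed
  have "(\<integral>x. indicator \<tau> x * f x \<partial>lborel) = (\<integral>z. ?h z \<partial>(lborel \<Otimes>\<^sub>M facet_measure v))"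
    using integral_simplex_cone[OF v f] by simp
  also have "\<dots> = (\<integral>s. (\<integral>y. ?h (s, y) \<partial>facet_measure v) \<partial>lborel)"
    by (rule LN.integral_fst'[OF int, symmetric])
  finally show ?thesis by simp
qed

text \<open>The inner integral of the cone formula for a layer: on the slice at level s the
  coordinate \<open>bary w\<close>, w \<noteq> v, takes the value
  \<open>s * bary w y\<close>.\<close>

definition facet_average :: "(real^'n \<Rightarrow> real) \<Rightarrow> real^'n \<Rightarrow> real \<Rightarrow> real \<Rightarrow> real" where
  "facet_average G v \<epsilon> s = (\<integral>y. G (v + s *\<^sub>R (y - v))
      * (\<Prod>w\<in>S - {v}. smoothstep ((s * bary w y - \<epsilon>) / \<epsilon>)) \<partial>facet_measure v)"

text \<open>On the slice at level s the coordinate \<open>bary v\<close> equals 1 - s, so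
  \<open>smoothstep'\<close> leaves the inner integral. The substitution s = 1 - \<epsilon> (1 + r)
  absorbs the factor 1 / \<epsilon>, and the height from the cone formula cancels the one in the
  integrand.\<close>

lemma layer_integral:
  fixes G :: "real^'n \<Rightarrow> real"
  assumes v: "v \<in> S" and G[measurable]: "G \<in> borel_measurable borel" and C: "\<And>x. \<bar>G x\<bar> \<le> C"
    and \<epsilon>: "\<epsilon> > 0" "\<epsilon> \<le> 1/3"
  shows "(\<integral>x. indicator \<tau> x * (G x / height v * layer \<epsilon> v x) \<partial>lborel)
     = (\<integral>r. (smoothstep' r * indicator {0..1} r) * ((1 - \<epsilon> * (1 + r)) ^ (CARD('n) - 1)
          * facet_average G v \<epsilon> (1 - \<epsilon> * (1 + r))) \<partial>lborel)"
proof -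
  let ?M = "CARD('n) - 1"
  have H: "0 < height v" using v by (rule height_pos)
  have lm: "layer \<epsilon> v \<in> borel_measurable borel"
    by (intro borel_measurable_continuous_onI continuous_layer \<epsilon>)
  have C0: "0 \<le> C" using C[of 0] by linarith
  have lb: "\<bar>layer \<epsilon> v x\<bar> \<le> 2 / \<epsilon>" for x
  proof -
    have "smoothstep' ((bary v x - \<epsilon>) / \<epsilon>) / \<epsilon> * (\<Prod>w\<in>S - {v}. smoothstep ((bary w x - \<epsilon>) / \<epsilon>)) \<le> 2 / \<epsilon> * 1"
      using \<epsilon> smoothstep'_bounds[of "(bary v x - \<epsilon>) / \<epsilon>"]
      by (intro mult_mono divide_right_mono prod_smoothstep_bounds) auto
    moreover have "0 \<le> smoothstep' ((bary v x - \<epsilon>) / \<epsilon>) / \<epsilon> * (\<Prod>w\<in>S - {v}. smoothstep ((bary w x - \<epsilon>) / \<epsilon>))"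
      using \<epsilon> smoothstep'_bounds[of "(bary v x - \<epsilon>) / \<epsilon>"]
      by (intro mult_nonneg_nonneg divide_nonneg_nonneg prod_smoothstep_bounds) auto
    ultimately show ?thesis unfolding layer_def by (simp only: abs_of_nonneg mult_1_right)
  qed
  have bd: "\<bar>G x / height v * layer \<epsilon> v x\<bar> \<le> C / height v * (2 / \<epsilon>)" for x
    using C[of x] lb[of x] H C0 \<epsilon> unfolding abs_mult abs_divide
    by (intro mult_mono) (auto intro: divide_right_mono)
  have fm: "(\<lambda>x. G x / height v * layer \<epsilon> v x) \<in> borel_measurable borel"
    using lm by measurable
  have inner: "(\<integral>y. G (v + s *\<^sub>R (y - v)) / height v * layer \<epsilon> v (v + s *\<^sub>R (y - v)) \<partial>facet_measure v)
     = smoothstep' ((1 - s - \<epsilon>) / \<epsilon>) / (\<epsilon> * height v) * facet_average G v \<epsilon> s" for s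
  proof -
    have "(\<integral>y. G (v + s *\<^sub>R (y - v)) / height v * layer \<epsilon> v (v + s *\<^sub>R (y - v)) \<partial>facet_measure v)
      = (\<integral>y. smoothstep' ((1 - s - \<epsilon>) / \<epsilon>) / (\<epsilon> * height v) * (G (v + s *\<^sub>R (y - v))
      * (\<Prod>w\<in>S - {v}. smoothstep ((s * bary w y - \<epsilon>) / \<epsilon>))) \<partial>facet_measure v)"
    proof (rule integral_cong_AE)
      have [measurable]: "bary w \<in> borel_measurable borel" for w
        by (intro borel_measurable_continuous_onI continuous_bary)
      show "(\<lambda>y. G (v + s *\<^sub>R (y - v)) / height v * layer \<epsilon> v (v + s *\<^sub>R (y - v))) \<in> borel_measurable (facet_measure v)"
        using lm by measurable
      show "(\<lambda>y. smoothstep' ((1 - s - \<epsilon>) / \<epsilon>) / (\<epsilon> * height v) * (G (v + s *\<^sub>R (y - v))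
          * (\<Prod>w\<in>S - {v}. smoothstep ((s * bary w y - \<epsilon>) / \<epsilon>)))) \<in> borel_measurable (facet_measure v)"
        by measurable
      show "AE y in facet_measure v. G (v + s *\<^sub>R (y - v)) / height v * layer \<epsilon> v (v + s *\<^sub>R (y - v))
          = smoothstep' ((1 - s - \<epsilon>) / \<epsilon>) / (\<epsilon> * height v) * (G (v + s *\<^sub>R (y - v))
          * (\<Prod>w\<in>S - {v}. smoothstep ((s * bary w y - \<epsilon>) / \<epsilon>)))"
        using AE_facet_measure[of v]
      proof eventually_elim
        case (elim y)
        have b1: "bary v (v + s *\<^sub>R (y - v)) = 1 - s"
          using bary_F[OF v elim] bary_vertex[OF v v] by (simp add: bary_segment)
        have "(\<Prod>w\<in>S - {v}. smoothstep ((bary w (v + s *\<^sub>R (y - v)) - \<epsilon>) / \<epsilon>))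
            = (\<Prod>w\<in>S - {v}. smoothstep ((s * bary w y - \<epsilon>) / \<epsilon>))"
        proof (rule prod.cong[OF refl])
          fix w assume w: "w \<in> S - {v}"
          then have "bary w v = 0" using bary_vertex[of w v] v by simp
          then show "smoothstep ((bary w (v + s *\<^sub>R (y - v)) - \<epsilon>) / \<epsilon>) = smoothstep ((s * bary w y - \<epsilon>) / \<epsilon>)"
            by (simp add: bary_segment)
        qed
        then show ?case unfolding layer_def b1 by (simp add: mult_ac)
      qed
    qed
    also have "\<dots> = smoothstep' ((1 - s - \<epsilon>) / \<epsilon>) / (\<epsilon> * height v) * facet_average G v \<epsilon> s"
      unfolding facet_average_def by (rule integral_mult_right_zero)
    finally show ?thesis .
  qed
  let ?k = "\<lambda>s. height v * s ^ ?M * indicator {0..1} s * (smoothstep' ((1 - s - \<epsilon>) / \<epsilon>) / (\<epsilon> * height v) * facet_average G v \<epsilon> s)"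
  have "(\<integral>x. indicator \<tau> x * (G x / height v * layer \<epsilon> v x) \<partial>lborel) = (\<integral>s. ?k s \<partial>lborel)"
    unfolding integral_simplex_cone_iterated[OF v fm bd] inner ..
  also have "\<dots> = \<bar>- \<epsilon>\<bar> *\<^sub>R (\<integral>r. ?k ((1 - \<epsilon>) + (- \<epsilon>) * r) \<partial>lborel)"
    using \<epsilon> by (intro lborel_integral_real_affine) simp
  also have "\<dots> = (\<integral>r. \<epsilon> * ?k ((1 - \<epsilon>) + (- \<epsilon>) * r) \<partial>lborel)"
    using \<epsilon> by simp
  also have "\<dots> = (\<integral>r. (smoothstep' r * indicator {0..1} r) * ((1 - \<epsilon> * (1 + r)) ^ ?M
          * facet_average G v \<epsilon> (1 - \<epsilon> * (1 + r))) \<partial>lborel)"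
  proof (rule Bochner_Integration.integral_cong[OF refl])
    fix r :: real
    have s: "(1 - \<epsilon>) + (- \<epsilon>) * r = 1 - \<epsilon> * (1 + r)" by (simp add: algebra_simps)
    have t: "(1 - (1 - \<epsilon> * (1 + r)) - \<epsilon>) / \<epsilon> = r" using \<epsilon> by (simp add: field_simps)
    show "\<epsilon> * ?k ((1 - \<epsilon>) + (- \<epsilon>) * r) = (smoothstep' r * indicator {0..1} r) * ((1 - \<epsilon> * (1 + r)) ^ ?M
          * facet_average G v \<epsilon> (1 - \<epsilon> * (1 + r)))"
    \<comment> \<open>For r in [0, 1] the bound \<epsilon> \<le> 1/3 keeps the level s in [0, 1];
      elsewhere \<open>smoothstep'\<close> vanishes, so the two indicators may be exchanged.\<close>
    proof (cases "r \<in> {0..1}")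
      case True
      have "\<epsilon> * (1 + r) \<le> 1/3 * (1 + 1)" using True \<epsilon> by (intro mult_mono) auto
      moreover have "0 \<le> \<epsilon> * (1 + r)" using True \<epsilon> by simp
      ultimately have "1 - \<epsilon> * (1 + r) \<in> {0..1}" by simp
      then show ?thesis unfolding s t using True H \<epsilon> by (simp add: field_simps)
    next
      case False
      then have "smoothstep' r = 0" using smoothstep'_0[of r] smoothstep'_1[of r] by (cases "r \<le> 0") auto
      then show ?thesis unfolding s t by simp
    qed
  qed
  finally show ?thesis .
qed

lemma facet_average_bound:
  assumes v: "v \<in> S" and G[measurable]: "G \<in> borel_measurable borel" and C: "\<And>x. \<bar>G x\<bar> \<le> C"
  shows "\<bar>facet_average G v \<epsilon> s\<bar> \<le> C * measure (facet_measure v) UNIV"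
proof -
  interpret N: finite_measure "facet_measure v" using v by (rule finite_facet_measure)
  have C0: "0 \<le> C" using C[of 0] by linarith
  have "\<bar>facet_average G v \<epsilon> s\<bar> \<le> (\<integral>y. C \<partial>facet_measure v)"
    unfolding facet_average_def
  proof (rule integral_abs_bound_integral[THEN order_trans])
    have [measurable]: "bary w \<in> borel_measurable borel" for w
      by (intro borel_measurable_continuous_onI continuous_bary)
    have pb: "\<bar>G (v + s *\<^sub>R (y - v)) * (\<Prod>w\<in>S - {v}. smoothstep ((s * bary w y - \<epsilon>) / \<epsilon>))\<bar> \<le> C" for y
    proof -
      have "\<bar>G (v + s *\<^sub>R (y - v))\<bar> * \<bar>\<Prod>w\<in>S - {v}. smoothstep ((s * bary w y - \<epsilon>) / \<epsilon>)\<bar> \<le> C * 1"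
        using C C0 by (intro mult_mono) (simp_all add: prod_smoothstep_bounds)
      then show ?thesis by (simp add: abs_mult)
    qed
    show "integrable (facet_measure v) (\<lambda>y. G (v + s *\<^sub>R (y - v)) * (\<Prod>w\<in>S - {v}. smoothstep ((s * bary w y - \<epsilon>) / \<epsilon>)))"
    proof (rule N.integrable_const_bound[where B=C])
      show "AE y in facet_measure v. norm (G (v + s *\<^sub>R (y - v)) * (\<Prod>w\<in>S - {v}. smoothstep ((s * bary w y - \<epsilon>) / \<epsilon>))) \<le> C"
        using pb by (intro AE_I2) simp
    qed measurable
    show "\<bar>G (v + s *\<^sub>R (y - v)) * (\<Prod>w\<in>S - {v}. smoothstep ((s * bary w y - \<epsilon>) / \<epsilon>))\<bar> \<le> C" for y
      by (rule pb)
  qed simp_all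
  also have "(\<integral>y. C \<partial>facet_measure v) = C * measure (facet_measure v) UNIV" by simp
  finally show ?thesis .
qed

text \<open>The slices converge to the facet as s tends to 1. The cutoff factors converge off the
  relative boundary of the facet, a null set by \<open>AE_facet_bary_pos\<close>, and boundedness of
  g dominates.\<close>

lemma facet_average_limit:
  assumes v: "v \<in> S" and g: "continuous_on \<tau> g" and r: "0 \<le> r" "r \<le> 1"
  defines "G \<equiv> \<lambda>x. indicator \<tau> x * g x"
  shows "(\<lambda>m. facet_average G v (1 / (real m + 3)) (1 - 1 / (real m + 3) * (1 + r)))
     \<longlonglongrightarrow> (\<integral>y. G y \<partial>facet_measure v)"
  unfolding facet_average_def
proof -
  interpret N: finite_measure "facet_measure v" using v by (rule finite_facet_measure)
  obtain C where C: "\<forall>x\<in>\<tau>. \<bar>g x\<bar> \<le> C" "0 \<le> C"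
    using continuous_on_simplex_bounded[OF g] by blast
  have GC: "\<bar>G x\<bar> \<le> C" for x
    using C by (cases "x \<in> \<tau>") (simp_all add: G_def)
  have [measurable]: "G \<in> borel_measurable borel"
    using borel_measurable_continuous_on_indicator[OF borel_simplex g] by (simp add: G_def)
  have [measurable]: "bary w \<in> borel_measurable borel" for w
    by (intro borel_measurable_continuous_onI continuous_bary)
  define s where "s m = 1 - 1 / (real m + 3) * (1 + r)" for m :: nat
  \<comment> \<open>The lower bound keeps \<open>s m * bary w y\<close> away from 0 uniformly in
    m.\<close>
  have s: "1/3 \<le> s m" "s m \<le> 1" for m
  proof -
    have "1 / (real m + 3) * (1 + r) \<le> 1/3 * (1 + 1)" using r by (intro mult_mono) (auto simp: field_simps)
    then show "1/3 \<le> s m" by (simp add: s_def)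
    show "s m \<le> 1" using r by (simp add: s_def)
  qed
  have slim: "s \<longlonglongrightarrow> 1"
  proof -
    have "(\<lambda>m. 1 / (real m + 3)) \<longlonglongrightarrow> 0"
      using LIMSEQ_ignore_initial_segment[OF lim_inverse_n', of 3] by (simp add: add.commute)
    then have "(\<lambda>m. 1 - 1 / (real m + 3) * (1 + r)) \<longlonglongrightarrow> 1 - 0 * (1 + r)"
      by (intro tendsto_intros)
    then show ?thesis by (simp add: s_def[abs_def])
  qed
  show "(\<lambda>m. \<integral>y. G (v + (1 - 1 / (real m + 3) * (1 + r)) *\<^sub>R (y - v))
      * (\<Prod>w\<in>S - {v}. smoothstep (((1 - 1 / (real m + 3) * (1 + r)) * bary w y - 1 / (real m + 3)) / (1 / (real m + 3)))) \<partial>facet_measure v)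
     \<longlonglongrightarrow> (\<integral>y. G y \<partial>facet_measure v)"
    unfolding s_def[symmetric]
  proof (rule integral_dominated_convergence[where w="\<lambda>_. C"])
    show "G \<in> borel_measurable (facet_measure v)" by measurable
    show "(\<lambda>y. G (v + s m *\<^sub>R (y - v)) * (\<Prod>w\<in>S - {v}. smoothstep ((s m * bary w y - 1 / (real m + 3)) / (1 / (real m + 3)))))
       \<in> borel_measurable (facet_measure v)" for m by measurable
    show "integrable (facet_measure v) (\<lambda>_. C)" by simp
    show "AE y in facet_measure v. norm (G (v + s m *\<^sub>R (y - v)) * (\<Prod>w\<in>S - {v}. smoothstep ((s m * bary w y - 1 / (real m + 3)) / (1 / (real m + 3))))) \<le> C" for m
    proof (rule AE_I2)
      fix y
      have "\<bar>G (v + s m *\<^sub>R (y - v))\<bar> * \<bar>\<Prod>w\<in>S - {v}. smoothstep ((s m * bary w y - 1 / (real m + 3)) / (1 / (real m + 3)))\<bar> \<le> C * 1"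
        using GC C(2) by (intro mult_mono) (simp_all add: prod_smoothstep_bounds del: divide_divide_eq_right)
      then show "norm (G (v + s m *\<^sub>R (y - v)) * (\<Prod>w\<in>S - {v}. smoothstep ((s m * bary w y - 1 / (real m + 3)) / (1 / (real m + 3))))) \<le> C"
        by (simp only: real_norm_def abs_mult mult_1_right)
    qed
    show "AE y in facet_measure v. (\<lambda>m. G (v + s m *\<^sub>R (y - v)) * (\<Prod>w\<in>S - {v}. smoothstep ((s m * bary w y - 1 / (real m + 3)) / (1 / (real m + 3)))))
        \<longlonglongrightarrow> G y"
      using AE_facet_measure[of v] AE_facet_bary_pos[OF v]
    proof eventually_elim
      case (elim y)
      have y: "y \<in> \<tau>" using F_subset elim(1) by (rule subsetD)
      have vt: "v \<in> \<tau>" using v by (rule hull_inc)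
      have in_t: "v + s m *\<^sub>R (y - v) \<in> \<tau>" for m
      proof -
        have "(1 - s m) *\<^sub>R v + s m *\<^sub>R y \<in> \<tau>"
          using convex_convex_hull vt y s[of m] by (intro convexD) auto
        then show ?thesis by (simp add: algebra_simps)
      qed
      have "(\<lambda>m. v + s m *\<^sub>R (y - v)) \<longlonglongrightarrow> v + 1 *\<^sub>R (y - v)"
        by (intro tendsto_intros slim)
      then have "(\<lambda>m. v + s m *\<^sub>R (y - v)) \<longlonglongrightarrow> y" by simp
      then have "(\<lambda>m. g (v + s m *\<^sub>R (y - v))) \<longlonglongrightarrow> g y"
        by (rule continuous_on_tendsto_compose[OF g]) (use y in_t in simp_all)
      then have 1: "(\<lambda>m. G (v + s m *\<^sub>R (y - v))) \<longlonglongrightarrow> G y"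
        using in_t y by (simp add: G_def)
      have "(\<lambda>m. \<Prod>w\<in>S - {v}. smoothstep ((s m * bary w y - 1 / (real m + 3)) / (1 / (real m + 3)))) \<longlonglongrightarrow> (\<Prod>w\<in>S - {v}. 1)"
      proof (rule tendsto_prod)
        fix w assume w: "w \<in> S - {v}"
        then have pos: "0 < bary w y" using elim(2) by simp
        show "(\<lambda>m. smoothstep ((s m * bary w y - 1 / (real m + 3)) / (1 / (real m + 3)))) \<longlonglongrightarrow> 1"
        proof (rule smoothstep_tends_1)
          show "0 < 1/3 * bary w y" using pos by simp
          show "1/3 * bary w y \<le> s m * bary w y" for m using s(1)[of m] pos by (intro mult_right_mono) auto
        qed
      qed
      from tendsto_mult[OF 1 this] show ?case by simp
    qed
  qed
qed

text \<open>In the rescaled variable r the layer has the fixed profile \<open>smoothstep'\<close> of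
  mass 1, so what remains in the limit is the facet integral itself.\<close>

lemma layer_integral_limit:
  assumes v: "v \<in> S" and g: "continuous_on \<tau> g"
  shows "(\<lambda>m. \<integral>x. indicator \<tau> x * (g x / height v * layer (1 / (real m + 3)) v x) \<partial>lborel)
     \<longlonglongrightarrow> (\<integral>y. indicator (F v) y * g y \<partial>facet_measure v)"
proof -
  interpret N: finite_measure "facet_measure v" using v by (rule finite_facet_measure)
  define G where "G x = indicator \<tau> x * g x" for x
  obtain C where C: "\<forall>x\<in>\<tau>. \<bar>g x\<bar> \<le> C" "0 \<le> C"
    using continuous_on_simplex_bounded[OF g] by blast
  have GC: "\<bar>G x\<bar> \<le> C" for x
    using C by (cases "x \<in> \<tau>") (simp_all add: G_def)
  have G[measurable]: "G \<in> borel_measurable borel"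
    using borel_measurable_continuous_on_indicator[OF borel_simplex g] by (simp add: G_def[abs_def])
  have [measurable]: "bary w \<in> borel_measurable borel" for w
    by (intro borel_measurable_continuous_onI continuous_bary)
  let ?M = "CARD('n) - 1" and ?e = "\<lambda>m::nat. 1 / (real m + 3)"
  let ?I = "\<integral>y. G y \<partial>facet_measure v"
  have e: "0 < ?e m" "?e m \<le> 1/3" for m by (auto simp: field_simps)
  have eq: "(\<integral>x. indicator \<tau> x * (g x / height v * layer (?e m) v x) \<partial>lborel)
     = (\<integral>r. (smoothstep' r * indicator {0..1} r) * ((1 - ?e m * (1 + r)) ^ ?M
          * facet_average G v (?e m) (1 - ?e m * (1 + r))) \<partial>lborel)" for m
  proof -
    have "(\<integral>x. indicator \<tau> x * (g x / height v * layer (?e m) v x) \<partial>lborel)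
      = (\<integral>x. indicator \<tau> x * (G x / height v * layer (?e m) v x) \<partial>lborel)"
      by (rule Bochner_Integration.integral_cong[OF refl]) (simp add: G_def indicator_def)
    then show ?thesis unfolding layer_integral[OF v G GC e] .
  qed
  have lim: "(\<lambda>m. \<integral>r. (smoothstep' r * indicator {0..1} r) * ((1 - ?e m * (1 + r)) ^ ?M
          * facet_average G v (?e m) (1 - ?e m * (1 + r))) \<partial>lborel)
     \<longlonglongrightarrow> (\<integral>r. (smoothstep' r * indicator {0..1} r) * ?I \<partial>lborel)"
  proof (rule integral_dominated_convergence[where w="\<lambda>r. (smoothstep' r * indicator {0..1} r) * (C * measure (facet_measure v) UNIV)"])
    show "(\<lambda>r. (smoothstep' r * indicator {0..1} r) * ?I) \<in> borel_measurable lborel" by measurable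
    show "(\<lambda>r. (smoothstep' r * indicator {0..1} r) * ((1 - ?e m * (1 + r)) ^ ?M
          * facet_average G v (?e m) (1 - ?e m * (1 + r)))) \<in> borel_measurable lborel" for m
      unfolding facet_average_def by measurable
    show "integrable lborel (\<lambda>r. (smoothstep' r * indicator {0..1} r) * (C * measure (facet_measure v) UNIV))"
      by (intro integrable_mult_left integral_smoothstep'(1))
    show "AE r in lborel. norm ((smoothstep' r * indicator {0..1} r) * ((1 - ?e m * (1 + r)) ^ ?M
          * facet_average G v (?e m) (1 - ?e m * (1 + r)))) \<le> (smoothstep' r * indicator {0..1} r) * (C * measure (facet_measure v) UNIV)" for m
    proof (rule AE_I2)
      fix r :: real
      show "norm ((smoothstep' r * indicator {0..1} r) * ((1 - ?e m * (1 + r)) ^ ?M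
          * facet_average G v (?e m) (1 - ?e m * (1 + r)))) \<le> (smoothstep' r * indicator {0..1} r) * (C * measure (facet_measure v) UNIV)"
      proof (cases "r \<in> {0..1}")
        case True
        have "?e m * (1 + r) \<le> 1/3 * (1 + 1)" using True e[of m] by (intro mult_mono) auto
        moreover have "0 \<le> ?e m * (1 + r)" using True by simp
        moreover have "0 \<le> 1 - q \<and> 1 - q \<le> 1" if "q \<le> 1/3 * (1 + 1)" "0 \<le> q" for q :: real
          using that by auto
        ultimately have q: "0 \<le> 1 - ?e m * (1 + r)" "1 - ?e m * (1 + r) \<le> 1" by blast+
        have "\<bar>(1 - ?e m * (1 + r)) ^ ?M\<bar> * \<bar>facet_average G v (?e m) (1 - ?e m * (1 + r))\<bar> \<le> 1 * (C * measure (facet_measure v) UNIV)"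
          using q by (intro mult_mono facet_average_bound[OF v G GC]) (auto intro: power_le_one)
        then have "smoothstep' r * (\<bar>(1 - ?e m * (1 + r)) ^ ?M\<bar> * \<bar>facet_average G v (?e m) (1 - ?e m * (1 + r))\<bar>)
            \<le> smoothstep' r * (1 * (C * measure (facet_measure v) UNIV))"
          using smoothstep'_bounds(1) by (rule mult_left_mono)
        moreover have "\<bar>smoothstep' r\<bar> = smoothstep' r" using smoothstep'_bounds(1)[of r] by simp
        ultimately show ?thesis using True by (simp only: real_norm_def abs_mult indicator_simps mult_1 mult_1_right abs_one)
      qed simp
    qed
    show "AE r in lborel. (\<lambda>m. (smoothstep' r * indicator {0..1} r) * ((1 - ?e m * (1 + r)) ^ ?M
          * facet_average G v (?e m) (1 - ?e m * (1 + r)))) \<longlonglongrightarrow> (smoothstep' r * indicator {0..1} r) * ?I"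
    proof (rule AE_I2)
      fix r :: real
      show "(\<lambda>m. (smoothstep' r * indicator {0..1} r) * ((1 - ?e m * (1 + r)) ^ ?M
          * facet_average G v (?e m) (1 - ?e m * (1 + r)))) \<longlonglongrightarrow> (smoothstep' r * indicator {0..1} r) * ?I"
      proof (cases "r \<in> {0..1}")
        case True
        have "(\<lambda>m. ?e m) \<longlonglongrightarrow> 0"
          using LIMSEQ_ignore_initial_segment[OF lim_inverse_n', of 3] by (simp add: add.commute)
        then have "(\<lambda>m. (1 - ?e m * (1 + r)) ^ ?M) \<longlonglongrightarrow> (1 - 0 * (1 + r)) ^ ?M"
          by (intro tendsto_intros)
        moreover have "(\<lambda>m. facet_average G v (?e m) (1 - ?e m * (1 + r))) \<longlonglongrightarrow> ?I"
          unfolding G_def[abs_def] using True by (intro facet_average_limit[OF v g]) auto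
        ultimately have "(\<lambda>m. (1 - ?e m * (1 + r)) ^ ?M * facet_average G v (?e m) (1 - ?e m * (1 + r))) \<longlonglongrightarrow> (1 - 0 * (1 + r)) ^ ?M * ?I"
          by (rule tendsto_mult)
        then show ?thesis by (intro tendsto_mult_left) simp
      qed simp
    qed
  qed
  have "(\<integral>r. (smoothstep' r * indicator {0..1} r) * ?I \<partial>lborel) = ?I"
    using integral_smoothstep'(2) by simp
  also have "?I = (\<integral>y. indicator (F v) y * g y \<partial>facet_measure v)"
  proof (rule integral_cong_AE)
    show "G \<in> borel_measurable (facet_measure v)" by measurable
    have "continuous_on (F v) g" using g F_subset by (rule continuous_on_subset)
    then show "(\<lambda>y. indicator (F v) y * g y) \<in> borel_measurable (facet_measure v)"
      using borel_measurable_continuous_on_indicator[OF borel_F, of v g] by simp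
    show "AE y in facet_measure v. G y = indicator (F v) y * g y"
      using AE_facet_measure[of v]
    proof eventually_elim
      case (elim y)
      then have "y \<in> \<tau>" using F_subset by (rule subsetD[rotated])
      then show ?case using elim by (simp add: G_def)
    qed
  qed
  finally show ?thesis using lim unfolding eq by (simp only:)
qed

text \<open>Gauss' theorem for the field \<phi> \<open>B\<close>, with weakly divergence-free
  \<open>B\<close>: both sides of \<open>tested_on_simplex\<close> are passed to the limit of
  vanishing cutoff width.\<close>

lemma divergence_simplex:
  fixes \<beta> B :: "real^'n \<Rightarrow> real^'n"
  assumes \<Omega>: "open \<Omega>" "interior \<tau> \<subseteq> \<Omega>" and df: "divergence_free \<Omega> \<beta>"
    and B: "continuous_on \<tau> B" "\<And>x. x \<in> interior \<tau> \<Longrightarrow> B x = \<beta> x" and \<phi>: "C1_fun \<phi>"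
  shows "(\<integral>x. indicator \<tau> x * frechet_derivative \<phi> (at x) (B x) \<partial>lborel)
     = (\<Sum>v\<in>S. (\<integral>y. indicator (F v) y * (\<phi> y * (B y \<bullet> nrm v)) \<partial>facet_measure v))"
proof -
  have "continuous_on \<tau> (\<lambda>x. \<Sum>j\<in>UNIV. (B x $ j) *\<^sub>R frechet_derivative \<phi> (at x) (axis j 1))"
    by (intro continuous_intros B(1) C1_fun_continuous_deriv[OF \<phi>])
  moreover have "(\<Sum>j\<in>UNIV. (B x $ j) *\<^sub>R frechet_derivative \<phi> (at x) (axis j 1)) = frechet_derivative \<phi> (at x) (B x)" for x
    using has_derivative_linear[OF C1_fun_deriv[OF \<phi>]] by (rule linear_expand_axis[symmetric])
  ultimately have cf: "continuous_on \<tau> (\<lambda>x. frechet_derivative \<phi> (at x) (B x))" by simp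
  have cg: "continuous_on \<tau> (\<lambda>x. \<phi> x * (B x \<bullet> nrm v))" for v
    by (intro continuous_intros C1_fun_continuous[OF \<phi>] B(1))
  have eq: "(\<integral>x. indicator \<tau> x * (frechet_derivative \<phi> (at x) (B x) * cutoff (1 / (real m + 3)) x) \<partial>lborel)
     = (\<Sum>v\<in>S. (\<integral>x. indicator \<tau> x * (\<phi> x * (B x \<bullet> nrm v) / height v * layer (1 / (real m + 3)) v x) \<partial>lborel))" for m
    by (rule tested_on_simplex[OF \<Omega> df B \<phi>]) auto
  have "(\<lambda>m. \<Sum>v\<in>S. (\<integral>x. indicator \<tau> x * (\<phi> x * (B x \<bullet> nrm v) / height v * layer (1 / (real m + 3)) v x) \<partial>lborel))
     \<longlonglongrightarrow> (\<Sum>v\<in>S. (\<integral>y. indicator (F v) y * (\<phi> y * (B y \<bullet> nrm v)) \<partial>facet_measure v))"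
    by (intro tendsto_sum layer_integral_limit cg)
  moreover have "(\<lambda>m. \<Sum>v\<in>S. (\<integral>x. indicator \<tau> x * (\<phi> x * (B x \<bullet> nrm v) / height v * layer (1 / (real m + 3)) v x) \<partial>lborel))
     \<longlonglongrightarrow> (\<integral>x. indicator \<tau> x * frechet_derivative \<phi> (at x) (B x) \<partial>lborel)"
    using cutoff_integral_limit[OF cf] unfolding eq .
  ultimately show ?thesis by (intro LIMSEQ_unique)
qed

end

section \<open>Traces and neighbouring simplices\<close>

lemma continuous_eq_on_closure:
  fixes f g :: "'a::metric_space \<Rightarrow> 'b::metric_space"
  assumes "continuous_on (closure A) f" "continuous_on (closure A) g" "\<And>x. x \<in> A \<Longrightarrow> f x = g x"
    and x: "x \<in> closure A"
  shows "f x = g x"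
proof -
  obtain s where s: "\<And>n. s n \<in> A" "s \<longlonglongrightarrow> x" using x closure_sequential by blast
  have sc: "\<forall>n. s n \<in> closure A" using s(1) closure_subset by blast
  have "(\<lambda>n. f (s n)) \<longlonglongrightarrow> f x"
    by (rule continuous_on_tendsto_compose[OF assms(1) s(2) x]) (use sc in simp)
  moreover have "(\<lambda>n. g (s n)) \<longlonglongrightarrow> g x"
    by (rule continuous_on_tendsto_compose[OF assms(2) s(2) x]) (use sc in simp)
  moreover have "(\<lambda>n. f (s n)) = (\<lambda>n. g (s n))" using s(1) assms(3) by auto
  ultimately show ?thesis using LIMSEQ_unique by metis
qed

text \<open>Each point of the simplex is a limit point of the interior, so the limit that defines
  the trace is unique and is the value of the continuous extension.\<close>

lemma trace_from_eq:
  fixes f g :: "real^'n \<Rightarrow> 'b::t2_space"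
  assumes cl: "closure (interior \<tau>) = \<tau>" and g: "continuous_on \<tau> g"
    and eq: "\<And>y. y \<in> interior \<tau> \<Longrightarrow> f y = g y" and x: "x \<in> \<tau>"
  shows "trace_from \<tau> f x = g x"
  unfolding trace_from_def
proof (rule tendsto_Lim)
  have "x islimpt interior \<tau>"
  proof (cases "x \<in> interior \<tau>")
    case True
    then show ?thesis by (intro interior_limit_point) simp
  next
    case False
    then show ?thesis using x cl by (auto simp: closure_def)
  qed
  then show "\<not> trivial_limit (at x within interior \<tau>)" by (simp add: trivial_limit_within)
  have "(g \<longlongrightarrow> g x) (at x within \<tau>)" using g x by (simp add: continuous_on_def)
  then have "(g \<longlongrightarrow> g x) (at x within interior \<tau>)"
    using interior_subset by (rule tendsto_within_subset)
  moreover have "eventually (\<lambda>y. f y = g y) (at x within interior \<tau>)"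
    using eq by (auto simp: eventually_at_filter)
  ultimately show "(f \<longlongrightarrow> g x) (at x within interior \<tau>)"
    by (simp cong: tendsto_cong)
qed

section \<open>Local geometry at a facet\<close>

context full_simplex begin

text \<open>A segment from the vertex w to a relative interior point y can be prolonged beyond y
  within the facet. Along it \<open>bary w\<close> is affine, 1 at w and still nonnegative beyond y,
  hence positive at y.\<close>

lemma rel_interior_facet_bary_pos:
  assumes v: "v \<in> S" and y: "y \<in> rel_interior (F v)" and w: "w \<in> S - {v}"
  shows "0 < bary w y"
proof -
  have "w \<in> affine hull (F v)" using w by (intro hull_inc) auto
  then obtain e where e: "e > 1" "(1 - e) *\<^sub>R w + e *\<^sub>R y \<in> F v"
    using convex_rel_interior_if2[OF convex_convex_hull y] by blast
  have "(1 - e) *\<^sub>R w + e *\<^sub>R y = w + e *\<^sub>R (y - w)" by (simp add: algebra_simps)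
  then have "w + e *\<^sub>R (y - w) \<in> \<tau>" using e(2) F_subset by auto
  then have "0 \<le> bary w (w + e *\<^sub>R (y - w))" using w by (simp add: mem_simplex_iff)
  then have "0 \<le> (1 - e) + e * bary w y" using bary_vertex[of w w] w by (simp add: bary_segment)
  then have "0 < e * bary w y" using e(1) by linarith
  then show ?thesis using e(1) by (simp add: zero_less_mult_iff)
qed

text \<open>Near a relative interior point of the facet all other barycentric coordinates stay
  positive, so the half-space condition of the facet itself decides.\<close>

lemma facet_neighbourhood:
  assumes v: "v \<in> S" and y: "y \<in> rel_interior (F v)"
  obtains e where "e > 0" "\<And>z. z \<in> ball y e \<Longrightarrow> (z - y) \<bullet> nrm v \<le> 0 \<Longrightarrow> z \<in> \<tau>"
    "\<And>z. z \<in> ball y e \<Longrightarrow> (z - y) \<bullet> nrm v < 0 \<Longrightarrow> z \<in> interior \<tau>"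
proof -
  let ?W = "{z. \<forall>w\<in>S - {v}. 0 < bary w z}"
  have "?W = (\<Inter>w\<in>S - {v}. {z. 0 < bary w z})" by auto
  moreover have "open {z. 0 < bary w z}" for w by (intro open_Collect_less continuous_intros)
  ultimately have "open ?W" by (simp add: open_INT)
  moreover have "y \<in> ?W" using rel_interior_facet_bary_pos[OF v y] by simp
  ultimately obtain e where e: "e > 0" "ball y e \<subseteq> ?W" by (meson open_contains_ball)
  have H: "0 < height v" using v by (rule height_pos)
  have "y \<in> F v" using y rel_interior_subset by blast
  then have by0: "bary v y = 0" by (rule bary_F[OF v])
  have bz: "bary v z = - ((z - y) \<bullet> nrm v) / height v" for z
    using bary_diff[of v z y] by0 by simp
  show ?thesis
  proof (rule that[OF e(1)])
    fix z assume z: "z \<in> ball y e" "(z - y) \<bullet> nrm v \<le> 0"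
    show "z \<in> \<tau>" unfolding mem_simplex_iff
    proof
      fix w assume w: "w \<in> S"
      show "0 \<le> bary w z"
      proof (cases "w = v")
        case True then show ?thesis unfolding True bz using z(2) H by (intro divide_nonneg_pos) auto
      next
        case False then have "0 < bary w z" using e(2) z(1) w by blast
        then show ?thesis by simp
      qed
    qed
  next
    fix z assume z: "z \<in> ball y e" "(z - y) \<bullet> nrm v < 0"
    show "z \<in> interior \<tau>" unfolding interior_simplex
    proof (intro CollectI ballI)
      fix w assume w: "w \<in> S"
      show "0 < bary w z"
      proof (cases "w = v")
        case True then show ?thesis unfolding True bz using z(2) H by (intro divide_pos_pos) auto
      next
        case False then show ?thesis using e(2) z(1) w by blast
      qed
    qed
  qed
qed

lemma facet_iff: "G facet_of \<tau> \<longleftrightarrow> (\<exists>v\<in>S. G = F v)"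
  using facet_of_convex_hull_affine_independent[OF indep, of G] F_nonempty by blast

lemma inj_F: "inj_on F S"
proof (rule inj_onI)
  fix u v assume u: "u \<in> S" and v: "v \<in> S" and eq: "F u = F v"
  show "u = v"
  proof (rule ccontr)
    assume "u \<noteq> v"
    then have "u \<in> F v" using u by (intro in_F)
    then have "u \<in> F u" using eq by simp
    then show False using bary_F[OF u] bary_vertex[OF u u] by simp
  qed
qed

lemma sum_facets: "(\<Sum>G | G facet_of \<tau>. g G) = (\<Sum>v\<in>S. g (F v))"
proof -
  have "{G. G facet_of \<tau>} = F ` S" unfolding facet_iff by auto
  then show ?thesis using inj_F by (simp add: sum.reindex)
qed

lemma facet_set_integral:
  fixes f :: "real^'n \<Rightarrow> 'b::{banach, second_countable_topology}"
  assumes v: "v \<in> S" and f: "continuous_on (F v) f"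
  shows "set_integrable (face_measure (F v)) (F v) f"
    and "(LINT x:F v|face_measure (F v). f x) = (\<integral>x. indicator (F v) x *\<^sub>R f x \<partial>facet_measure v)"
proof -
  let ?g = "\<lambda>x. indicator (F v) x *\<^sub>R f x"
  have g: "?g \<in> borel_measurable (face_measure (F v))"
    using borel_measurable_continuous_on_indicator[OF borel_F f] sets_face_measure[of "F v"]
    by (simp cong: measurable_cong_sets)
  have i: "(\<lambda>x. indicator (F v) x :: real) \<in> borel_measurable (face_measure (F v))"
    using sets_face_measure[of "F v"] by (simp cong: measurable_cong_sets)
  have fm: "facet_measure v = density (face_measure (F v)) (\<lambda>x. ennreal (indicator (F v) x))"
    unfolding facet_measure_def by (simp add: ennreal_indicator)
  have idem: "(\<lambda>x. indicator (F v) x *\<^sub>R ?g x) = ?g" by (auto simp: indicator_def)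
  have "integrable (face_measure (F v)) (\<lambda>x. indicator (F v) x *\<^sub>R ?g x)"
    using integrable_facet_measure[OF v f] unfolding fm by (subst (asm) integrable_density[OF g i]) auto
  then show "set_integrable (face_measure (F v)) (F v) f"
    unfolding idem by (simp add: set_integrable_def)
  have "(\<integral>x. ?g x \<partial>facet_measure v) = (\<integral>x. indicator (F v) x *\<^sub>R ?g x \<partial>face_measure (F v))"
    unfolding fm by (rule integral_density[OF g i]) simp
  then show "(LINT x:F v|face_measure (F v). f x) = (\<integral>x. ?g x \<partial>facet_measure v)"
    unfolding idem by (simp add: set_lebesgue_integral_def)
qed

text \<open>A discrete function is prescribed only inside the simplex. The boundary is a null set,
  and the continuous representative allows the passage from \<open>lebesgue\<close> to
  \<open>lborel\<close>.\<close>

lemma simplex_set_integral: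
  fixes f g :: "real^'n \<Rightarrow> 'b::euclidean_space"
  assumes g: "continuous_on \<tau> g" and eq: "\<And>x. x \<in> interior \<tau> \<Longrightarrow> f x = g x"
  shows "set_integrable lebesgue \<tau> f"
    and "(LINT x:\<tau>|lebesgue. f x) = (\<integral>x. indicator \<tau> x *\<^sub>R g x \<partial>lborel)"
proof -
  let ?f = "\<lambda>x. indicator \<tau> x *\<^sub>R f x" and ?g = "\<lambda>x. indicator \<tau> x *\<^sub>R g x"
  have gb: "?g \<in> borel_measurable borel" by (rule borel_measurable_continuous_on_indicator[OF borel_simplex g])
  have gi: "integrable lborel ?g" by (rule integrable_simplex[OF g])
  have gl: "integrable lebesgue ?g" using gb gi by (simp add: integrable_completion)
  have ae: "AE x in lebesgue. ?g x = ?f x"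
  proof -
    have "AE x in lebesgue. x \<in> \<tau> \<longrightarrow> x \<in> interior \<tau>" using AE_interior by (rule AE_completion)
    then show ?thesis
    proof eventually_elim
      case (elim x)
      then show ?case using eq[of x] by (cases "x \<in> \<tau>") simp_all
    qed
  qed
  have fm: "?f \<in> borel_measurable lebesgue"
    using borel_measurable_integrable[OF gl] ae by (rule borel_measurable_AE)
  show "set_integrable lebesgue \<tau> f"
    unfolding set_integrable_def
    by (rule integrable_cong_AE_imp[OF gl fm ae])
  have "(LINT x:\<tau>|lebesgue. f x) = (\<integral>x. ?g x \<partial>lebesgue)"
    unfolding set_lebesgue_integral_def
  proof (rule integral_cong_AE[OF fm borel_measurable_integrable[OF gl]])
    show "AE x in lebesgue. ?f x = ?g x" using ae by eventually_elim (rule sym)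
  qed
  also have "\<dots> = (\<integral>x. ?g x \<partial>lborel)" using gb by (intro integral_completion) simp
  finally show "(LINT x:\<tau>|lebesgue. f x) = (\<integral>x. ?g x \<partial>lborel)" .
qed

end

text \<open>The two normals agree up to sign. Equal normals would put both simplices on the same
  side of the facet, so that their interiors meet; opposite ones give two half-balls that together
  fill a neighbourhood of each relative interior point.\<close>

lemma adjacent_simplices:
  assumes S: "full_simplex S" and S': "full_simplex S'" and v: "v \<in> S" and v': "v' \<in> S'"
    and same: "convex hull (S' - {v'}) = convex hull (S - {v})"
    and ne: "convex hull S \<noteq> convex hull S'"
    and face: "convex hull S \<inter> convex hull S' face_of convex hull S" "convex hull S \<inter> convex hull S' face_of convex hull S'"
  shows "outer_normal (convex hull S') (convex hull (S - {v})) = - outer_normal (convex hull S) (convex hull (S - {v}))"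
    and "rel_interior (convex hull (S - {v})) \<subseteq> interior (convex hull S \<union> convex hull S')"
proof -
  interpret A: full_simplex S by fact
  interpret B: full_simplex S' by fact
  let ?n = "outer_normal (convex hull S) (convex hull (S - {v}))"
  let ?n' = "outer_normal (convex hull S') (convex hull (S - {v}))"
  have n': "?n' = ?n \<or> ?n' = - ?n"
  proof (rule A.unit_normal_unique[OF v _ _ A.norm_nrm[OF v] A.facet_flat[OF v]])
    show "norm ?n' = 1" using B.norm_nrm[OF v'] same by simp
    show "(y - x) \<bullet> ?n' = 0" if "x \<in> A.F v" "y \<in> A.F v" for x y
      using B.facet_flat[OF v', unfolded same, OF that] .
  qed
  have nA: "?n \<bullet> ?n = 1" using A.norm_nrm[OF v] by (simp add: norm_eq_1)
  \<comment> \<open>A face that meets the interior of a convex set is the whole set, so overlapping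
    interiors would make the two simplices equal.\<close>
  have disj: "interior (convex hull S) \<inter> interior (convex hull S') = {}"
  proof (rule ccontr)
    assume "interior (convex hull S) \<inter> interior (convex hull S') \<noteq> {}"
    then obtain z where z: "z \<in> interior (convex hull S)" "z \<in> interior (convex hull S')" by blast
    then have "z \<in> convex hull S" "z \<in> convex hull S'" using interior_subset by blast+
    then have "convex hull S \<inter> convex hull S' = convex hull S" "convex hull S \<inter> convex hull S' = convex hull S'"
      using face_of_disjoint_interior[OF face(1)] face_of_disjoint_interior[OF face(2)] z by blast+
    then show False using ne by simp
  qed
  show opp: "?n' = - ?n"
  proof (rule ccontr)
    assume "?n' \<noteq> - ?n"
    then have eq: "?n' = ?n" using n' by simp
    have "rel_interior (A.F v) \<noteq> {}" using A.F_nonempty[OF v] rel_interior_eq_empty[OF convex_convex_hull] by blast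
    then obtain y where y: "y \<in> rel_interior (A.F v)" by blast
    then have y': "y \<in> rel_interior (B.F v')" using same by simp
    show False
    proof (rule A.facet_neighbourhood[OF v y], rule B.facet_neighbourhood[OF v' y'])
      fix e e' assume e: "e > 0" and e': "e' > 0"
        and 1: "\<And>z. z \<in> ball y e \<Longrightarrow> (z - y) \<bullet> ?n < 0 \<Longrightarrow> z \<in> interior (convex hull S)"
        and 2: "\<And>z. z \<in> ball y e' \<Longrightarrow> (z - y) \<bullet> B.nrm v' < 0 \<Longrightarrow> z \<in> interior (convex hull S')"
      define d where "d = min e e' / 2"
      have d: "0 < d" "d < e" "d < e'" using e e' by (auto simp: d_def)
      \<comment> \<open>A point slightly inwards from y, and inwards for both simplices when the
        normals agree.\<close>
      let ?z = "y - d *\<^sub>R ?n"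
      have dist: "dist y ?z = d" using A.norm_nrm[OF v] d by (simp add: dist_norm)
      have in1: "?z \<in> interior (convex hull S)"
        by (rule 1) (use dist d nA in \<open>simp_all\<close>)
      have in2: "?z \<in> interior (convex hull S')"
        by (rule 2) (use dist d nA eq same in \<open>simp_all\<close>)
      show False using in1 in2 disj by blast
    qed
  qed
  show "rel_interior (convex hull (S - {v})) \<subseteq> interior (convex hull S \<union> convex hull S')"
  proof
    fix y assume y: "y \<in> rel_interior (convex hull (S - {v}))"
    then have y': "y \<in> rel_interior (B.F v')" using same by simp
    show "y \<in> interior (convex hull S \<union> convex hull S')"
    proof (rule A.facet_neighbourhood[OF v y], rule B.facet_neighbourhood[OF v' y'])
      fix e e' assume e: "e > 0" and e': "e' > 0"
        and 1: "\<And>z. z \<in> ball y e \<Longrightarrow> (z - y) \<bullet> ?n \<le> 0 \<Longrightarrow> z \<in> convex hull S"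
        and 2: "\<And>z. z \<in> ball y e' \<Longrightarrow> (z - y) \<bullet> B.nrm v' \<le> 0 \<Longrightarrow> z \<in> convex hull S'"
      have "z \<in> convex hull S \<union> convex hull S'" if z: "z \<in> ball y (min e e')" for z
      proof (cases "(z - y) \<bullet> ?n \<le> 0")
        case True
        then have "z \<in> convex hull S" using z by (intro 1) auto
        then show ?thesis ..
      next
        case False
        have "(z - y) \<bullet> B.nrm v' \<le> 0" using False opp same by simp
        then have "z \<in> convex hull S'" using z by (intro 2) auto
        then show ?thesis ..
      qed
      then have "ball y (min e e') \<subseteq> convex hull S \<union> convex hull S'" by blast
      moreover have "y \<in> ball y (min e e')" using e e' by simp
      ultimately show "y \<in> interior (convex hull S \<union> convex hull S')"
        using open_ball interior_maximal by blast
    qed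
  qed
qed

section \<open>Coercivity\<close>

text \<open>Taking real parts leads to the Euclidean inner product of the underlying real space,
  where Cauchy-Schwarz and symmetry are at hand.\<close>

lemma Re_cdot: "Re (cdot a b) = a \<bullet> b"
  by (simp add: cdot_def inner_vec_def inner_complex_def)

lemma Re_cddot: "Re (cddot A B) = A \<bullet> B"
  by (simp add: cddot_def inner_vec_def inner_complex_def)

lemma continuous_on_cdot[continuous_intros]:
  "continuous_on A f \<Longrightarrow> continuous_on A g \<Longrightarrow> continuous_on A (\<lambda>x. cdot (f x) (g x))"
  unfolding cdot_def by (intro continuous_intros)

lemma continuous_on_cddot[continuous_intros]:
  "continuous_on A f \<Longrightarrow> continuous_on A g \<Longrightarrow> continuous_on A (\<lambda>x. cddot (f x) (g x))"
  unfolding cddot_def by (intro continuous_intros)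

lemma continuous_on_outer[continuous_intros]:
  "continuous_on A f \<Longrightarrow> continuous_on A g \<Longrightarrow> continuous_on A (\<lambda>x. f x \<otimes>\<^sub>t g x)"
  unfolding outer_def by (intro continuous_intros continuous_on_vec_lambda)

lemma continuous_on_cvec[continuous_intros]:
  "continuous_on A f \<Longrightarrow> continuous_on A (\<lambda>x. cvec (f x))"
  unfolding cvec_def by (intro continuous_intros continuous_on_vec_lambda)

lemma continuous_on_matrix_vector[continuous_intros]:
  fixes f :: "'a::topological_space \<Rightarrow> complex^'n^'m"
  shows "continuous_on A f \<Longrightarrow> continuous_on A g \<Longrightarrow> continuous_on A (\<lambda>x. f x *v g x)"
  unfolding matrix_vector_mult_def by (intro continuous_intros continuous_on_vec_lambda)

lemma outer_mult_cvec: "(w \<otimes>\<^sub>t cvec b) *v cvec n = (b \<bullet> n) *\<^sub>R w"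
proof -
  have "((w \<otimes>\<^sub>t cvec b) *v cvec n) $ i = ((b \<bullet> n) *\<^sub>R w) $ i" for i
  proof -
    have "((w \<otimes>\<^sub>t cvec b) *v cvec n) $ i = (\<Sum>j\<in>UNIV. w $ i * complex_of_real (b $ j * n $ j))"
      by (simp add: matrix_vector_mult_def outer_def cvec_def mult.assoc)
    also have "\<dots> = w $ i * complex_of_real (b \<bullet> n)"
      by (simp add: sum_distrib_left inner_vec_def)
    finally show ?thesis by (simp add: scaleR_conv_of_real[where 'a=complex] mult.commute)
  qed
  then show ?thesis by (simp add: vec_eq_iff)
qed

lemma Re_set_integral:
  assumes "set_integrable M A f"
  shows "Re (LINT x:A|M. f x) = (LINT x:A|M. Re (f x))"
  using assms unfolding set_integrable_def set_lebesgue_integral_def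
  by (subst integral_Re[symmetric]) simp_all

lemma C1_fun_vec:
  fixes f :: "real^'n \<Rightarrow> complex^'m"
  assumes "\<And>i. C1_fun (\<lambda>x. f x $ i)"
  shows "C1_fun f"
proof -
  have "linear (\<lambda>z::complex. axis i z :: complex^'m)" for i
    by (rule linearI) (simp_all add: vec_eq_iff axis_def)
  then have bl: "bounded_linear (\<lambda>z::complex. axis i z :: complex^'m)" for i
    by (simp add: linear_conv_bounded_linear)
  have "C1_fun (\<lambda>x. \<Sum>i\<in>UNIV. axis i (f x $ i) :: complex^'m)"
    by (intro C1_fun_sum C1_fun_compose_linear[OF assms bl])
  moreover have "(\<Sum>i\<in>UNIV. axis i (f x $ i)) = f x" for x
    by (simp add: vec_eq_iff axis_def if_distrib cong: if_cong)
  ultimately show ?thesis by simp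
qed

lemma grad_mult_cvec:
  assumes "C1_fun f"
  shows "grad f x *v cvec b = frechet_derivative f (at x) b"
proof -
  let ?D = "frechet_derivative f (at x)"
  have "(grad f x *v cvec b) $ i = ?D b $ i" for i
  proof -
    have "?D b = (\<Sum>j\<in>UNIV. (b $ j) *\<^sub>R ?D (axis j 1))"
      by (rule linear_expand_axis[OF has_derivative_linear[OF C1_fun_deriv[OF assms]]])
    then have "?D b $ i = (\<Sum>j\<in>UNIV. (b $ j) *\<^sub>R (?D (axis j 1) $ i))" by simp
    then show ?thesis
      by (simp add: matrix_vector_mult_def grad_def partial_deriv_def cvec_def scaleR_conv_of_real mult.commute)
  qed
  then show ?thesis by (simp add: vec_eq_iff)
qed

lemma continuous_on_grad: "C1_fun f \<Longrightarrow> continuous_on A (grad f)"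
  unfolding grad_def[abs_def] partial_deriv_def
  by (intro continuous_on_vec_lambda continuous_intros C1_fun_continuous_deriv)

lemma grad_annihilated:
  assumes "difference_annihilated a K f" "C1_fun f"
  shows "difference_annihilated a K (grad f)"
  unfolding difference_annihilated_def
proof (intro allI)
  fix x w
  have "(\<Sum>m\<le>K. a m *\<^sub>R frechet_derivative f (at (x + real m *\<^sub>R w)) (axis j 1)) = 0" for j
    using frechet_derivative_annihilated[OF assms] by (simp add: difference_annihilated_def)
  then have "(\<Sum>m\<le>K. a m *\<^sub>R frechet_derivative f (at (x + real m *\<^sub>R w)) (axis j 1)) $ i = 0" for i j
    by simp
  then show "(\<Sum>m\<le>K. a m *\<^sub>R grad f (x + real m *\<^sub>R w)) = 0"
    by (simp add: vec_eq_iff grad_def partial_deriv_def)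
qed

lemma annihilated_vec:
  fixes f :: "'a::real_vector \<Rightarrow> complex^'m"
  assumes "\<And>i. difference_annihilated a K (\<lambda>x. f x $ i)"
  shows "difference_annihilated a K f"
  using assms by (simp add: difference_annihilated_def vec_eq_iff)

lemma grad_eq_on_open:
  assumes "open D" "x \<in> D" "\<And>y. y \<in> D \<Longrightarrow> f y = g y" "C1_fun g"
  shows "grad f x = grad g x"
proof -
  have "(f has_derivative frechet_derivative g (at x)) (at x)"
    by (rule has_derivative_transform_within_open[OF C1_fun_deriv[OF assms(4)] assms(1,2)]) (simp add: assms(3))
  then have "frechet_derivative f (at x) = frechet_derivative g (at x)" by (metis frechet_derivative_at)
  then show ?thesis by (simp add: grad_def partial_deriv_def)
qed

section \<open>A discrete function on a fixed mesh\<close>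

text \<open>Mesh and function are fixed here, while \<sigma> and \<open>a\<close> are parameters
  chosen outside: constants built from them, k and the dimension are automatically independent of
  the mesh.\<close>

locale dg_function =
  fixes \<Omega> :: "(real^'n) set" and \<beta> :: "real^'n \<Rightarrow> real^'n" and \<T> :: "(real^'n) set set" and k :: nat
    and u :: "real^'n \<Rightarrow> complex^'n" and \<sigma> :: real and a :: "nat \<Rightarrow> real"
  assumes dim2: "2 \<le> CARD('n)"
    and domain: "polyhedral_domain \<Omega>" and field: "W1_infty_field \<Omega> \<beta>" and divfree: "divergence_free \<Omega> \<beta>"
    and mesh: "simplicial_mesh \<Omega> \<T>" and u: "u \<in> dg_space \<Omega> \<T> k"
    and \<sigma>: "\<sigma> > 0" "\<And>\<tau>. \<tau> \<in> \<T> \<Longrightarrow> diameter \<tau> \<le> \<sigma> * inball_diameter \<tau>"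
    and a0: "a 0 = 1"
    and a: "\<And>q :: complex poly. degree q \<le> k \<Longrightarrow> (\<Sum>i\<le>Suc k. of_real (a i) * poly q (of_nat i)) = 0"
begin

lemma simplexE:
  assumes "\<tau> \<in> \<T>"
  obtains S where "full_simplex S" "\<tau> = convex hull S"
proof -
  have "int CARD('n) simplex \<tau>" using assms mesh by (simp add: simplicial_mesh_def)
  then obtain C where C: "\<not> affine_dependent C" "int (card C) = int CARD('n) + 1" "\<tau> = convex hull C"
    by (auto simp: simplex_def)
  have "full_simplex C"
    using C dim2 by unfold_locales auto
  then show ?thesis using C(3) that by blast
qed

lemma open_domain: "open \<Omega>" and interior_closure_domain: "interior (closure \<Omega>) = \<Omega>"
  using domain by (auto simp: polyhedral_domain_def)

lemma finite_mesh: "finite \<T>"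
  using mesh by (simp add: simplicial_mesh_def triangulation_def)

lemma Union_mesh: "\<Union>\<T> = closure \<Omega>"
  using mesh by (simp add: simplicial_mesh_def)

lemma simplex_interior_subset: "\<tau> \<in> \<T> \<Longrightarrow> interior \<tau> \<subseteq> \<Omega>"
  using interior_mono[of \<tau> "closure \<Omega>"] Union_mesh interior_closure_domain by auto

text \<open>\<open>u\<close> is arbitrary on the skeleton, so all traces are expressed by its
  polynomial on the simplex, extended to the whole space.\<close>

definition U :: "(real^'n) set \<Rightarrow> real^'n \<Rightarrow> complex^'n" where
  "U \<tau> = (SOME U. (\<forall>i. (\<lambda>x. U x $ i) \<in> poly_space k) \<and> (\<forall>x\<in>interior \<tau>. u x = U x))"

text \<open>The field is controlled on the open set \<Omega> only; this extension supplies its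
  traces on faces in the boundary.\<close>

definition B :: "(real^'n) set \<Rightarrow> real^'n \<Rightarrow> real^'n" where
  "B \<tau> = (SOME B. continuous_on \<tau> B \<and> (\<forall>x\<in>interior \<tau>. B x = \<beta> x))"

lemma U:
  assumes "\<tau> \<in> \<T>"
  shows U_poly: "(\<lambda>x. U \<tau> x $ i) \<in> poly_space k" and U_eq: "x \<in> interior \<tau> \<Longrightarrow> u x = U \<tau> x"
proof -
  have "\<forall>i. \<exists>p\<in>poly_space k. \<forall>x\<in>interior \<tau>. u x $ i = p x"
    using u assms by (simp add: dg_space_def)
  then obtain p where p: "\<And>i. p i \<in> poly_space k" "\<And>i x. x \<in> interior \<tau> \<Longrightarrow> u x $ i = p i x" by metis
  have "\<exists>U. (\<forall>i. (\<lambda>x. U x $ i) \<in> poly_space k) \<and> (\<forall>x\<in>interior \<tau>. u x = U x)"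
    using p by (intro exI[of _ "\<lambda>x. \<chi> i. p i x"]) (simp add: vec_eq_iff)
  then have *: "(\<forall>i. (\<lambda>x. U \<tau> x $ i) \<in> poly_space k) \<and> (\<forall>x\<in>interior \<tau>. u x = U \<tau> x)"
    unfolding U_def by (rule someI_ex)
  then show "(\<lambda>x. U \<tau> x $ i) \<in> poly_space k" "x \<in> interior \<tau> \<Longrightarrow> u x = U \<tau> x" by blast+
qed

lemma C1_U: "\<tau> \<in> \<T> \<Longrightarrow> C1_fun (U \<tau>)"
  by (intro C1_fun_vec poly_space_C1[OF U_poly])

lemma continuous_U: "\<tau> \<in> \<T> \<Longrightarrow> continuous_on A (U \<tau>)"
  by (intro C1_fun_continuous C1_U)

lemma continuous_grad_U: "\<tau> \<in> \<T> \<Longrightarrow> continuous_on A (grad (U \<tau>))"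
  by (intro continuous_on_grad C1_U)

lemma grad_eq: "\<tau> \<in> \<T> \<Longrightarrow> x \<in> interior \<tau> \<Longrightarrow> grad u x = grad (U \<tau>) x"
  by (rule grad_eq_on_open[of "interior \<tau>"]) (auto simp: U_eq C1_U)

lemma closure_interior_mesh: "\<tau> \<in> \<T> \<Longrightarrow> closure (interior \<tau>) = \<tau>"
  by (rule simplexE) (auto simp: full_simplex.closure_interior)

text \<open>On the convex open simplex the components of \<beta> are Lipschitz, hence uniformly
  continuous, and extend continuously to the closure, which is the simplex.\<close>

lemma B:
  assumes "\<tau> \<in> \<T>"
  shows B_cont: "continuous_on \<tau> (B \<tau>)" and B_eq: "x \<in> interior \<tau> \<Longrightarrow> B \<tau> x = \<beta> x"
proof -
  obtain S where S: "full_simplex S" "\<tau> = convex hull S" using assms by (rule simplexE)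
  have cvx: "convex (interior \<tau>)" unfolding S(2) by (intro convex_interior convex_convex_hull)
  have "\<exists>g. continuous_on \<tau> g \<and> (\<forall>x\<in>interior \<tau>. \<beta> x $ i = g x)" for i
  proof -
    have "(\<lambda>x. \<beta> x $ i) \<in> W1_infty \<Omega>" "continuous_on \<Omega> \<beta>" using field by (simp_all add: W1_infty_field_def)
    moreover from this(2) have "continuous_on \<Omega> (\<lambda>x. \<beta> x $ i)" by (intro continuous_intros)
    ultimately obtain L where "L-lipschitz_on (interior \<tau>) (\<lambda>x. \<beta> x $ i)"
      using W1_infty_lipschitz[OF open_domain _ _ cvx simplex_interior_subset[OF assms]] by blast
    then have "uniformly_continuous_on (interior \<tau>) (\<lambda>x. \<beta> x $ i)" by (rule lipschitz_on_uniformly_continuous)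
    then obtain g where "uniformly_continuous_on (closure (interior \<tau>)) g" "\<And>x. x \<in> interior \<tau> \<Longrightarrow> \<beta> x $ i = g x"
      by (rule uniformly_continuous_on_extension_on_closure) blast
    then show ?thesis
      unfolding closure_interior_mesh[OF assms] using uniformly_continuous_imp_continuous by blast
  qed
  then obtain g where g: "\<And>i. continuous_on \<tau> (g i)" "\<And>i x. x \<in> interior \<tau> \<Longrightarrow> \<beta> x $ i = g i x" by metis
  have "\<exists>B. continuous_on \<tau> B \<and> (\<forall>x\<in>interior \<tau>. B x = \<beta> x)"
    using g by (intro exI[of _ "\<lambda>x. \<chi> i. g i x"]) (auto simp: vec_eq_iff intro!: continuous_on_vec_lambda)
  then have *: "continuous_on \<tau> (B \<tau>) \<and> (\<forall>x\<in>interior \<tau>. B \<tau> x = \<beta> x)"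
    unfolding B_def by (rule someI_ex)
  then show "continuous_on \<tau> (B \<tau>)" "x \<in> interior \<tau> \<Longrightarrow> B \<tau> x = \<beta> x" by blast+
qed

lemma trace_u: "\<tau> \<in> \<T> \<Longrightarrow> x \<in> \<tau> \<Longrightarrow> trace_from \<tau> u x = U \<tau> x"
  by (rule trace_from_eq[OF closure_interior_mesh continuous_U U_eq])

lemma trace_grad: "\<tau> \<in> \<T> \<Longrightarrow> x \<in> \<tau> \<Longrightarrow> trace_from \<tau> (grad u) x = grad (U \<tau>) x"
  by (rule trace_from_eq[OF closure_interior_mesh continuous_grad_U grad_eq])

lemma trace_flux:
  assumes "\<tau> \<in> \<T>" "x \<in> \<tau>"
  shows "trace_from \<tau> (\<lambda>y. u y \<otimes>\<^sub>t cvec (\<beta> y)) x = U \<tau> x \<otimes>\<^sub>t cvec (B \<tau> x)"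
proof (rule trace_from_eq[OF closure_interior_mesh[OF assms(1)] _ _ assms(2)])
  show "continuous_on \<tau> (\<lambda>x. U \<tau> x \<otimes>\<^sub>t cvec (B \<tau> x))"
    by (intro continuous_intros continuous_U B_cont assms)
  show "u y \<otimes>\<^sub>t cvec (\<beta> y) = U \<tau> y \<otimes>\<^sub>t cvec (B \<tau> y)" if "y \<in> interior \<tau>" for y
    using U_eq[OF assms(1) that] B_eq[OF assms(1) that] by simp
qed

lemma facet_set_integrable:
  fixes f :: "real^'n \<Rightarrow> 'b::{banach, second_countable_topology}"
  assumes "\<tau> \<in> \<T>" "G facet_of \<tau>" "continuous_on G f"
  shows "set_integrable (face_measure G) G f"
proof -
  obtain S where S: "full_simplex S" "\<tau> = convex hull S" using assms(1) by (rule simplexE)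
  then obtain v where v: "v \<in> S" "G = convex hull (S - {v})"
    using full_simplex.facet_iff[OF S(1)] assms(2) by blast
  show ?thesis
    using full_simplex.facet_set_integral(1)[OF S(1) v(1)] assms(3) unfolding v(2) by blast
qed

lemma mesh_set_integrable:
  fixes f :: "real^'n \<Rightarrow> 'b::{banach, second_countable_topology}"
  assumes "G \<in> mesh_faces \<T>" "continuous_on G f"
  shows "set_integrable (face_measure G) G f"
  using assms facet_set_integrable unfolding mesh_faces_def by blast

lemma facet_subset: "G facet_of \<tau> \<Longrightarrow> G \<subseteq> \<tau>"
  by (simp add: facet_of_imp_subset)

abbreviation energy :: "(real^'n) set \<Rightarrow> real" where
  "energy \<tau> \<equiv> (LINT x:\<tau>|lebesgue. (norm (grad u x))\<^sup>2)"

text \<open>The constant of \<open>inverse_trace\<close> times \<sigma>, the price for replacing the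
  height by the diameter of a facet.\<close>

definition trace_const :: real where
  "trace_const = \<sigma> * ((\<Sum>i\<le>k. (a (Suc i))\<^sup>2) * (real (Suc k))\<^sup>2 * 2 ^ CARD('n))"

lemma energy_nonneg: "0 \<le> energy \<tau>"
  unfolding set_lebesgue_integral_def by (intro integral_nonneg_AE) simp

lemma facet_diameter_pos:
  assumes "G \<in> mesh_faces \<T>" shows "0 < diameter G"
proof -
  obtain \<tau> where \<tau>: "\<tau> \<in> \<T>" "G facet_of \<tau>" using assms unfolding mesh_faces_def by blast
  obtain S where S: "full_simplex S" "\<tau> = convex hull S" using \<tau>(1) by (rule simplexE)
  then obtain v where v: "v \<in> S" "G = convex hull (S - {v})"
    using full_simplex.facet_iff[OF S(1)] \<tau>(2) by blast
  show ?thesis unfolding v(2) using S(1) v(1) by (rule full_simplex.diameter_F_pos)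
qed

text \<open>Shape regularity leads from the facet diameter over the simplex diameter and the
  inscribed ball to the height, which \<open>inverse_trace\<close> controls. That estimate applies
  to the gradient because the differences that annihilate \<open>U \<tau>\<close> annihilate its
  derivatives too.\<close>

lemma trace_inequality:
  assumes \<tau>: "\<tau> \<in> \<T>" "G facet_of \<tau>"
  shows "diameter G * (LINT x:G|face_measure G. (norm (grad (U \<tau>) x))\<^sup>2) \<le> trace_const * energy \<tau>"
proof -
  obtain S where S: "full_simplex S" "\<tau> = convex hull S" using \<tau>(1) by (rule simplexE)
  then obtain v where v: "v \<in> S" "G = convex hull (S - {v})"
    using full_simplex.facet_iff[OF S(1)] \<tau>(2) by blast
  interpret S: full_simplex S by (rule S(1))
  let ?f = "grad (U \<tau>)"
  have cf: "continuous_on A ?f" for A by (rule continuous_grad_U[OF \<tau>(1)])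
  have cn: "continuous_on A (\<lambda>x. (norm (?f x))\<^sup>2)" for A by (intro continuous_intros cf)
  have ann: "difference_annihilated a (Suc k) ?f"
    by (intro grad_annihilated annihilated_vec C1_U \<tau>(1) poly_space_annihilated[OF U_poly[OF \<tau>(1)]] a)
  have I: "(LINT x:G|face_measure G. (norm (?f x))\<^sup>2) = (\<integral>y. indicator (S.F v) y * (norm (?f y))\<^sup>2 \<partial>S.facet_measure v)"
    using S.facet_set_integral(2)[OF v(1) cn] unfolding v(2) by simp
  have J: "energy \<tau> = (\<integral>x. indicator S.\<tau> x * (norm (?f x))\<^sup>2 \<partial>lborel)"
    using S.simplex_set_integral(2)[OF cn, of "\<lambda>x. (norm (grad u x))\<^sup>2"] grad_eq[OF \<tau>(1)] unfolding S(2) by simp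
  have I0: "0 \<le> (LINT x:G|face_measure G. (norm (?f x))\<^sup>2)"
    unfolding set_lebesgue_integral_def by (intro integral_nonneg_AE) simp
  have "diameter G \<le> diameter \<tau>" unfolding v(2) S(2) by (rule S.diameter_F_le)
  also have "\<dots> \<le> \<sigma> * inball_diameter \<tau>" using \<tau>(1) by (rule \<sigma>(2))
  also have "\<dots> \<le> \<sigma> * S.height v" using S.inball_le_height[OF v(1)] \<sigma>(1) unfolding S(2) by (intro mult_left_mono) auto
  finally have "diameter G * (LINT x:G|face_measure G. (norm (?f x))\<^sup>2)
      \<le> (\<sigma> * S.height v) * (LINT x:G|face_measure G. (norm (?f x))\<^sup>2)" using I0 by (rule mult_right_mono)
  also have "\<dots> = \<sigma> * (S.height v * (LINT x:G|face_measure G. (norm (?f x))\<^sup>2))" by simp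
  also have "\<dots> \<le> \<sigma> * ((\<Sum>i\<le>k. (a (Suc i))\<^sup>2) * (real (Suc k))\<^sup>2 * 2 ^ CARD('n) * energy \<tau>)"
    unfolding I J using S.inverse_trace[OF v(1) cf ann a0] \<sigma>(1) by (intro mult_left_mono) auto
  finally show ?thesis by (simp add: trace_const_def mult.assoc)
qed

section \<open>Cancellation of the convective terms\<close>

lemma convection_simplex:
  assumes \<tau>: "\<tau> \<in> \<T>"
  shows "Re (LINT x:\<tau>|lebesgue. cdot (grad u x *v cvec (\<beta> x)) (u x))
    = (1/2) * (\<Sum>G | G facet_of \<tau>. LINT x:G|face_measure G. (norm (U \<tau> x))\<^sup>2 * (B \<tau> x \<bullet> outer_normal \<tau> G))"
proof -
  obtain S where S: "full_simplex S" "\<tau> = convex hull S" using \<tau> by (rule simplexE)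
  interpret S: full_simplex S by (rule S(1))
  define \<phi> where "\<phi> x = (norm (U \<tau> x))\<^sup>2" for x
  let ?D = "\<lambda>x. frechet_derivative (U \<tau>) (at x)"
  have C1: "C1_fun (U \<tau>)" using \<tau> by (rule C1_U)
  have d\<phi>: "(\<phi> has_derivative (\<lambda>h. 2 * (U \<tau> x \<bullet> ?D x h))) (at x)" for x
    unfolding \<phi>_def[abs_def] power2_norm_eq_inner
    by (rule has_derivative_eq_rhs[OF has_derivative_inner[OF C1_fun_deriv[OF C1] C1_fun_deriv[OF C1]]])
       (auto simp: inner_commute)
  have \<phi>: "C1_fun \<phi>"
    by (rule C1_funI[OF d\<phi>]) (intro continuous_intros continuous_U \<tau> C1_fun_continuous_deriv[OF C1])
  have f\<phi>: "frechet_derivative \<phi> (at x) h = 2 * (U \<tau> x \<bullet> ?D x h)" for x h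
    using fun_cong[OF frechet_derivative_at[OF d\<phi>[of x]], of h] by simp
  have cB: "continuous_on S.\<tau> (B \<tau>)" using B_cont[OF \<tau>] unfolding S(2) .
  have Bi: "B \<tau> x = \<beta> x" if "x \<in> interior S.\<tau>" for x using B_eq[OF \<tau>] that unfolding S(2) .
  have cg: "continuous_on S.\<tau> (\<lambda>x. cdot (grad (U \<tau>) x *v cvec (B \<tau> x)) (U \<tau> x))"
    by (intro continuous_intros continuous_U continuous_grad_U \<tau> cB)
  have eq: "cdot (grad u x *v cvec (\<beta> x)) (u x) = cdot (grad (U \<tau>) x *v cvec (B \<tau> x)) (U \<tau> x)"
    if "x \<in> interior S.\<tau>" for x
    using that grad_eq[OF \<tau>] U_eq[OF \<tau>] Bi[OF that] unfolding S(2) by simp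
  have "Re (LINT x:\<tau>|lebesgue. cdot (grad u x *v cvec (\<beta> x)) (u x))
      = (LINT x:\<tau>|lebesgue. Re (cdot (grad u x *v cvec (\<beta> x)) (u x)))"
    unfolding S(2) by (rule Re_set_integral[OF S.simplex_set_integral(1)[OF cg eq]])
  also have "\<dots> = (\<integral>x. indicator S.\<tau> x *\<^sub>R Re (cdot (grad (U \<tau>) x *v cvec (B \<tau> x)) (U \<tau> x)) \<partial>lborel)"
    unfolding S(2)
  proof (rule S.simplex_set_integral(2))
    show "continuous_on S.\<tau> (\<lambda>x. Re (cdot (grad (U (convex hull S)) x *v cvec (B (convex hull S) x)) (U (convex hull S) x)))"
      using continuous_on_Re[OF cg] unfolding S(2) .
    show "Re (cdot (grad u x *v cvec (\<beta> x)) (u x)) = Re (cdot (grad (U (convex hull S)) x *v cvec (B (convex hull S) x)) (U (convex hull S) x))"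
      if "x \<in> interior S.\<tau>" for x using eq[OF that] unfolding S(2) by (rule arg_cong)
  qed
  also have "\<dots> = (\<integral>x. (1/2) * (indicator S.\<tau> x * frechet_derivative \<phi> (at x) (B \<tau> x)) \<partial>lborel)"
    unfolding Re_cdot grad_mult_cvec[OF C1] f\<phi> by (simp add: inner_commute)
  also have "\<dots> = (1/2) * (\<integral>x. indicator S.\<tau> x * frechet_derivative \<phi> (at x) (B \<tau> x) \<partial>lborel)"
    by (rule integral_mult_right_zero)
  also have "(\<integral>x. indicator S.\<tau> x * frechet_derivative \<phi> (at x) (B \<tau> x) \<partial>lborel)
      = (\<Sum>v\<in>S. (\<integral>y. indicator (S.F v) y * (\<phi> y * (B \<tau> y \<bullet> S.nrm v)) \<partial>S.facet_measure v))"
    using simplex_interior_subset[OF \<tau>] unfolding S(2)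
    by (intro S.divergence_simplex[OF open_domain _ divfree] \<phi>[unfolded S(2)] cB[unfolded S(2)] Bi[unfolded S(2)])
  also have "\<dots> = (\<Sum>v\<in>S. LINT x:S.F v|face_measure (S.F v). \<phi> x * (B \<tau> x \<bullet> outer_normal S.\<tau> (S.F v)))"
  proof (rule sum.cong[OF refl])
    fix v assume v: "v \<in> S"
    have "continuous_on (S.F v) (\<lambda>x. \<phi> x * (B \<tau> x \<bullet> S.nrm v))"
      using continuous_on_subset[OF cB S.F_subset] by (intro continuous_intros C1_fun_continuous[OF \<phi>])
    from S.facet_set_integral(2)[OF v this]
    show "(\<integral>y. indicator (S.F v) y * (\<phi> y * (B \<tau> y \<bullet> S.nrm v)) \<partial>S.facet_measure v)
      = (LINT x:S.F v|face_measure (S.F v). \<phi> x * (B \<tau> x \<bullet> outer_normal S.\<tau> (S.F v)))" by simp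
  qed
  also have "\<dots> = (\<Sum>G | G facet_of S.\<tau>. LINT x:G|face_measure G. \<phi> x * (B \<tau> x \<bullet> outer_normal S.\<tau> G))"
    by (rule S.sum_facets[symmetric])
  finally show ?thesis unfolding \<phi>_def S(2)[symmetric] .
qed


lemma finite_faces: "finite (mesh_faces \<T>)"
proof -
  have "finite {G. G facet_of \<tau>}" if \<tau>: "\<tau> \<in> \<T>" for \<tau>
  proof -
    obtain S where S: "full_simplex S" "\<tau> = convex hull S" using \<tau> by (rule simplexE)
    have "{G. G facet_of \<tau>} = (\<lambda>v. convex hull (S - {v})) ` S"
      unfolding S(2) full_simplex.facet_iff[OF S(1)] by auto
    then show ?thesis using full_simplex.finS[OF S(1)] by simp
  qed
  moreover have "mesh_faces \<T> = (\<Union>\<tau>\<in>\<T>. {G. G facet_of \<tau>})" by (auto simp: mesh_faces_def)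
  ultimately show ?thesis using finite_mesh by simp
qed

lemma card_facets:
  assumes "\<tau> \<in> \<T>" shows "card {G. G facet_of \<tau>} = Suc CARD('n)"
proof -
  obtain S where S: "full_simplex S" "\<tau> = convex hull S" using assms by (rule simplexE)
  have "{G. G facet_of \<tau>} = (\<lambda>v. convex hull (S - {v})) ` S"
    unfolding S(2) full_simplex.facet_iff[OF S(1)] by auto
  then show ?thesis
    using full_simplex.inj_F[OF S(1)] full_simplex.cardS[OF S(1)] by (simp add: card_image)
qed

text \<open>Counts the incident pairs of a face and a simplex in both orders.\<close>

lemma sum_adjacent_swap:
  fixes g :: "(real^'n) set \<Rightarrow> (real^'n) set \<Rightarrow> 'b::comm_monoid_add"
  shows "(\<Sum>G\<in>mesh_faces \<T>. \<Sum>\<tau>\<in>adjacent \<T> G. g G \<tau>) = (\<Sum>\<tau>\<in>\<T>. \<Sum>G | G facet_of \<tau>. g G \<tau>)"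
proof -
  have "(\<Sum>G\<in>mesh_faces \<T>. \<Sum>\<tau>\<in>adjacent \<T> G. g G \<tau>) = (\<Sum>\<tau>\<in>\<T>. \<Sum>G | G \<in> mesh_faces \<T> \<and> G facet_of \<tau>. g G \<tau>)"
    unfolding adjacent_def by (rule sum.swap_restrict[OF finite_faces finite_mesh])
  also have "\<dots> = (\<Sum>\<tau>\<in>\<T>. \<Sum>G | G facet_of \<tau>. g G \<tau>)"
    by (intro sum.cong refl) (auto simp: mesh_faces_def)
  finally show ?thesis .
qed

text \<open>The condition \<open>interior (closure \<Omega>) = \<Omega>\<close> puts the relative
  interior of a shared face into \<Omega>, where \<beta> is continuous and both extensions equal it;
  the rest of the face follows by closure.\<close>

lemma neighbours:
  assumes \<tau>: "\<tau> \<in> \<T>" "G facet_of \<tau>" and \<tau>': "\<tau>' \<in> \<T>" "G facet_of \<tau>'" and ne: "\<tau> \<noteq> \<tau>'"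
  shows "outer_normal \<tau>' G = - outer_normal \<tau> G" and "x \<in> G \<Longrightarrow> B \<tau>' x = B \<tau> x"
proof -
  obtain S where S: "full_simplex S" "\<tau> = convex hull S" using \<tau>(1) by (rule simplexE)
  obtain S' where S': "full_simplex S'" "\<tau>' = convex hull S'" using \<tau>'(1) by (rule simplexE)
  obtain v where v: "v \<in> S" "G = convex hull (S - {v})"
    using full_simplex.facet_iff[OF S(1)] \<tau>(2) S(2) by blast
  obtain v' where v': "v' \<in> S'" "G = convex hull (S' - {v'})"
    using full_simplex.facet_iff[OF S'(1)] \<tau>'(2) S'(2) by blast
  have tri: "T \<inter> T' face_of T" if "T \<in> \<T>" "T' \<in> \<T>" for T T'
    using mesh that by (simp add: simplicial_mesh_def triangulation_def)
  have face: "convex hull S \<inter> convex hull S' face_of convex hull S" "convex hull S \<inter> convex hull S' face_of convex hull S'"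
    using tri[OF \<tau>(1) \<tau>'(1)] tri[OF \<tau>'(1) \<tau>(1)] unfolding S(2) S'(2) by (simp_all add: Int_commute)
  note adj = adjacent_simplices[OF S(1) S'(1) v(1) v'(1) v'(2)[symmetric, unfolded v(2)] ne[unfolded S(2) S'(2)] face]
  show "outer_normal \<tau>' G = - outer_normal \<tau> G"
    using adj(1) unfolding S(2) S'(2) v(2) .
  have ri: "rel_interior G \<subseteq> \<Omega>"
  proof -
    have "rel_interior G \<subseteq> interior (\<tau> \<union> \<tau>')" using adj(2) unfolding S(2) S'(2) v(2) .
    also have "\<dots> \<subseteq> interior (closure \<Omega>)" using Union_mesh \<tau>(1) \<tau>'(1) by (intro interior_mono) blast
    finally show ?thesis unfolding interior_closure_domain .
  qed
  have val: "B T y = \<beta> y" if T: "T \<in> \<T>" "y \<in> T" "y \<in> \<Omega>" for T y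
  proof -
    have "isCont \<beta> y"
      using field T(3) open_domain by (simp add: W1_infty_field_def continuous_on_eq_continuous_at)
    then have "(\<beta> \<longlongrightarrow> \<beta> y) (at y within interior T)"
      by (simp add: continuous_at isCont_def tendsto_within_subset[of \<beta> _ _ UNIV])
    moreover have "\<not> trivial_limit (at y within interior T)"
    proof -
      have "y islimpt interior T"
      proof (cases "y \<in> interior T")
        case True
        then show ?thesis by (intro interior_limit_point) simp
      next
        case False
        then show ?thesis using T(2) closure_interior_mesh[OF T(1)] by (auto simp: closure_def)
      qed
      then show ?thesis by (simp add: trivial_limit_within)
    qed
    ultimately have "trace_from T \<beta> y = \<beta> y" unfolding trace_from_def by (intro tendsto_Lim)
    moreover have "trace_from T \<beta> y = B T y"
      by (rule trace_from_eq[OF closure_interior_mesh[OF T(1)] B_cont[OF T(1)] _ T(2)]) (simp add: B_eq[OF T(1)])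
    ultimately show ?thesis by simp
  qed
  have Gcl: "closure (rel_interior G) = G"
  proof -
    have "closure (rel_interior G) = closure G"
      unfolding v(2) by (rule convex_closure_rel_interior[OF convex_convex_hull])
    also have "closure G = G"
      unfolding v(2) by (rule closure_closed[OF compact_imp_closed[OF full_simplex.compact_F[OF S(1)]]])
    finally show ?thesis .
  qed
  have G\<tau>: "G \<subseteq> \<tau>" "G \<subseteq> \<tau>'" using facet_subset \<tau>(2) \<tau>'(2) by blast+
  show "B \<tau>' x = B \<tau> x" if "x \<in> G"
  proof (rule continuous_eq_on_closure[where A="rel_interior G" and f="B \<tau>'" and g="B \<tau>" and x=x])
    show "continuous_on (closure (rel_interior G)) (B \<tau>')" unfolding Gcl
      using B_cont[OF \<tau>'(1)] G\<tau>(2) by (rule continuous_on_subset)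
    show "continuous_on (closure (rel_interior G)) (B \<tau>)" unfolding Gcl
      using B_cont[OF \<tau>(1)] G\<tau>(1) by (rule continuous_on_subset)
    show "x \<in> closure (rel_interior G)" unfolding Gcl by fact
    fix y assume y: "y \<in> rel_interior G"
    then have "y \<in> G" "y \<in> \<Omega>" using rel_interior_subset ri by blast+
    then show "B \<tau>' y = B \<tau> y" using val \<tau>(1) \<tau>'(1) G\<tau> by (metis subsetD)
  qed
qed

lemma outer_normal_nonzero:
  assumes "\<tau> \<in> \<T>" "G facet_of \<tau>" shows "outer_normal \<tau> G \<noteq> 0"
proof -
  obtain S where S: "full_simplex S" "\<tau> = convex hull S" using assms(1) by (rule simplexE)
  obtain v where v: "v \<in> S" "G = convex hull (S - {v})"
    using full_simplex.facet_iff[OF S(1)] assms(2) S(2) by blast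
  have "norm (outer_normal \<tau> G) = 1" unfolding S(2) v(2) using S(1) v(1) by (rule full_simplex.norm_nrm)
  then show ?thesis by auto
qed

text \<open>A third simplex at the face would have a normal opposite to each of two opposite
  normals, which is impossible for nonzero vectors.\<close>

lemma adjacent_interior:
  assumes "G \<in> interior_faces \<T>"
  obtains \<tau> \<tau>' where "\<tau> \<noteq> \<tau>'" "adjacent \<T> G = {\<tau>, \<tau>'}" "outer_normal \<tau>' G = - outer_normal \<tau> G"
    "\<forall>x\<in>G. B \<tau>' x = B \<tau> x"
proof -
  obtain \<tau> \<tau>' where \<tau>: "\<tau> \<in> \<T>" "\<tau>' \<in> \<T>" "\<tau> \<noteq> \<tau>'" "G facet_of \<tau>" "G facet_of \<tau>'"
    using assms unfolding interior_faces_def by blast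
  note nb = neighbours[OF \<tau>(1,4) \<tau>(2,5) \<tau>(3)]
  have "T \<in> {\<tau>, \<tau>'}" if T: "T \<in> \<T>" "G facet_of T" for T
  proof (rule ccontr)
    assume "T \<notin> {\<tau>, \<tau>'}"
    then have ne: "\<tau> \<noteq> T" "\<tau>' \<noteq> T" by auto
    have "outer_normal T G = - outer_normal \<tau> G" by (rule neighbours(1)[OF \<tau>(1,4) T ne(1)])
    moreover have "outer_normal T G = - outer_normal \<tau>' G" by (rule neighbours(1)[OF \<tau>(2,5) T ne(2)])
    ultimately have "outer_normal \<tau> G = - outer_normal \<tau> G" using nb(1) by simp
    then have "2 *\<^sub>R outer_normal \<tau> G = 0" by (simp only: scaleR_2 eq_neg_iff_add_eq_0)
    then have "outer_normal \<tau> G = 0" by simp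
    then show False using outer_normal_nonzero[OF \<tau>(1,4)] by simp
  qed
  then have "adjacent \<T> G = {\<tau>, \<tau>'}" using \<tau> unfolding adjacent_def by blast
  then show ?thesis using \<tau>(3) nb by (intro that[of \<tau> \<tau>']) auto
qed

lemma adjacent_boundary:
  assumes "G \<in> boundary_faces \<T>"
  obtains \<tau> where "adjacent \<T> G = {\<tau>}"
proof -
  obtain \<tau> where \<tau>: "\<tau> \<in> \<T>" "G facet_of \<tau>"
    using assms unfolding boundary_faces_def mesh_faces_def by blast
  have "T = \<tau>" if "T \<in> \<T>" "G facet_of T" for T
    using assms \<tau> that unfolding boundary_faces_def interior_faces_def by blast
  then have "adjacent \<T> G = {\<tau>}" using \<tau> unfolding adjacent_def by blast
  then show ?thesis by (rule that)
qed

lemma adjacentD: "\<tau> \<in> adjacent \<T> G \<Longrightarrow> \<tau> \<in> \<T>" "\<tau> \<in> adjacent \<T> G \<Longrightarrow> G facet_of \<tau>"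
  "\<tau> \<in> adjacent \<T> G \<Longrightarrow> G \<subseteq> \<tau>"
  by (auto simp: adjacent_def dest: facet_subset)

text \<open>From here to \<open>mean_u\<close>, the face quantities of the form with traces replaced
  by the extensions \<open>U\<close> and \<open>B\<close>, which makes their continuity on the face
  evident.\<close>

definition jump :: "(real^'n) set \<Rightarrow> real^'n \<Rightarrow> complex^'n^'n" where
  "jump G x = (\<Sum>\<tau>\<in>adjacent \<T> G. U \<tau> x \<otimes>\<^sub>t cvec (outer_normal \<tau> G))"

definition mean_grad :: "(real^'n) set \<Rightarrow> real^'n \<Rightarrow> complex^'n^'n" where
  "mean_grad G x = (1 / real (card (adjacent \<T> G))) *\<^sub>R (\<Sum>\<tau>\<in>adjacent \<T> G. grad (U \<tau>) x)"

definition flux_jump :: "(real^'n) set \<Rightarrow> real^'n \<Rightarrow> complex^'n" where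
  "flux_jump G x = (\<Sum>\<tau>\<in>adjacent \<T> G. (B \<tau> x \<bullet> outer_normal \<tau> G) *\<^sub>R U \<tau> x)"

definition mean_u :: "(real^'n) set \<Rightarrow> real^'n \<Rightarrow> complex^'n" where
  "mean_u G x = (1 / real (card (adjacent \<T> G))) *\<^sub>R (\<Sum>\<tau>\<in>adjacent \<T> G. U \<tau> x)"

lemma face_values:
  assumes "x \<in> G"
  shows "full_jump \<T> G u x = jump G x" "mean \<T> G (grad u) x = mean_grad G x"
    "tensor_jump \<T> G (\<lambda>y. u y \<otimes>\<^sub>t cvec (\<beta> y)) x = flux_jump G x" "mean \<T> G u x = mean_u G x"
proof -
  have t: "\<tau> \<in> \<T>" "x \<in> \<tau>" if "\<tau> \<in> adjacent \<T> G" for \<tau>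
    using adjacentD(1,3)[OF that] assms by blast+
  show "full_jump \<T> G u x = jump G x"
    unfolding full_jump_def jump_def by (intro sum.cong refl) (simp add: trace_u t)
  show "mean \<T> G (grad u) x = mean_grad G x"
    unfolding mean_def mean_grad_def by (intro arg_cong2[where f=scaleR] sum.cong refl) (simp add: trace_grad t)
  show "tensor_jump \<T> G (\<lambda>y. u y \<otimes>\<^sub>t cvec (\<beta> y)) x = flux_jump G x"
    unfolding tensor_jump_def flux_jump_def by (intro sum.cong refl) (simp add: trace_flux t outer_mult_cvec)
  show "mean \<T> G u x = mean_u G x"
    unfolding mean_def mean_u_def by (intro arg_cong2[where f=scaleR] sum.cong refl) (simp add: trace_u t)
qed

lemma face_continuity:
  shows "continuous_on G (jump G)" "continuous_on G (mean_grad G)" "continuous_on G (flux_jump G)" "continuous_on G (mean_u G)"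
proof -
  have Bc: "continuous_on G (B \<tau>)" if "\<tau> \<in> adjacent \<T> G" for \<tau>
    using B_cont[OF adjacentD(1)[OF that]] adjacentD(3)[OF that] by (rule continuous_on_subset)
  show "continuous_on G (jump G)" "continuous_on G (mean_grad G)" "continuous_on G (mean_u G)"
    unfolding jump_def[abs_def] mean_grad_def[abs_def] mean_u_def[abs_def]
    by (intro continuous_intros continuous_U continuous_grad_U adjacentD(1); assumption)+
  show "continuous_on G (flux_jump G)"
    unfolding flux_jump_def[abs_def]
    by (intro continuous_intros continuous_U adjacentD(1) Bc; assumption)
qed

abbreviation face_int :: "(real^'n) set \<Rightarrow> (real^'n \<Rightarrow> 'b) \<Rightarrow> 'b::{banach, second_countable_topology}" where
  "face_int G f \<equiv> (LINT x:G|face_measure G. f x)"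

lemma face_int_cong:
  assumes "\<And>x. x \<in> G \<Longrightarrow> f x = g x" shows "face_int G f = face_int G g"
  unfolding set_lebesgue_integral_def
proof (rule Bochner_Integration.integral_cong[OF refl])
  show "indicator G x *\<^sub>R f x = indicator G x *\<^sub>R g x" for x
    using assms[of x] by (cases "x \<in> G") simp_all
qed

text \<open>The outward fluxes of |u|^2 \<beta> from all adjacent simplices; on an interior face,
  the normals being opposite, it is the flux of the jump of |u|^2.\<close>

definition face_flux :: "(real^'n) set \<Rightarrow> real" where
  "face_flux G = (\<Sum>\<tau>\<in>adjacent \<T> G. face_int G (\<lambda>x. (norm (U \<tau> x))\<^sup>2 * (B \<tau> x \<bullet> outer_normal \<tau> G)))"

lemma interior_subset_mesh_faces: "interior_faces \<T> \<subseteq> mesh_faces \<T>"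
  by (auto simp: interior_faces_def mesh_faces_def)

lemma Re_face_int:
  assumes "G \<in> mesh_faces \<T>" "continuous_on G f"
  shows "Re (face_int G f) = face_int G (\<lambda>x. Re (f x))"
  by (rule Re_set_integral[OF mesh_set_integrable[OF assms]])

text \<open>On an interior face \<beta> has a single trace, and the product of U - U' with (U + U')
  / 2 has as real part half the difference of squares. On a boundary face jump and mean both reduce
  to the one-sided trace and the whole flux appears, which explains the factor 1/2 of the boundary
  sum in \<open>dg_form\<close>.\<close>

lemma convection_face:
  assumes G: "G \<in> mesh_faces \<T>"
  shows "Re (face_int G (\<lambda>x. cdot (tensor_jump \<T> G (\<lambda>y. u y \<otimes>\<^sub>t cvec (\<beta> y)) x) (mean \<T> G u x)))
    = (if G \<in> interior_faces \<T> then face_flux G / 2 else face_flux G)"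
proof -
  have "Re (face_int G (\<lambda>x. cdot (tensor_jump \<T> G (\<lambda>y. u y \<otimes>\<^sub>t cvec (\<beta> y)) x) (mean \<T> G u x)))
      = Re (face_int G (\<lambda>x. cdot (flux_jump G x) (mean_u G x)))"
    by (intro arg_cong[where f=Re] face_int_cong) (simp add: face_values)
  also have "\<dots> = face_int G (\<lambda>x. flux_jump G x \<bullet> mean_u G x)"
    unfolding Re_cdot[symmetric] by (intro Re_face_int G continuous_intros face_continuity)
  finally have 1: "Re (face_int G (\<lambda>x. cdot (tensor_jump \<T> G (\<lambda>y. u y \<otimes>\<^sub>t cvec (\<beta> y)) x) (mean \<T> G u x)))
      = face_int G (\<lambda>x. flux_jump G x \<bullet> mean_u G x)" .
  have int: "set_integrable (face_measure G) G (\<lambda>x. (norm (U \<tau> x))\<^sup>2 * (B \<tau> x \<bullet> outer_normal \<tau> G))"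
    if \<tau>: "\<tau> \<in> adjacent \<T> G" for \<tau>
  proof (rule mesh_set_integrable[OF G])
    have "continuous_on G (B \<tau>)"
      using B_cont[OF adjacentD(1)[OF \<tau>]] adjacentD(3)[OF \<tau>] by (rule continuous_on_subset)
    then show "continuous_on G (\<lambda>x. (norm (U \<tau> x))\<^sup>2 * (B \<tau> x \<bullet> outer_normal \<tau> G))"
      by (intro continuous_intros continuous_U adjacentD(1)[OF \<tau>])
  qed
  show ?thesis
  proof (cases "G \<in> interior_faces \<T>")
    case True
    then obtain \<tau> \<tau>' where adj: "\<tau> \<noteq> \<tau>'" "adjacent \<T> G = {\<tau>, \<tau>'}" "outer_normal \<tau>' G = - outer_normal \<tau> G"
      "\<forall>x\<in>G. B \<tau>' x = B \<tau> x" by (rule adjacent_interior)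
    let ?f = "\<lambda>\<tau> x. (norm (U \<tau> x))\<^sup>2 * (B \<tau> x \<bullet> outer_normal \<tau> G)"
    have "face_int G (\<lambda>x. flux_jump G x \<bullet> mean_u G x) = face_int G (\<lambda>x. (1/2) *\<^sub>R (?f \<tau> x + ?f \<tau>' x))"
    proof (rule face_int_cong)
      fix x assume "x \<in> G"
      then have b: "B \<tau>' x = B \<tau> x" using adj(4) by blast
      let ?b = "B \<tau> x \<bullet> outer_normal \<tau> G"
      have "flux_jump G x = ?b *\<^sub>R (U \<tau> x - U \<tau>' x)"
        using adj(1) by (simp add: flux_jump_def adj(2,3) b scaleR_diff_right)
      moreover have "mean_u G x = (1/2) *\<^sub>R (U \<tau> x + U \<tau>' x)"
        using adj(1) by (simp add: mean_u_def adj(2))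
      moreover have "(U \<tau> x - U \<tau>' x) \<bullet> (U \<tau> x + U \<tau>' x) = (norm (U \<tau> x))\<^sup>2 - (norm (U \<tau>' x))\<^sup>2"
        by (simp add: power2_norm_eq_inner inner_diff_left inner_diff_right inner_add_right inner_commute)
      ultimately have "flux_jump G x \<bullet> mean_u G x = ?b * (1/2) * ((norm (U \<tau> x))\<^sup>2 - (norm (U \<tau>' x))\<^sup>2)"
        by (simp only: inner_scaleR_left inner_scaleR_right mult.assoc)
      then show "flux_jump G x \<bullet> mean_u G x = (1/2) *\<^sub>R (?f \<tau> x + ?f \<tau>' x)"
        by (simp add: b adj(3) algebra_simps)
    qed
    also have "\<dots> = (1/2) * (face_int G (?f \<tau>) + face_int G (?f \<tau>'))"
      using int adj(2) by (simp add: set_integral_add)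
    also have "\<dots> = face_flux G / 2" using adj(1) by (simp add: face_flux_def adj(2))
    finally show ?thesis using 1 True by simp
  next
    case False
    then have "G \<in> boundary_faces \<T>" using G by (simp add: boundary_faces_def)
    then obtain \<tau> where adj: "adjacent \<T> G = {\<tau>}" by (rule adjacent_boundary)
    have "face_int G (\<lambda>x. flux_jump G x \<bullet> mean_u G x) = face_flux G"
      by (simp add: flux_jump_def mean_u_def face_flux_def adj power2_norm_eq_inner mult.commute)
    then show ?thesis using 1 False by simp
  qed
qed

text \<open>By the divergence theorem on each simplex the volume terms give half of every face flux.
  The interior sum subtracts half of the flux, the boundary sum 1/2 times the whole.\<close>

lemma convection_cancels:
  "Re (\<Sum>\<tau>\<in>\<T>. LINT x:\<tau>|lebesgue. cdot (grad u x *v cvec (\<beta> x)) (u x))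
   - Re (\<Sum>G\<in>interior_faces \<T>. face_int G (\<lambda>x. cdot (tensor_jump \<T> G (\<lambda>y. u y \<otimes>\<^sub>t cvec (\<beta> y)) x) (mean \<T> G u x)))
   - 1 / 2 * Re (\<Sum>G\<in>boundary_faces \<T>. face_int G (\<lambda>x. cdot (tensor_jump \<T> G (\<lambda>y. u y \<otimes>\<^sub>t cvec (\<beta> y)) x) (mean \<T> G u x))) = 0"
proof -
  have "Re (\<Sum>\<tau>\<in>\<T>. LINT x:\<tau>|lebesgue. cdot (grad u x *v cvec (\<beta> x)) (u x))
      = (1/2) * (\<Sum>\<tau>\<in>\<T>. \<Sum>G | G facet_of \<tau>. face_int G (\<lambda>x. (norm (U \<tau> x))\<^sup>2 * (B \<tau> x \<bullet> outer_normal \<tau> G)))"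
    by (simp add: Re_sum convection_simplex sum_distrib_left)
  also have "\<dots> = (1/2) * (\<Sum>G\<in>mesh_faces \<T>. face_flux G)"
    unfolding face_flux_def sum_adjacent_swap ..
  also have "(\<Sum>G\<in>mesh_faces \<T>. face_flux G) = (\<Sum>G\<in>interior_faces \<T>. face_flux G) + (\<Sum>G\<in>boundary_faces \<T>. face_flux G)"
    unfolding boundary_faces_def using sum.subset_diff[OF interior_subset_mesh_faces finite_faces, of face_flux]
    by (simp add: add.commute)
  finally have v: "Re (\<Sum>\<tau>\<in>\<T>. LINT x:\<tau>|lebesgue. cdot (grad u x *v cvec (\<beta> x)) (u x))
      = (1/2) * ((\<Sum>G\<in>interior_faces \<T>. face_flux G) + (\<Sum>G\<in>boundary_faces \<T>. face_flux G))" .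
  have i: "Re (\<Sum>G\<in>interior_faces \<T>. face_int G (\<lambda>x. cdot (tensor_jump \<T> G (\<lambda>y. u y \<otimes>\<^sub>t cvec (\<beta> y)) x) (mean \<T> G u x)))
      = (1/2) * (\<Sum>G\<in>interior_faces \<T>. face_flux G)"
    unfolding Re_sum sum_distrib_left
  proof (rule sum.cong[OF refl])
    fix G assume "G \<in> interior_faces \<T>"
    then show "Re (face_int G (\<lambda>x. cdot (tensor_jump \<T> G (\<lambda>y. u y \<otimes>\<^sub>t cvec (\<beta> y)) x) (mean \<T> G u x))) = 1/2 * face_flux G"
      using convection_face[of G] interior_subset_mesh_faces by auto
  qed
  have b: "Re (\<Sum>G\<in>boundary_faces \<T>. face_int G (\<lambda>x. cdot (tensor_jump \<T> G (\<lambda>y. u y \<otimes>\<^sub>t cvec (\<beta> y)) x) (mean \<T> G u x)))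
      = (\<Sum>G\<in>boundary_faces \<T>. face_flux G)"
    unfolding Re_sum
  proof (rule sum.cong[OF refl])
    fix G assume "G \<in> boundary_faces \<T>"
    then show "Re (face_int G (\<lambda>x. cdot (tensor_jump \<T> G (\<lambda>y. u y \<otimes>\<^sub>t cvec (\<beta> y)) x) (mean \<T> G u x))) = face_flux G"
      using convection_face[of G] by (simp add: boundary_faces_def)
  qed
  show ?thesis unfolding v i b by (simp add: algebra_simps)
qed

section \<open>Consistency terms, penalty and the final estimate\<close>

definition jump_sq :: "(real^'n) set \<Rightarrow> real" where
  "jump_sq G = face_int G (\<lambda>x. (norm (jump G x))\<^sup>2)"

definition mean_sq :: "(real^'n) set \<Rightarrow> real" where
  "mean_sq G = face_int G (\<lambda>x. (norm (mean_grad G x))\<^sup>2)"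

definition consistency :: "(real^'n) set \<Rightarrow> real" where
  "consistency G = face_int G (\<lambda>x. mean_grad G x \<bullet> jump G x)"

lemma face_int_nonneg: "(\<And>x. 0 \<le> f x) \<Longrightarrow> 0 \<le> face_int G (f :: real^'n \<Rightarrow> real)"
  unfolding set_lebesgue_integral_def by (intro integral_nonneg_AE) simp

lemma face_int_mono:
  fixes f g :: "real^'n \<Rightarrow> real"
  assumes "G \<in> mesh_faces \<T>" "continuous_on G f" "continuous_on G g" "\<And>x. f x \<le> g x"
  shows "face_int G f \<le> face_int G g"
  by (rule set_integral_mono[OF mesh_set_integrable mesh_set_integrable]) (use assms in auto)

text \<open>Young's inequality under the integral, for both signs of the integrand. The weight
  \<open>c\<close> is left open and becomes \<open>diameter G / (2 * C)\<close> in
  \<open>coercivity\<close>.\<close>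

lemma consistency_bound:
  assumes G: "G \<in> mesh_faces \<T>" and c: "c > 0"
  shows "2 * \<bar>consistency G\<bar> \<le> c * mean_sq G + jump_sq G / c"
proof -
  have young: "2 * \<bar>A \<bullet> J\<bar> \<le> c * (norm A)\<^sup>2 + (norm J)\<^sup>2 / c" for A J :: "complex^'n^'n"
  proof -
    have "0 \<le> (sqrt c * norm A - norm J / sqrt c)\<^sup>2" by simp
    also have "\<dots> = c * (norm A)\<^sup>2 + (norm J)\<^sup>2 / c - 2 * (norm A * norm J)"
      using c by (simp add: power2_diff power_mult_distrib power_divide)
    finally show ?thesis using Cauchy_Schwarz_ineq2[of A J] by linarith
  qed
  note ci = face_continuity(1,2)[of G]
  have cM: "continuous_on G (\<lambda>x. c * (norm (mean_grad G x))\<^sup>2)" "continuous_on G (\<lambda>x. (norm (jump G x))\<^sup>2 / c)"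
    using c by (auto intro!: continuous_intros ci)
  have R: "face_int G (\<lambda>x. c * (norm (mean_grad G x))\<^sup>2 + (norm (jump G x))\<^sup>2 / c) = c * mean_sq G + jump_sq G / c"
    using set_integral_add(2)[OF mesh_set_integrable[OF G cM(1)] mesh_set_integrable[OF G cM(2)]]
    by (simp add: mean_sq_def jump_sq_def set_integral_mult_right set_integral_divide_zero)
  have "2 * consistency G = face_int G (\<lambda>x. 2 * (mean_grad G x \<bullet> jump G x))"
    unfolding consistency_def by (rule set_integral_mult_right[symmetric])
  also have "\<dots> \<le> face_int G (\<lambda>x. c * (norm (mean_grad G x))\<^sup>2 + (norm (jump G x))\<^sup>2 / c)"
  proof (rule face_int_mono[OF G])
    show "2 * (mean_grad G x \<bullet> jump G x) \<le> c * (norm (mean_grad G x))\<^sup>2 + (norm (jump G x))\<^sup>2 / c" for x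
      using young[of "mean_grad G x" "jump G x"] by linarith
  qed (intro continuous_intros ci cM)+
  finally have 1: "2 * consistency G \<le> c * mean_sq G + jump_sq G / c" unfolding R .
  have "(-2) * consistency G = face_int G (\<lambda>x. (-2) * (mean_grad G x \<bullet> jump G x))"
    unfolding consistency_def by (rule set_integral_mult_right[symmetric])
  also have "\<dots> \<le> face_int G (\<lambda>x. c * (norm (mean_grad G x))\<^sup>2 + (norm (jump G x))\<^sup>2 / c)"
  proof (rule face_int_mono[OF G])
    show "(-2) * (mean_grad G x \<bullet> jump G x) \<le> c * (norm (mean_grad G x))\<^sup>2 + (norm (jump G x))\<^sup>2 / c" for x
      using young[of "mean_grad G x" "jump G x"] by linarith
  qed (intro continuous_intros ci cM)+
  finally have 2: "(-2) * consistency G \<le> c * mean_sq G + jump_sq G / c" unfolding R .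
  show ?thesis using 1 2 by linarith
qed

text \<open>By Cauchy-Schwarz the square of a mean over N simplices is at most the sum of the
  squares over N, hence at most the sum; this treats interior and boundary faces alike.\<close>

lemma mean_sq_bound:
  assumes G: "G \<in> mesh_faces \<T>"
  shows "diameter G * mean_sq G \<le> (\<Sum>\<tau>\<in>adjacent \<T> G. trace_const * energy \<tau>)"
proof -
  let ?A = "adjacent \<T> G"
  have finA: "finite ?A" using finite_mesh by (simp add: adjacent_def)
  have "?A \<noteq> {}" using G unfolding mesh_faces_def adjacent_def by blast
  then have N: "1 \<le> real (card ?A)" using finA by (simp add: Suc_le_eq card_gt_0_iff)
  have pt: "(norm (mean_grad G x))\<^sup>2 \<le> (\<Sum>\<tau>\<in>?A. (norm (grad (U \<tau>) x))\<^sup>2)" for x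
  proof -
    let ?s = "\<Sum>\<tau>\<in>?A. (norm (grad (U \<tau>) x))\<^sup>2" and ?N = "real (card ?A)"
    have s0: "0 \<le> ?s" by (intro sum_nonneg) simp
    have "(norm (\<Sum>\<tau>\<in>?A. grad (U \<tau>) x))\<^sup>2 \<le> (\<Sum>\<tau>\<in>?A. norm (grad (U \<tau>) x))\<^sup>2"
      by (intro power_mono norm_sum) simp
    also have "\<dots> \<le> ?s * ?N" by (rule sum_squared_le_sum_of_squares)
    finally have "(norm (\<Sum>\<tau>\<in>?A. grad (U \<tau>) x))\<^sup>2 \<le> ?s * ?N" .
    then have "(norm (mean_grad G x))\<^sup>2 \<le> ?s * ?N / ?N\<^sup>2"
      unfolding mean_grad_def by (simp add: power_divide divide_right_mono)
    also have "\<dots> = ?s / ?N" using N by (simp add: power2_eq_square)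
    also have "\<dots> \<le> ?s / 1" using N s0 by (intro divide_left_mono) auto
    finally show ?thesis by simp
  qed
  have cg: "continuous_on G (\<lambda>x. (norm (grad (U \<tau>) x))\<^sup>2)" if "\<tau> \<in> ?A" for \<tau>
    by (intro continuous_intros continuous_grad_U adjacentD(1)[OF that])
  have "mean_sq G \<le> face_int G (\<lambda>x. \<Sum>\<tau>\<in>?A. (norm (grad (U \<tau>) x))\<^sup>2)"
    unfolding mean_sq_def
  proof (rule face_int_mono[OF G _ _ pt])
    show "continuous_on G (\<lambda>x. (norm (mean_grad G x))\<^sup>2)" by (intro continuous_intros face_continuity)
    show "continuous_on G (\<lambda>x. \<Sum>\<tau>\<in>?A. (norm (grad (U \<tau>) x))\<^sup>2)" by (intro continuous_on_sum cg)
  qed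
  also have "\<dots> = (\<Sum>\<tau>\<in>?A. face_int G (\<lambda>x. (norm (grad (U \<tau>) x))\<^sup>2))"
    unfolding set_lebesgue_integral_def scaleR_sum_right
    using mesh_set_integrable[OF G cg] by (intro Bochner_Integration.integral_sum) (simp add: set_integrable_def)
  finally have "diameter G * mean_sq G \<le> diameter G * (\<Sum>\<tau>\<in>?A. face_int G (\<lambda>x. (norm (grad (U \<tau>) x))\<^sup>2))"
    using facet_diameter_pos[OF G] by (intro mult_left_mono) auto
  also have "\<dots> = (\<Sum>\<tau>\<in>?A. diameter G * face_int G (\<lambda>x. (norm (grad (U \<tau>) x))\<^sup>2))"
    by (rule sum_distrib_left)
  also have "\<dots> \<le> (\<Sum>\<tau>\<in>?A. trace_const * energy \<tau>)"
    by (intro sum_mono trace_inequality adjacentD)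
  finally show ?thesis .
qed

text \<open>After exchanging the sums, every simplex is counted once for each of its d + 1
  facets.\<close>

lemma sum_mean_sq_bound:
  "(\<Sum>G\<in>mesh_faces \<T>. diameter G * mean_sq G) \<le> real (Suc CARD('n)) * trace_const * (\<Sum>\<tau>\<in>\<T>. energy \<tau>)"
proof -
  have "(\<Sum>G\<in>mesh_faces \<T>. diameter G * mean_sq G) \<le> (\<Sum>G\<in>mesh_faces \<T>. \<Sum>\<tau>\<in>adjacent \<T> G. trace_const * energy \<tau>)"
    by (intro sum_mono mean_sq_bound)
  also have "\<dots> = (\<Sum>\<tau>\<in>\<T>. \<Sum>G | G facet_of \<tau>. trace_const * energy \<tau>)"
    by (rule sum_adjacent_swap)
  also have "\<dots> = (\<Sum>\<tau>\<in>\<T>. real (Suc CARD('n)) * (trace_const * energy \<tau>))"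
    by (intro sum.cong refl) (simp only: sum_constant card_facets)
  also have "\<dots> = real (Suc CARD('n)) * trace_const * (\<Sum>\<tau>\<in>\<T>. energy \<tau>)"
    by (simp only: sum_distrib_left mult.assoc)
  finally show ?thesis .
qed

lemma jump_sq_nonneg: "0 \<le> jump_sq G"
  unfolding jump_sq_def by (rule face_int_nonneg) simp

lemma dg_norm_square:
  assumes "\<gamma> \<ge> 0"
  shows "(dg_norm \<gamma> \<T> u)\<^sup>2 = (\<Sum>\<tau>\<in>\<T>. energy \<tau>) + \<gamma> * (\<Sum>G\<in>mesh_faces \<T>. jump_sq G / diameter G)"
proof -
  have "face_int G (\<lambda>x. \<gamma> / diameter G * (norm (full_jump \<T> G u x))\<^sup>2) = \<gamma> * (jump_sq G / diameter G)" for G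
  proof -
    have "face_int G (\<lambda>x. \<gamma> / diameter G * (norm (full_jump \<T> G u x))\<^sup>2) = face_int G (\<lambda>x. \<gamma> / diameter G * (norm (jump G x))\<^sup>2)"
      by (rule face_int_cong) (simp add: face_values)
    also have "\<dots> = \<gamma> / diameter G * jump_sq G"
      unfolding jump_sq_def by (rule set_integral_mult_right)
    finally show ?thesis by simp
  qed
  then have eq: "(\<Sum>G\<in>mesh_faces \<T>. face_int G (\<lambda>x. \<gamma> / diameter G * (norm (full_jump \<T> G u x))\<^sup>2))
      = \<gamma> * (\<Sum>G\<in>mesh_faces \<T>. jump_sq G / diameter G)"
    unfolding sum_distrib_left by (rule sum.cong[OF refl])
  have "0 \<le> (\<Sum>\<tau>\<in>\<T>. energy \<tau>)" by (intro sum_nonneg energy_nonneg)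
  moreover have "0 \<le> (\<Sum>G\<in>mesh_faces \<T>. jump_sq G / diameter G)"
    by (intro sum_nonneg divide_nonneg_pos jump_sq_nonneg facet_diameter_pos)
  ultimately show ?thesis
    unfolding dg_norm_def eq using assms by (intro real_sqrt_pow2) simp
qed

text \<open>The integrands of the two consistency terms are conjugate to each other, so their real
  parts coincide and combine to the factor 1 - \<theta>; the convective terms are gone by
  \<open>convection_cancels\<close>.\<close>

lemma Re_dg_form:
  "Re (dg_form \<mu> \<beta> \<theta> \<gamma> \<T> u u) = \<mu> * (\<Sum>\<tau>\<in>\<T>. energy \<tau>) - (1 - \<theta>) * \<mu> * (\<Sum>G\<in>mesh_faces \<T>. consistency G)
     + \<gamma> * (\<Sum>G\<in>mesh_faces \<T>. jump_sq G / diameter G)"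
proof -
  have t1: "Re (\<Sum>\<tau>\<in>\<T>. LINT x:\<tau>|lebesgue. complex_of_real \<mu> * cddot (grad u x) (grad u x)) = \<mu> * (\<Sum>\<tau>\<in>\<T>. energy \<tau>)"
    unfolding Re_sum sum_distrib_left
  proof (rule sum.cong[OF refl])
    fix \<tau> assume \<tau>: "\<tau> \<in> \<T>"
    obtain S where S: "full_simplex S" "\<tau> = convex hull S" using \<tau> by (rule simplexE)
    have "set_integrable lebesgue \<tau> (\<lambda>x. complex_of_real \<mu> * cddot (grad u x) (grad u x))"
      unfolding S(2)
    proof (rule full_simplex.simplex_set_integral(1)[OF S(1)])
      show "continuous_on (convex hull S) (\<lambda>x. complex_of_real \<mu> * cddot (grad (U \<tau>) x) (grad (U \<tau>) x))"
        by (intro continuous_intros continuous_grad_U \<tau>)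
      show "complex_of_real \<mu> * cddot (grad u x) (grad u x) = complex_of_real \<mu> * cddot (grad (U \<tau>) x) (grad (U \<tau>) x)"
        if "x \<in> interior (convex hull S)" for x
        using grad_eq[OF \<tau>] that unfolding S(2) by simp
    qed
    then have "Re (LINT x:\<tau>|lebesgue. complex_of_real \<mu> * cddot (grad u x) (grad u x))
       = (LINT x:\<tau>|lebesgue. Re (complex_of_real \<mu> * cddot (grad u x) (grad u x)))" by (rule Re_set_integral)
    also have "\<dots> = (LINT x:\<tau>|lebesgue. \<mu> * (norm (grad u x))\<^sup>2)"
      by (simp add: Re_cddot power2_norm_eq_inner)
    also have "\<dots> = \<mu> * energy \<tau>" by (rule set_integral_mult_right)
    finally show "Re (LINT x:\<tau>|lebesgue. complex_of_real \<mu> * cddot (grad u x) (grad u x)) = \<mu> * energy \<tau>" .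
  qed
  have faces: "Re (face_int G (\<lambda>x. complex_of_real c * cddot (X x) (Y x))) = c * face_int G (\<lambda>x. X' x \<bullet> Y' x)"
    if "G \<in> mesh_faces \<T>" "\<And>x. x \<in> G \<Longrightarrow> X x = X' x" "\<And>x. x \<in> G \<Longrightarrow> Y x = Y' x" "continuous_on G X'" "continuous_on G Y'"
    for G c and X X' Y Y' :: "real^'n \<Rightarrow> complex^'n^'n"
  proof -
    have "Re (face_int G (\<lambda>x. complex_of_real c * cddot (X x) (Y x))) = Re (face_int G (\<lambda>x. complex_of_real c * cddot (X' x) (Y' x)))"
      by (intro arg_cong[where f=Re] face_int_cong) (simp add: that(2,3))
    also have "\<dots> = face_int G (\<lambda>x. Re (complex_of_real c * cddot (X' x) (Y' x)))"
      by (intro Re_face_int that(1) continuous_intros that(4,5))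
    also have "\<dots> = face_int G (\<lambda>x. c * (X' x \<bullet> Y' x))" by (simp add: Re_cddot)
    also have "\<dots> = c * face_int G (\<lambda>x. X' x \<bullet> Y' x)" by (rule set_integral_mult_right)
    finally show ?thesis .
  qed
  have t3: "Re (\<Sum>G\<in>mesh_faces \<T>. face_int G (\<lambda>x. complex_of_real \<mu> * cddot (mean \<T> G (grad u) x) (full_jump \<T> G u x)))
     = \<mu> * (\<Sum>G\<in>mesh_faces \<T>. consistency G)"
    unfolding Re_sum sum_distrib_left consistency_def
    by (intro sum.cong refl faces face_values face_continuity)
  have t4: "Re (\<Sum>G\<in>mesh_faces \<T>. face_int G (\<lambda>x. complex_of_real \<mu> * cddot (full_jump \<T> G u x) (mean \<T> G (grad u) x)))
     = \<mu> * (\<Sum>G\<in>mesh_faces \<T>. consistency G)"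
    unfolding Re_sum sum_distrib_left consistency_def inner_commute[of "mean_grad _ _"]
    by (intro sum.cong refl faces face_values face_continuity)
  have t5: "Re (\<Sum>G\<in>mesh_faces \<T>. face_int G (\<lambda>x. complex_of_real (\<gamma> / diameter G) * cddot (full_jump \<T> G u x) (full_jump \<T> G u x)))
     = \<gamma> * (\<Sum>G\<in>mesh_faces \<T>. jump_sq G / diameter G)"
  proof -
    have "Re (\<Sum>G\<in>mesh_faces \<T>. face_int G (\<lambda>x. complex_of_real (\<gamma> / diameter G) * cddot (full_jump \<T> G u x) (full_jump \<T> G u x)))
       = (\<Sum>G\<in>mesh_faces \<T>. \<gamma> / diameter G * jump_sq G)"
      unfolding Re_sum jump_sq_def power2_norm_eq_inner
      by (intro sum.cong refl faces face_values face_continuity)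
    then show ?thesis by (simp add: sum_distrib_left)
  qed
  have half: "Re (1 / 2 * z) = 1 / 2 * Re z" for z by simp
  have thet: "Re (complex_of_real \<theta> * z) = \<theta> * Re z" for z by simp
  show ?thesis
    unfolding dg_form_def minus_complex.sel plus_complex.sel half thet t1 t3 t4 t5
    using convection_cancels by (simp add: algebra_simps)
qed

text \<open>Since 1 - \<theta> \<le> 2, the consistency terms cost at most \<mu> (E / 2 + 2 C J),
  where E is the gradient part and J the jump part. Half of \<mu> E survives, and \<gamma> \<ge> 4 C
  \<mu> leaves at least half of \<gamma> J.\<close>

lemma coercivity:
  assumes \<mu>: "\<mu> > 0" and \<theta>: "-1 \<le> \<theta>" "\<theta> \<le> 1"
    and C: "C > 0" "real (Suc CARD('n)) * trace_const \<le> C" and \<gamma>: "\<gamma> \<ge> 4 * C * \<mu>"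
  shows "Re (dg_form \<mu> \<beta> \<theta> \<gamma> \<T> u u) \<ge> min (\<mu> / 2) (1 / 2) * (dg_norm \<gamma> \<T> u)\<^sup>2"
proof -
  let ?E = "\<Sum>\<tau>\<in>\<T>. energy \<tau>" and ?J = "\<Sum>G\<in>mesh_faces \<T>. jump_sq G / diameter G"
    and ?N = "\<Sum>G\<in>mesh_faces \<T>. consistency G"
  have E0: "0 \<le> ?E" by (intro sum_nonneg energy_nonneg)
  have J0: "0 \<le> ?J" by (intro sum_nonneg divide_nonneg_pos jump_sq_nonneg facet_diameter_pos)
  have "0 < 4 * C * \<mu>" using C \<mu> by simp
  then have \<gamma>0: "0 < \<gamma>" using \<gamma> by linarith
  have "2 * \<bar>?N\<bar> \<le> (\<Sum>G\<in>mesh_faces \<T>. 2 * \<bar>consistency G\<bar>)"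
    unfolding sum_distrib_left[symmetric] by (intro mult_left_mono sum_abs) simp
  also have "\<dots> \<le> (\<Sum>G\<in>mesh_faces \<T>. 1 / (2 * C) * (diameter G * mean_sq G) + 2 * C * (jump_sq G / diameter G))"
  proof (rule sum_mono)
    fix G assume G: "G \<in> mesh_faces \<T>"
    have d: "0 < diameter G" using G by (rule facet_diameter_pos)
    \<comment> \<open>The diameter in the Young weight matches the one in the trace inequality, and
      the divisor 2 C reduces the summed gradient terms to half of the energy.\<close>
    have "2 * \<bar>consistency G\<bar> \<le> diameter G / (2 * C) * mean_sq G + jump_sq G / (diameter G / (2 * C))"
      using C d by (intro consistency_bound[OF G]) simp
    then show "2 * \<bar>consistency G\<bar> \<le> 1 / (2 * C) * (diameter G * mean_sq G) + 2 * C * (jump_sq G / diameter G)"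
      by (simp add: mult.commute)
  qed
  also have "\<dots> = 1 / (2 * C) * (\<Sum>G\<in>mesh_faces \<T>. diameter G * mean_sq G) + 2 * C * ?J"
    unfolding sum.distrib sum_distrib_left ..
  also have "\<dots> \<le> 1 / (2 * C) * (C * ?E) + 2 * C * ?J"
  proof -
    have "(\<Sum>G\<in>mesh_faces \<T>. diameter G * mean_sq G) \<le> C * ?E"
      using sum_mean_sq_bound mult_right_mono[OF C(2) E0] by linarith
    then show ?thesis using C by (intro add_right_mono mult_left_mono) auto
  qed
  also have "\<dots> = ?E / 2 + 2 * C * ?J" using C by simp
  finally have N: "2 * \<bar>?N\<bar> \<le> ?E / 2 + 2 * C * ?J" .
  have "(1 - \<theta>) * ?N \<le> \<bar>(1 - \<theta>) * ?N\<bar>" by (rule abs_ge_self)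
  also have "\<dots> = (1 - \<theta>) * \<bar>?N\<bar>" using \<theta> by (simp add: abs_mult)
  also have "\<dots> \<le> 2 * \<bar>?N\<bar>" using \<theta> by (intro mult_right_mono) auto
  finally have "\<mu> * ((1 - \<theta>) * ?N) \<le> \<mu> * (?E / 2 + 2 * C * ?J)"
    using N \<mu> by (intro mult_left_mono) auto
  then have low: "Re (dg_form \<mu> \<beta> \<theta> \<gamma> \<T> u u) \<ge> \<mu> / 2 * ?E + (\<gamma> - 2 * C * \<mu>) * ?J"
    unfolding Re_dg_form by (simp add: algebra_simps)
  have "(\<gamma> - 2 * C * \<mu>) * ?J \<ge> \<gamma> / 2 * ?J"
    using \<gamma> J0 by (intro mult_right_mono) auto
  moreover have "\<mu> / 2 * ?E \<ge> min (\<mu> / 2) (1 / 2) * ?E" using E0 by (intro mult_right_mono) auto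
  moreover have "\<gamma> / 2 * ?J \<ge> min (\<mu> / 2) (1 / 2) * (\<gamma> * ?J)"
  proof -
    have "min (\<mu> / 2) (1 / 2) * (\<gamma> * ?J) \<le> 1 / 2 * (\<gamma> * ?J)" using \<gamma>0 J0 by (intro mult_right_mono) auto
    then show ?thesis by simp
  qed
  ultimately show ?thesis
    unfolding dg_norm_square[OF less_imp_le[OF \<gamma>0]] distrib_left using low by linarith
qed

end

theorem lemma2p1:
  fixes \<Omega> :: "(real^'n) set"
    and \<mu> \<theta> :: real
    and \<beta> :: "real^'n \<Rightarrow> real^'n"
    and \<M> :: "(real^'n) set set set"
    and k :: nat
  assumes "CARD('n) \<in> {2, 3}"
    and "bounded \<Omega>" and "polyhedral_domain \<Omega>"
    and "\<mu> > 0"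
    and "W1_infty_field \<Omega> \<beta>" and "divergence_free \<Omega> \<beta>"
    and "\<forall>\<T>\<in>\<M>. simplicial_mesh \<Omega> \<T>" and "shape_regular \<M>"
    and "k \<ge> 1"
    and "\<theta> \<in> {-1, 0, 1}"
  shows "\<exists>\<gamma>\<^sub>0>0. \<forall>\<gamma>\<ge>\<gamma>\<^sub>0. \<exists>\<mu>\<^sub>0>0. \<forall>\<T>\<in>\<M>. \<forall>u\<in>dg_space \<Omega> \<T> k.
           Re (dg_form \<mu> \<beta> \<theta> \<gamma> \<T> u u) \<ge> \<mu>\<^sub>0 * (dg_norm \<gamma> \<T> u)\<^sup>2"
proof -
  obtain \<sigma> where \<sigma>: "\<sigma> > 0" "\<forall>\<T>\<in>\<M>. \<forall>\<tau>\<in>\<T>. diameter \<tau> \<le> \<sigma> * inball_diameter \<tau>"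
    using \<open>shape_regular \<M>\<close> unfolding shape_regular_def by blast
  obtain a :: "nat \<Rightarrow> real" where a: "a 0 = 1"
    "\<forall>q :: complex poly. degree q \<le> k \<longrightarrow> (\<Sum>i\<le>Suc k. of_real (a i) * poly q (of_nat i)) = 0"
    using poly_difference_coeffs[of k] by blast
  \<comment> \<open>Fixed before any mesh or function, hence independent of h. Adding 1 makes
    \<open>C\<close> positive, since the Young weight divides by it.\<close>
  define C where "C = real (Suc CARD('n)) * (\<sigma> * ((\<Sum>i\<le>k. (a (Suc i))\<^sup>2) * (real (Suc k))\<^sup>2 * 2 ^ CARD('n))) + 1"
  have C: "C > 0"
    unfolding C_def using \<sigma>(1)
    by (intro add_nonneg_pos mult_nonneg_nonneg sum_nonneg) auto
  show ?thesis
  proof (rule exI[of _ "4 * C * \<mu>"], intro conjI allI impI)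
    show "0 < 4 * C * \<mu>" using C \<open>\<mu> > 0\<close> by simp
    fix \<gamma> assume \<gamma>: "4 * C * \<mu> \<le> \<gamma>"
    show "\<exists>\<mu>\<^sub>0>0. \<forall>\<T>\<in>\<M>. \<forall>u\<in>dg_space \<Omega> \<T> k. \<mu>\<^sub>0 * (dg_norm \<gamma> \<T> u)\<^sup>2 \<le> Re (dg_form \<mu> \<beta> \<theta> \<gamma> \<T> u u)"
    \<comment> \<open>The surviving shares of the gradient part and of the penalty; the constant is
      the same for all admissible \<gamma>.\<close>
    proof (rule exI[of _ "min (\<mu> / 2) (1 / 2)"], intro conjI ballI)
      show "0 < min (\<mu> / 2) (1 / 2)" using \<open>\<mu> > 0\<close> by simp
      fix \<T> u assume \<T>: "\<T> \<in> \<M>" and u: "u \<in> dg_space \<Omega> \<T> k"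
      interpret dg_function \<Omega> \<beta> \<T> k u \<sigma> a
      proof
        show "2 \<le> CARD('n)" using assms(1) by auto
        show "simplicial_mesh \<Omega> \<T>" using assms(7) \<T> by blast
        show "diameter \<tau> \<le> \<sigma> * inball_diameter \<tau>" if "\<tau> \<in> \<T>" for \<tau> using \<sigma>(2) \<T> that by blast
        show "(\<Sum>i\<le>Suc k. of_real (a i) * poly q (of_nat i)) = 0" if "degree q \<le> k" for q :: "complex poly"
          using a(2) that by blast
      qed (fact assms \<sigma>(1) a(1) u)+
      have "real (Suc CARD('n)) * trace_const \<le> C" unfolding C_def trace_const_def by simp
      moreover have "-1 \<le> \<theta>" "\<theta> \<le> 1" using assms(10) by auto
      ultimately show "min (\<mu> / 2) (1 / 2) * (dg_norm \<gamma> \<T> u)\<^sup>2 \<le> Re (dg_form \<mu> \<beta> \<theta> \<gamma> \<T> u u)"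
        using \<open>\<mu> > 0\<close> C \<gamma> by (intro coercivity)
    qed
  qed
qed

end
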